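(* Let $\rho:\mathbb{F}_2\to \mathrm{SL}(2,\mathbb{C})$ be an irreducible representation satisfying the BQ-conditions. Then $\rho$ admits finitely many minimal carrier $2$-graphs.
   Context: $\mathbb{F}_2$ is the free group of rank two; a basis is an ordered pair $(X,Y)$ freely generating $\mathbb{F}_2$; an element is primitive if it belongs to a basis. $\mathrm{Inn}^{\mathfrak e}(\mathbb{F}_2)\subset\mathrm{Aut}(\mathbb{F}_2)$ is the subgroup generated by the inner automorphisms and the elliptic involutions $\mathfrak e_{(X,Y)}$ ($X\mapsto X^{-1}$, $Y\mapsto Y^{-1}$) for bases $(X,Y)$. For $W\in\mathbb{F}_2$, $[W]$ is its $\mathrm{Inn}^{\mathfrak e}(\mathbb{F}_2)$-orbit; $\Omega$ is the set of all $[W]$ with $W$ primitive. A representation $\rho:\mathbb{F}_2\to\mathrm{SL}(2,\mathbb{C})$ is irreducible if no non-trivial proper subspace of $\mathbb{C}^2$ is invariant. Its trace function is $f_\rho:\Omega\to\mathbb{C}$, $f_\rho([W])=\mathrm{tr}\,\rho(W)$. An irreducible $\rho$ satisfies the BQ-conditions if (1) $f_\rho^{-1}([-2,2])=\emptyset$ and (2) $|f_\rho|^{-1}([0,2])$ is finite. $\mathrm{SL}(2,\mathbb{C})$ acts on $\mathbb{H}^3$ by orientation preserving isometries. A $2$-graph is a connected finite trivalent graph of rank $2$. There are two combinatorial types: the buckle (theta graph: two vertices joined by three edges) and the dumbbell (two vertices, each carrying a loop edge, joined by one edge). Fix a basis $(X_0,Y_0)$ of $\mathbb{F}_2$. A marking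 is given by assigning a free basis to two distinct simple loops of the graph. Fix once and for all one graph $\Gamma$ of each of the two types, with marking $(X_0,Y_0)$, which identifies $\pi_1(\Gamma)$ with $\mathbb{F}_2$: for the buckle with edges $a,b,c$ oriented from one vertex to the other take $X_0=ac^{-1}$, $Y_0=bc^{-1}$; for the dumbbell, with loops $\ell_1,\ell_2$ and bridge $e$ from the vertex of $\ell_1$ to that of $\ell_2$, take $X_0=\ell_1$, $Y_0=e\ell_2e^{-1}$. From now on "$2$-graph" means one of these two models. $\mathbb{F}_2$ acts on the universal cover $\widetilde\Gamma$ by deck transformations. A map $\Psi:\widetilde\Gamma\to\mathbb{H}^3$ which is a local homeomorphism (onto its image) is $\rho$-equivariant if there is a basis $(X,Y)$ of $\mathbb{F}_2$ such that, with $h_\Psi\in\mathrm{Aut}(\mathbb{F}_2)$ the automorphism sending $X_0\mapsto X$, $Y_0\mapsto Y$, one has $\Psi(W\cdot x)=\rho(h_\Psi(W))\Psi(x)$ for all $W\in\mathbb{F}_2$, $x\in\widetilde\Gamma$. Such an automorphism $h_\Psi$ is understood as part of the data of $\Psi$. A marked carrier $2$-graph for $\rho$ is a pair $(\Gamma,\Psi)$ with $\Gamma$ a $2$-graph and $\Psi$ such a $\rho$-equivariant map. Pulling back by $\Psi$ the intrinsic metric of $\Psi(\widetilde\Gamma)$ (induced by the hyperbolic metric) gives a metric on $\Gamma$; the length $L(\Gamma,\Psi)$ is the sum of the lengths of the edges of $\Gamma$ in this metric. Two marked carrier $2$-graphs $(\Gamma_1,\Psi_1)$, $(\Gamma_2,\Psi_2)$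 are equivalent if (1) $\Gamma_1$ and $\Gamma_2$ are the same $2$-graph; (2) there is $W\in\mathbb{F}_2$ with $\mathrm{Im}(\Psi_1)=\rho(W)(\mathrm{Im}(\Psi_2))$; (3) $h_{\Psi_2}=h'h_{\Psi_1}$ for some $h'\in\mathrm{Inn}^{\mathfrak e}(\mathbb{F}_2)$. An equivalence class $(\Gamma,[\Psi])$ is a carrier $2$-graph for $\rho$; its length is $L(\Gamma,\Psi)$ for a representative. A carrier $2$-graph is geodesic if $\Psi$ sends every edge of $\widetilde\Gamma$ to a geodesic segment of strictly positive length; $\mathcal{CG}_\rho$ denotes the set of geodesic carrier $2$-graphs of $\rho$. A carrier $2$-graph in $\mathcal{CG}_\rho$ is minimal if it has the minimal length among all carrier $2$-graphs for $\rho$. *)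

theory Defs
  imports "HOL-Analysis.Analysis" "HOL-Algebra.Bij" "HOL-Algebra.Generated_Groups"
begin

section \<open>The free group of rank two\<close>

datatype gen = GX | GY

text \<open>The letter \<open>(a, True)\<close> stands for the generator \<open>a\<close>, and \<open>(a, False)\<close> for its inverse.\<close>

type_synonym letter = "gen \<times> bool"

fun reduced :: "letter list \<Rightarrow> bool" where
  "reduced (k # l # w) \<longleftrightarrow> \<not> (fst k = fst l \<and> snd k \<noteq> snd l) \<and> reduced (l # w)"
| "reduced _ \<longleftrightarrow> True"

fun letter_val :: "('g, 'm) monoid_scheme \<Rightarrow> 'g \<Rightarrow> 'g \<Rightarrow> letter \<Rightarrow> 'g" where
  "letter_val G X Y (GX, s) = (if s then X else inv\<^bsub>G\<^esub> X)"
| "letter_val G X Y (GY, s) = (if s then Y else inv\<^bsub>G\<^esub> Y)"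

definition word_val :: "('g, 'm) monoid_scheme \<Rightarrow> 'g \<Rightarrow> 'g \<Rightarrow> letter list \<Rightarrow> 'g" where
  "word_val G X Y w = foldr (\<lambda>l g. letter_val G X Y l \<otimes>\<^bsub>G\<^esub> g) w \<one>\<^bsub>G\<^esub>"

text \<open>Every element is the value of exactly one reduced word in \<open>X\<close> and \<open>Y\<close>. In particular
  \<open>G\<close> is a free group of rank two as soon as it is a group with some such pair.\<close>

definition free_basis :: "('g, 'm) monoid_scheme \<Rightarrow> 'g \<Rightarrow> 'g \<Rightarrow> bool" where
  "free_basis G X Y \<longleftrightarrow> X \<in> carrier G \<and> Y \<in> carrier G \<and>
     bij_betw (word_val G X Y) {w. reduced w} (carrier G)"

definition primitive_elem :: "('g, 'm) monoid_scheme \<Rightarrow> 'g \<Rightarrow> bool" where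
  "primitive_elem G W \<longleftrightarrow> (\<exists>V. free_basis G W V \<or> free_basis G V W)"

definition inner_autos :: "('g, 'm) monoid_scheme \<Rightarrow> ('g \<Rightarrow> 'g) set" where
  "inner_autos G = {(\<lambda>g\<in>carrier G. x \<otimes>\<^bsub>G\<^esub> g \<otimes>\<^bsub>G\<^esub> inv\<^bsub>G\<^esub> x) | x. x \<in> carrier G}"

definition elliptic_involutions :: "('g, 'm) monoid_scheme \<Rightarrow> ('g \<Rightarrow> 'g) set" where
  "elliptic_involutions G =
     {\<phi> \<in> auto G. \<exists>X Y. free_basis G X Y \<and> \<phi> X = inv\<^bsub>G\<^esub> X \<and> \<phi> Y = inv\<^bsub>G\<^esub> Y}"

definition Inn_e :: "('g, 'm) monoid_scheme \<Rightarrow> ('g \<Rightarrow> 'g) set" where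
  "Inn_e G = generate (AutoGroup G) (inner_autos G \<union> elliptic_involutions G)"

definition Inn_e_class :: "('g, 'm) monoid_scheme \<Rightarrow> 'g \<Rightarrow> 'g set" where
  "Inn_e_class G W = {\<phi> W | \<phi>. \<phi> \<in> Inn_e G}"

definition Omega :: "('g, 'm) monoid_scheme \<Rightarrow> 'g set set" where
  "Omega G = Inn_e_class G ` {W \<in> carrier G. primitive_elem G W}"


section \<open>Representations into SL(2,C)\<close>

definition SL2C :: "(complex^2^2) monoid" where
  "SL2C = \<lparr>carrier = {A. det A = 1}, mult = (**), one = mat 1\<rparr>"

definition irreducible_rep :: "('g, 'm) monoid_scheme \<Rightarrow> ('g \<Rightarrow> complex^2^2) \<Rightarrow> bool" where
  "irreducible_rep G \<rho> \<longleftrightarrow>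
     (\<forall>V :: (complex^2) set. vec.subspace V \<and> (\<forall>g\<in>carrier G. \<forall>v\<in>V. \<rho> g *v v \<in> V)
        \<longrightarrow> V = {0} \<or> V = UNIV)"

text \<open>For a representation into \<open>SL2C\<close> the trace is constant on each class in \<open>Omega G\<close>, so the
  choice of the representative is immaterial.\<close>

definition trace_fun :: "('g \<Rightarrow> complex^2^2) \<Rightarrow> 'g set \<Rightarrow> complex" where
  "trace_fun \<rho> C = trace (\<rho> (SOME W. W \<in> C))"

definition BQ_conditions :: "('g, 'm) monoid_scheme \<Rightarrow> ('g \<Rightarrow> complex^2^2) \<Rightarrow> bool" where
  "BQ_conditions G \<rho> \<longleftrightarrow>
     {C \<in> Omega G. trace_fun \<rho> C \<in> complex_of_real ` {-2..2}} = {} \<and>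
     finite {C \<in> Omega G. cmod (trace_fun \<rho> C) \<in> {0..2}}"


section \<open>Hyperbolic space and lengths of curves\<close>

text \<open>Upper half-space model: \<open>(z, t)\<close> stands for the quaternion \<open>z + t j\<close>. The hyperbolic
  metric induces the Euclidean topology.\<close>

type_synonym point3 = "complex \<times> real"

definition H3 :: "point3 set" where
  "H3 = {(z, t). t > 0}"

definition hdist :: "point3 \<Rightarrow> point3 \<Rightarrow> real" where
  "hdist p q = arcosh (1 + ((cmod (fst p - fst q))\<^sup>2 + (snd p - snd q)\<^sup>2) / (2 * snd p * snd q))"

text \<open>The Poincare extension \<open>x \<mapsto> (a x + b) (c x + d)\<^sup>-\<^sup>1\<close>, computed in the quaternions.\<close>

definition SL2C_act :: "complex^2^2 \<Rightarrow> point3 \<Rightarrow> point3" where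
  "SL2C_act A p =
     (let a = A $ 1 $ 1; b = A $ 1 $ 2; c = A $ 2 $ 1; d = A $ 2 $ 2;
          z = fst p; t = snd p;
          N = (cmod (c * z + d))\<^sup>2 + (cmod c)\<^sup>2 * t\<^sup>2
      in (((a * z + b) * cnj (c * z + d) + a * cnj c * of_real (t\<^sup>2)) / of_real N, t / N))"

text \<open>Length of a curve on \<open>[0,1]\<close> with respect to an extended metric \<open>d\<close>: the supremum over all
  finite subdivisions.\<close>

definition curve_length :: "('a \<Rightarrow> 'a \<Rightarrow> ennreal) \<Rightarrow> (real \<Rightarrow> 'a) \<Rightarrow> ennreal" where
  "curve_length d \<gamma> =
     (SUP ts \<in> {ts. sorted ts \<and> set ts \<subseteq> {0..1}}.
        \<Sum>i < length ts - 1. d (\<gamma> (ts ! i)) (\<gamma> (ts ! Suc i)))"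

text \<open>The intrinsic metric of a subset \<open>S\<close> of hyperbolic space; it is infinite if no rectifiable
  path in \<open>S\<close> joins the two points.\<close>

definition intrinsic_dist :: "point3 set \<Rightarrow> point3 \<Rightarrow> point3 \<Rightarrow> ennreal" where
  "intrinsic_dist S p q =
     (INF \<gamma> \<in> {\<gamma>. path \<gamma> \<and> path_image \<gamma> \<subseteq> S \<and> pathstart \<gamma> = p \<and> pathfinish \<gamma> = q}.
        curve_length (\<lambda>x y. ennreal (hdist x y)) \<gamma>)"

definition geodesic_segment :: "point3 set \<Rightarrow> bool" where
  "geodesic_segment S \<longleftrightarrow>
     (\<exists>l>0. \<exists>c. c ` {0..l} = S \<and> S \<subseteq> H3 \<and>
        (\<forall>s\<in>{0..l}. \<forall>t\<in>{0..l}. hdist (c s) (c t) = \<bar>s - t\<bar>))"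


section \<open>The two graphs and their universal covers\<close>

text \<open>Both graphs have two vertices and three oriented edges. In the buckle \<open>E1\<close>, \<open>E2\<close>, \<open>E3\<close>
  are \<open>a\<close>, \<open>b\<close>, \<open>c\<close>; in the dumbbell they are the loops \<open>\<ell>\<^sub>1\<close>, \<open>\<ell>\<^sub>2\<close> and the bridge \<open>e\<close>.\<close>

datatype two_graph = Buckle | Dumbbell
datatype vertex = V0 | V1
datatype edge = E1 | E2 | E3

fun src :: "two_graph \<Rightarrow> edge \<Rightarrow> vertex" where
  "src Buckle _ = V0"
| "src Dumbbell E1 = V0"
| "src Dumbbell E2 = V1"
| "src Dumbbell E3 = V0"

fun tgt :: "two_graph \<Rightarrow> edge \<Rightarrow> vertex" where
  "tgt Buckle _ = V1"
| "tgt Dumbbell E1 = V0"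
| "tgt Dumbbell E2 = V1"
| "tgt Dumbbell E3 = V1"

text \<open>The universal cover is realised as the derived graph of the voltage assignment \<open>voltage\<close>:
  vertices and edges are those of the base graph, indexed by \<open>carrier G\<close>, and the lift of \<open>e\<close> with
  index \<open>g\<close> runs from the lift of \<open>src e\<close> with index \<open>g\<close> to the lift of \<open>tgt e\<close> with index
  \<open>g\<close> times the voltage of \<open>e\<close>. In both graphs \<open>E3\<close> is a maximal tree, and the voltages of the loops
  at \<open>V0\<close> are: in the buckle, \<open>X0\<close> for \<open>a c\<^sup>-\<^sup>1\<close> and \<open>Y0\<close> for \<open>b c\<^sup>-\<^sup>1\<close>; in the dumbbell,
  \<open>X0\<close> for \<open>\<ell>\<^sub>1\<close> and \<open>Y0\<close> for \<open>e \<ell>\<^sub>2 e\<^sup>-\<^sup>1\<close>. So the voltages realise the isomorphism of the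
  fundamental group with \<open>G\<close> given by the marking \<open>(X0, Y0)\<close>; the derived graph is therefore the
  universal covering tree, and left multiplication on indices is the action by deck
  transformations.\<close>

fun voltage :: "('g, 'm) monoid_scheme \<Rightarrow> 'g \<Rightarrow> 'g \<Rightarrow> edge \<Rightarrow> 'g" where
  "voltage G X0 Y0 E1 = X0"
| "voltage G X0 Y0 E2 = Y0"
| "voltage G X0 Y0 E3 = \<one>\<^bsub>G\<^esub>"

text \<open>\<open>Inner g e t\<close>, for \<open>0 < t < 1\<close>, is the point with parameter \<open>t\<close> of the open edge with
  index \<open>g\<close> over \<open>e\<close>.\<close>

datatype 'g cover_point = Vert 'g vertex | Inner 'g edge real

definition cover_points :: "('g, 'm) monoid_scheme \<Rightarrow> 'g cover_point set" where
  "cover_points G = {Vert g v | g v. g \<in> carrier G} \<union>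
     {Inner g e t | g e t. g \<in> carrier G \<and> 0 < t \<and> t < 1}"

definition edge_path ::
  "('g, 'm) monoid_scheme \<Rightarrow> 'g \<Rightarrow> 'g \<Rightarrow> two_graph \<Rightarrow> 'g \<Rightarrow> edge \<Rightarrow> real \<Rightarrow> 'g cover_point" where
  "edge_path G X0 Y0 \<Gamma> g e t =
     (if t \<le> 0 then Vert g (src \<Gamma> e)
      else if t \<ge> 1 then Vert (g \<otimes>\<^bsub>G\<^esub> voltage G X0 Y0 e) (tgt \<Gamma> e)
      else Inner g e t)"

text \<open>The quotient topology from the disjoint union of the closed edges.\<close>

definition cover_topology ::
  "('g, 'm) monoid_scheme \<Rightarrow> 'g \<Rightarrow> 'g \<Rightarrow> two_graph \<Rightarrow> 'g cover_point topology" where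
  "cover_topology G X0 Y0 \<Gamma> = topology (\<lambda>U. U \<subseteq> cover_points G \<and>
     (\<forall>g\<in>carrier G. \<forall>e.
        openin (top_of_set {0..1}) {t \<in> {0..1}. edge_path G X0 Y0 \<Gamma> g e t \<in> U}))"

lemma openin_cover_topology:
  "openin (cover_topology G X0 Y0 \<Gamma>) U \<longleftrightarrow> U \<subseteq> cover_points G \<and>
     (\<forall>g\<in>carrier G. \<forall>e.
        openin (top_of_set {0..1}) {t \<in> {0..1}. edge_path G X0 Y0 \<Gamma> g e t \<in> U})"
proof -
  have 1: "{t \<in> {0..1}. edge_path G X0 Y0 \<Gamma> g e t \<in> S \<inter> T} =
      {t \<in> {0..1}. edge_path G X0 Y0 \<Gamma> g e t \<in> S} \<inter> {t \<in> {0..1}. edge_path G X0 Y0 \<Gamma> g e t \<in> T}"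
    for g e S T by auto
  have 2: "{t \<in> {0..1}. edge_path G X0 Y0 \<Gamma> g e t \<in> \<Union>K} =
      \<Union>((\<lambda>S. {t \<in> {0..1}. edge_path G X0 Y0 \<Gamma> g e t \<in> S}) ` K)" for g e K
    by auto
  have "istopology (\<lambda>U. U \<subseteq> cover_points G \<and>
     (\<forall>g\<in>carrier G. \<forall>e.
        openin (top_of_set {0..1}) {t \<in> {0..1}. edge_path G X0 Y0 \<Gamma> g e t \<in> U}))"
    unfolding istopology_def 1 2 by (blast intro: openin_Int openin_Union)
  then show ?thesis
    by (simp add: cover_topology_def topology_inverse')
qed

lemma topspace_cover_topology:
  assumes "group G" "X0 \<in> carrier G" "Y0 \<in> carrier G"
  shows "topspace (cover_topology G X0 Y0 \<Gamma>) = cover_points G"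
proof -
  interpret group G by fact
  have "voltage G X0 Y0 e \<in> carrier G" for e
    using assms by (cases e) auto
  then have "{t \<in> {0..1}. edge_path G X0 Y0 \<Gamma> g e t \<in> cover_points G} = {0..1}"
    if "g \<in> carrier G" for g e
    using that by (auto simp: edge_path_def cover_points_def)
  then have "openin (cover_topology G X0 Y0 \<Gamma>) (cover_points G)"
    unfolding openin_cover_topology by simp
  then show ?thesis
    by (meson openin_cover_topology openin_subset openin_topspace subset_antisym)
qed

fun deck :: "('g, 'm) monoid_scheme \<Rightarrow> 'g \<Rightarrow> 'g cover_point \<Rightarrow> 'g cover_point" where
  "deck G W (Vert g v) = Vert (W \<otimes>\<^bsub>G\<^esub> g) v"
| "deck G W (Inner g e t) = Inner (W \<otimes>\<^bsub>G\<^esub> g) e t"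


section \<open>Carrier graphs\<close>

text \<open>Every point has an open neighbourhood that is mapped homeomorphically onto its image. The image
  of the neighbourhood need not be open in the image of the whole tree, so images of distant edges
  may cross.\<close>

definition locally_homeo_onto_image :: "'a topology \<Rightarrow> ('a \<Rightarrow> point3) \<Rightarrow> bool" where
  "locally_homeo_onto_image T \<Psi> \<longleftrightarrow>
     (\<forall>x\<in>topspace T. \<exists>U. openin T U \<and> x \<in> U \<and>
        homeomorphic_map (subtopology T U) (top_of_set (\<Psi> ` U)) \<Psi>)"

definition equivariant_via ::
  "('g, 'm) monoid_scheme \<Rightarrow> 'g \<Rightarrow> 'g \<Rightarrow> ('g \<Rightarrow> complex^2^2) \<Rightarrow> ('g \<Rightarrow> 'g)
     \<Rightarrow> ('g cover_point \<Rightarrow> point3) \<Rightarrow> bool" where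
  "equivariant_via G X0 Y0 \<rho> h \<Psi> \<longleftrightarrow> h \<in> auto G \<and>
     (\<exists>X Y. free_basis G X Y \<and> h X0 = X \<and> h Y0 = Y) \<and>
     (\<forall>W\<in>carrier G. \<forall>x\<in>cover_points G. \<Psi> (deck G W x) = SL2C_act (\<rho> (h W)) (\<Psi> x))"

text \<open>A graph, the map \<open>\<Psi>\<close> on its universal cover, and the automorphism belonging to \<open>\<Psi>\<close>. Only the
  values of \<open>\<Psi>\<close> on \<open>cover_points G\<close> matter.\<close>

datatype 'g marked_graph =
  Marked (graph_of: two_graph) (map_of: "'g cover_point \<Rightarrow> point3") (aut_of: "'g \<Rightarrow> 'g")

definition marked_carriers ::
  "('g, 'm) monoid_scheme \<Rightarrow> 'g \<Rightarrow> 'g \<Rightarrow> ('g \<Rightarrow> complex^2^2) \<Rightarrow> 'g marked_graph set" where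
  "marked_carriers G X0 Y0 \<rho> = {M.
     map_of M ` cover_points G \<subseteq> H3 \<and>
     locally_homeo_onto_image (cover_topology G X0 Y0 (graph_of M)) (map_of M) \<and>
     equivariant_via G X0 Y0 \<rho> (aut_of M) (map_of M)}"

text \<open>Sum over the three edges of the base graph of the length, for the pulled-back intrinsic metric,
  of the lift with index \<open>\<one>\<close>; by equivariance all lifts of an edge have the same length.\<close>

definition carrier_length ::
  "('g, 'm) monoid_scheme \<Rightarrow> 'g \<Rightarrow> 'g \<Rightarrow> 'g marked_graph \<Rightarrow> ennreal" where
  "carrier_length G X0 Y0 M =
     (\<Sum>e\<in>{E1, E2, E3}.
        curve_length
          (\<lambda>x y. intrinsic_dist (map_of M ` cover_points G) (map_of M x) (map_of M y))
          (edge_path G X0 Y0 (graph_of M) \<one>\<^bsub>G\<^esub> e))"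

definition carrier_equiv ::
  "('g, 'm) monoid_scheme \<Rightarrow> 'g \<Rightarrow> 'g \<Rightarrow> ('g \<Rightarrow> complex^2^2) \<Rightarrow> ('g marked_graph) rel" where
  "carrier_equiv G X0 Y0 \<rho> = {(M1, M2).
     M1 \<in> marked_carriers G X0 Y0 \<rho> \<and> M2 \<in> marked_carriers G X0 Y0 \<rho> \<and>
     graph_of M1 = graph_of M2 \<and>
     (\<exists>W\<in>carrier G. map_of M1 ` cover_points G =
        SL2C_act (\<rho> W) ` (map_of M2 ` cover_points G)) \<and>
     (\<exists>h'\<in>Inn_e G. aut_of M2 = h' \<otimes>\<^bsub>AutoGroup G\<^esub> aut_of M1)}"

definition carrier_graphs ::
  "('g, 'm) monoid_scheme \<Rightarrow> 'g \<Rightarrow> 'g \<Rightarrow> ('g \<Rightarrow> complex^2^2) \<Rightarrow> 'g marked_graph set set" where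
  "carrier_graphs G X0 Y0 \<rho> = marked_carriers G X0 Y0 \<rho> // carrier_equiv G X0 Y0 \<rho>"

definition is_geodesic ::
  "('g, 'm) monoid_scheme \<Rightarrow> 'g \<Rightarrow> 'g \<Rightarrow> 'g marked_graph \<Rightarrow> bool" where
  "is_geodesic G X0 Y0 M \<longleftrightarrow>
     (\<forall>g\<in>carrier G. \<forall>e.
        geodesic_segment (map_of M ` (edge_path G X0 Y0 (graph_of M) g e ` {0..1})))"

definition geodesic_carriers ::
  "('g, 'm) monoid_scheme \<Rightarrow> 'g \<Rightarrow> 'g \<Rightarrow> ('g \<Rightarrow> complex^2^2) \<Rightarrow> 'g marked_graph set set" where
  "geodesic_carriers G X0 Y0 \<rho> =
     {C \<in> carrier_graphs G X0 Y0 \<rho>. \<exists>M\<in>C. is_geodesic G X0 Y0 M}"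

text \<open>Minimality is tested on a geodesic representative, whose length is compared with that of every
  representative of every carrier graph of either type, geodesic or not. (Two non-geodesic equivalent
  maps may trace the same image with different multiplicities, hence the explicit quantification
  over representatives.)\<close>

definition minimal_carriers ::
  "('g, 'm) monoid_scheme \<Rightarrow> 'g \<Rightarrow> 'g \<Rightarrow> ('g \<Rightarrow> complex^2^2) \<Rightarrow> 'g marked_graph set set" where
  "minimal_carriers G X0 Y0 \<rho> =
     {C \<in> geodesic_carriers G X0 Y0 \<rho>. \<exists>M\<in>C. is_geodesic G X0 Y0 M \<and>
        (\<forall>C'\<in>carrier_graphs G X0 Y0 \<rho>. \<forall>M'\<in>C'.
           carrier_length G X0 Y0 M \<le> carrier_length G X0 Y0 M')}"

end

theory Submission
  imports Defs
begin

text \<open>Every automorphism is, up to inner automorphisms and signed permutations of the marking, given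
  by a vertex of one of two binary trees of bases, the trees of positive words in \<open>(X, Y) \<mapsto> (X, X Y)\<close>
  and \<open>(X, Y) \<mapsto> (X Y, Y)\<close> rooted at \<open>(X0, Y0)\<close> and \<open>(X0, Y0\<^sup>-\<^sup>1)\<close>: this is Nielsen reduction in the
  Cayley tree. Along these trees the traces form a Markoff map, and under the BQ-conditions only
  finitely many of them are bounded by a given constant (Bowditch): an infinite path through
  bounded vertices would either run along a single region, where the traces grow exponentially or
  tend to zero, or descend forever, which forces the trace of the commutator to be 2, against
  irreducibility. A carrier graph of length \<open>L\<close> bounds these traces in terms of \<open>L\<close>, so only finitely
  many classes of automorphisms carry minimal graphs.

  For a fixed automorphism the length is a convex function of the two vertices. If there were two
  minimisers, the length would be constant on the segment between them, so that at a moving vertex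
  all three edges would be tangent to its direction of motion and two of them would overlap,
  against local injectivity.\<close>

section \<open>Markoff maps on a binary tree\<close>

text \<open>What is counted in the end is a word in a binary tree plus two signed letters.
  Finiteness for classes in \<open>Omega\<close> must therefore become finiteness for words, and the
  abelianisation does this: \<open>Inn_e\<close> acts on exponent sums only by a sign, and they
  determine the vertex. A positive word never mixes the signs of its exponent sums, which is why two
  roots occur. The number 4 in the Markoff part comes from \<open>kappa\<close> being the trace of
  the commutator plus 2. Neither the existence of a minimiser nor the exact length of an arbitrary
  carrier enters. Lengths are compared through the distances between images of adjacent vertices:
  their sum bounds the length of a geodesic carrier from below and that of the straight map with the
  same vertices from above. The obstacle in the convexity argument is that the midpoint of two
  vertex placements may fail to be locally injective and is then no competitor. Halving repeatedly
  towards a nondegenerate placement stays strictly shorter and ends in nondegenerate ones.\<close>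

fun mstep :: "bool \<Rightarrow> complex \<times> complex \<times> complex \<Rightarrow> complex \<times> complex \<times> complex" where
  "mstep True (x, y, z) = (x, z, x * z - y)"
| "mstep False (x, y, z) = (z, y, z * y - x)"

definition mnode :: "complex \<times> complex \<times> complex \<Rightarrow> bool list \<Rightarrow> complex \<times> complex \<times> complex" where
  "mnode s w = foldl (\<lambda>s b. mstep b s) s w"

text \<open>A triple stands for (tr A, tr B, tr AB). The step \<open>True\<close> passes to the
  basis (A, AB) and \<open>False\<close> to (AB, B), so the third entry is the only new trace at
  each vertex.\<close>

abbreviation tip :: "complex \<times> complex \<times> complex \<Rightarrow> complex" where
  "tip s \<equiv> snd (snd s)"

lemma mnode_simps [simp]:
  "mnode s [] = s" "mnode s (b # w) = mnode (mstep b s) w" "mnode s (w @ v) = mnode (mnode s w) v"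
  by (simp_all add: mnode_def)

text \<open>On (tr A, tr B, tr AB) this is tr [A,B] + 2. It is quadratic in each variable, and a
  step replaces one root of such a quadratic by the other.\<close>

fun kappa :: "complex \<times> complex \<times> complex \<Rightarrow> complex" where
  "kappa (x, y, z) = x\<^sup>2 + y\<^sup>2 + z\<^sup>2 - x * y * z"

lemma kappa_mstep [simp]: "kappa (mstep b s) = kappa s"
  by (cases s; cases b) (simp_all add: power2_eq_square algebra_simps)

text \<open>A condition inherited by both children that forces the traces to increase away from the
  root. The factor 2 is what the triangle inequality leaves of \<open>x * z - y\<close> once
  \<open>y\<close> is at most half of \<open>x * z\<close>.\<close>

fun grows :: "complex \<times> complex \<times> complex \<Rightarrow> bool" where
  "grows (x, y, z) \<longleftrightarrow> cmod x > 2 \<and> cmod y > 2 \<and> cmod (x * y) \<le> 2 * cmod z"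

lemma grows_step_aux:
  assumes "cmod x > 2" "cmod y > 2" "cmod (x * y) \<le> 2 * cmod z"
  shows "cmod z > 2" "cmod (x * z) \<le> 2 * cmod (x * z - y)"
proof -
  have "2 * cmod y \<le> cmod x * cmod y"
    using assms by (intro mult_right_mono) auto
  then have z: "cmod y \<le> cmod z"
    using assms(3) by (simp add: norm_mult)
  then show "cmod z > 2" using assms by simp
  have "2 * cmod z \<le> cmod x * cmod z"
    using assms by (intro mult_right_mono) auto
  with z have "2 * cmod y \<le> cmod (x * z)" by (simp add: norm_mult)
  moreover have "cmod (x * z) - cmod y \<le> cmod (x * z - y)" by (rule norm_triangle_ineq2)
  ultimately show "cmod (x * z) \<le> 2 * cmod (x * z - y)" by simp
qed

lemma grows_mstep: "grows s \<Longrightarrow> grows (mstep b s)"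
proof (cases s)
  case (fields x y z)
  assume "grows s"
  then have *: "cmod x > 2" "cmod y > 2" "cmod (x * y) \<le> 2 * cmod z"
    using fields by auto
  show ?thesis
    using * fields grows_step_aux[of x y z] grows_step_aux[of y x z]
    by (cases b) (auto simp: mult.commute)
qed

text \<open>Growth is slowest along a single region of modulus 2m, where half of (2m)(2m^k) is
  2m^(k+1): one factor m per step. Carrying the exponent \<open>k\<close> lets the induction restart
  at either child.\<close>

lemma grows_tip_lower:
  assumes "grows (x, y, z)" "1 \<le> m" "2 * m \<le> cmod x" "2 * m \<le> cmod y" "2 * m ^ k \<le> cmod z" "k \<ge> 1"
  shows "2 * m ^ (k + length w) \<le> cmod (tip (mnode (x, y, z) w))"
  using assms
proof (induction w arbitrary: x y z k)
  case Nil
  then show ?case by simp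
next
  case (Cons b w)
  have g: "cmod x > 2" "cmod y > 2" "cmod (x * y) \<le> 2 * cmod z"
    using Cons.prems by auto
  have mk: "m \<le> m ^ k" using Cons.prems by (simp add: self_le_power)
  have x': "2 * m ^ Suc k \<le> cmod (x * z - y)"
  proof -
    have "(2 * m) * (2 * m ^ k) \<le> cmod x * cmod z"
      using Cons.prems by (intro mult_mono) auto
    with grows_step_aux(2)[OF g] show ?thesis by (simp add: norm_mult)
  qed
  have y': "2 * m ^ Suc k \<le> cmod (z * y - x)"
  proof -
    have "(2 * m) * (2 * m ^ k) \<le> cmod y * cmod z"
      using Cons.prems by (intro mult_mono) auto
    with grows_step_aux(2)[of y x z] g show ?thesis by (simp add: norm_mult mult.commute)
  qed
  have gb: "grows (mstep b (x, y, z))" by (rule grows_mstep[OF Cons.prems(1)])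
  show ?case
  proof (cases b)
    case True
    then show ?thesis
      using Cons.IH[of x z "x * z - y" "Suc k"] Cons.prems x' mk gb by simp
  next
    case False
    then show ?thesis
      using Cons.IH[of z y "z * y - x" "Suc k"] Cons.prems y' mk gb by simp
  qed
qed

lemma grows_tip_lower':
  assumes "grows (x, y, z)" "1 \<le> m" "2 * m \<le> cmod x" "2 * m \<le> cmod y"
  shows "2 * m ^ Suc (length w) \<le> cmod (tip (mnode (x, y, z) w))"
proof -
  have "(2 * m) * 2 \<le> cmod x * cmod y"
    using assms by (intro mult_mono) auto
  then have "2 * m ^ 1 \<le> cmod z"
    using assms by (simp add: norm_mult)
  from grows_tip_lower[OF assms this] show ?thesis by simp
qed

definition small_words :: "real \<Rightarrow> complex \<times> complex \<times> complex \<Rightarrow> bool list set" where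
  "small_words K s = {w. cmod (tip (mnode s w)) \<le> K}"

lemma finite_small_words_if_grows:
  assumes "grows s" shows "finite (small_words K s)"
proof (cases s)
  case (fields x y z)
  \<comment> \<open>Strictly above 1 because both moduli exceed 2 strictly; this is the base of the
    exponential growth.\<close>
  define m where "m = min (cmod x) (cmod y) / 2"
  have m: "1 < m" "2 * m \<le> cmod x" "2 * m \<le> cmod y"
    using assms fields by (auto simp: m_def)
  obtain N where N: "K < m ^ N" using real_arch_pow[OF m(1)] by blast
  have "length w \<le> N" if "w \<in> small_words K s" for w
  proof (rule ccontr)
    assume "\<not> length w \<le> N"
    then have "m ^ N \<le> m ^ Suc (length w)" using m by (intro power_increasing) auto
    moreover have "2 * m ^ Suc (length w) \<le> K"
      using grows_tip_lower'[of x y z m w] assms fields m that by (auto simp: small_words_def)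
    moreover have "m ^ N > 0" using m by simp
    ultimately show False using N by linarith
  qed
  then have "small_words K s \<subseteq> {w. set w \<subseteq> UNIV \<and> length w \<le> N}" by auto
  then show ?thesis by (rule finite_subset) (rule finite_lists_length_le, simp)
qed

lemma small_words_empty_if_grows:
  assumes "grows (x, y, z)" "K \<ge> 2" "K < cmod x" "K < cmod y"
  shows "w \<notin> small_words K (x, y, z)"
proof
  assume w: "w \<in> small_words K (x, y, z)"
  define m where "m = min (cmod x) (cmod y) / 2"
  have m: "1 < m" "2 * m \<le> cmod x" "2 * m \<le> cmod y" "K < 2 * m"
    using assms by (auto simp: m_def)
  have "m \<le> m ^ Suc (length w)" using m by (intro self_le_power) auto
  moreover have "2 * m ^ Suc (length w) \<le> K"
    using grows_tip_lower'[of x y z m w] assms m w by (auto simp: small_words_def)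
  ultimately show False using m by linarith
qed

lemma small_words_step:
  "small_words K s \<subseteq> {[]} \<union> (#) True ` small_words K (mstep True s) \<union> (#) False ` small_words K (mstep False s)"
proof
  fix w assume "w \<in> small_words K s"
  then show "w \<in> {[]} \<union> (#) True ` small_words K (mstep True s) \<union> (#) False ` small_words K (mstep False s)"
    by (cases w; cases "hd w") (auto simp: small_words_def)
qed

text \<open>For \<open>x\<close> the trace of a matrix in SL(2,C), \<open>l\<close> is an
  eigenvalue. Eigenvalues on the unit circle are conjugate to each other, so their sum is real and
  lies in [-2,2].\<close>

lemma root_outside_unit_circle:
  assumes "x \<notin> complex_of_real ` {-2..2}"
  obtains l where "l \<noteq> 0" "x = l + inverse l" "cmod l > 1"
proof -
  obtain r where r: "r\<^sup>2 = x\<^sup>2 - 4"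
    using power2_csqrt by blast
  define l where "l = (x + r) / 2"
  have prod: "l * (x - l) = 1"
    using r by (simp add: l_def field_simps power2_eq_square)
  then have l0: "l \<noteq> 0" by auto
  have xl: "x = l + inverse l"
    using prod l0 by (metis add.commute diff_add_cancel inverse_unique)
  have ne: "cmod l \<noteq> 1"
  proof
    assume 1: "cmod l = 1"
    then have "inverse l = cnj l"
      using complex_norm_square[of l] by (metis inverse_unique of_real_1 one_power2)
    then have "x = complex_of_real (2 * Re l)"
      using xl by (simp add: complex_add_cnj)
    moreover have "\<bar>Re l\<bar> \<le> 1" using abs_Re_le_cmod[of l] 1 by simp
    ultimately show False
      using assms by (auto simp: abs_le_iff intro!: image_eqI[of _ _ "2 * Re l"])
  qed
  show ?thesis
  proof (cases "cmod l > 1")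
    case True
    then show ?thesis using that l0 xl by blast
  next
    case False
    then have "cmod (inverse l) > 1" using ne l0 by (simp add: norm_inverse one_less_inverse_iff)
    then show ?thesis using that[of "inverse l"] l0 xl by simp
  qed
qed

text \<open>The solutions are combinations of the powers of \<open>l\<close> and of
  \<open>inverse l\<close>. Each of \<open>a\<close> and \<open>b\<close> annihilates one of the two
  exponentials, and \<open>Y\<close> fails to grow only if the coefficient of \<open>l ^ k\<close>
  vanishes.\<close>

lemma trace_recurrence_dichotomy:
  fixes Y :: "nat \<Rightarrow> complex"
  assumes "x \<notin> complex_of_real ` {-2..2}" "\<And>k. Y (Suc (Suc k)) = x * Y (Suc k) - Y k"
  shows "Y \<longlonglongrightarrow> 0 \<or> filterlim Y at_infinity sequentially"
proof -
  obtain l where l: "l \<noteq> 0" "x = l + inverse l" "cmod l > 1"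
    using root_outside_unit_circle[OF assms(1)] .
  define a where "a k = Y (Suc k) - inverse l * Y k" for k
  define b where "b k = Y (Suc k) - l * Y k" for k
  have a: "a k = l ^ k * a 0" for k
  proof (induction k)
    case (Suc k)
    have "a (Suc k) = l * a k" using l(1) by (simp add: a_def assms(2) l(2) algebra_simps)
    then show ?case using Suc by simp
  qed simp
  have b: "b k = inverse l ^ k * b 0" for k
  proof (induction k)
    case (Suc k)
    have "b (Suc k) = inverse l * b k" using l(1) by (simp add: b_def assms(2) l(2) algebra_simps)
    then show ?case using Suc by simp
  qed simp
  have il: "cmod (inverse l) < 1" using l by (simp add: norm_inverse inverse_less_1_iff)
  have d: "l - inverse l \<noteq> 0"
    using l il by (metis eq_iff_diff_eq_0 less_asym)
  have Y: "Y k = (a k - b k) / (l - inverse l)" for k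
    using d by (simp add: a_def b_def nonzero_eq_divide_eq algebra_simps)
  have b0: "b \<longlonglongrightarrow> 0"
  proof -
    have "(\<lambda>k. inverse l ^ k * b 0) \<longlonglongrightarrow> 0"
      using il by (intro tendsto_mult_left_zero LIMSEQ_power_zero)
    then show ?thesis by (simp only: b[symmetric])
  qed
  show ?thesis
  proof (cases "a 0 = 0")
    case True
    then have "a k = 0" for k using a[of k] by simp
    then have "Y = (\<lambda>k. - b k / (l - inverse l))" using Y by (simp add: fun_eq_iff)
    moreover have "(\<lambda>k. - b k / (l - inverse l)) \<longlonglongrightarrow> - 0 / (l - inverse l)"
      by (intro tendsto_intros b0 d)
    ultimately have "Y \<longlonglongrightarrow> 0" by simp
    then show ?thesis ..
  next
    case False
    have "filterlim (\<lambda>k. l ^ k) at_infinity sequentially"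
      using l(3) by (rule filterlim_realpow_sequentially_gt1)
    from tendsto_mult_filterlim_at_infinity[OF tendsto_const False this]
    have "filterlim (\<lambda>k. a k) at_infinity sequentially"
      by (simp only: mult.commute[of "a 0"] a[symmetric])
    from tendsto_add_filterlim_at_infinity[OF tendsto_minus[OF b0] this]
    have "filterlim (\<lambda>k. - b k + a k) at_infinity sequentially" .
    from tendsto_mult_filterlim_at_infinity[OF tendsto_const[of "1 / (l - inverse l)"] _ this]
    have "filterlim (\<lambda>k. (1 / (l - inverse l)) * (- b k + a k)) at_infinity sequentially"
      using d by simp
    moreover have "(\<lambda>k. (1 / (l - inverse l)) * (- b k + a k)) = Y"
      by (simp add: fun_eq_iff Y)
    ultimately show ?thesis by simp
  qed
qed

text \<open>\<open>Y\<close> lists the neighbours of a region of trace \<open>x\<close> along which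
  the path runs. Leaving the path opens a subtree at two large neighbours; the margin
  \<open>cmod x\<close> in the threshold makes its first triple satisfy \<open>grows\<close>, so
  nothing small lies beyond. The two triples in \<open>branch\<close> are the two orders of the
  neighbours.\<close>

lemma small_words_const_path:
  fixes t :: "nat \<Rightarrow> complex \<times> complex \<times> complex"
  assumes step: "\<And>j. t (Suc j) = mstep c (t j)" and K: "K \<ge> 2"
    and Y: "\<And>j. tip (t j) = Y (Suc j)"
    and branch: "\<And>j. mstep (\<not> c) (t j) \<in> {(Y j, Y (Suc j), Y j * Y (Suc j) - x), (Y (Suc j), Y j, Y j * Y (Suc j) - x)}"
    and large: "\<And>j. j \<ge> i \<Longrightarrow> cmod (Y j) > K + cmod x" and "j \<ge> i"
  shows "w \<notin> small_words K (t j)"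
  using \<open>j \<ge> i\<close>
proof (induction w arbitrary: j)
  case Nil
  have "cmod (Y (Suc j)) > K + cmod x" using large[of "Suc j"] Nil by simp
  then have "cmod (Y (Suc j)) > K" using norm_ge_zero[of x] by linarith
  then show ?case by (simp add: small_words_def Y)
next
  case (Cons b w)
  show ?case
  proof (cases "b = c")
    case True
    then show ?thesis using Cons.IH[of "Suc j"] Cons.prems by (simp add: small_words_def step)
  next
    case False
    have l: "cmod (Y j) > K + cmod x" "cmod (Y (Suc j)) > K + cmod x" using large Cons.prems by auto
    have gt: "cmod (Y j) > K" "cmod (Y (Suc j)) > K" using l norm_ge_zero[of x] by linarith+
    have "cmod (Y j) * 2 \<le> cmod (Y j) * cmod (Y (Suc j))" using gt K by (intro mult_left_mono) auto
    then have "2 * cmod x \<le> cmod (Y j * Y (Suc j))" using l K by (simp add: norm_mult)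
    moreover have "cmod (Y j * Y (Suc j)) - cmod x \<le> cmod (Y j * Y (Suc j) - x)" by (rule norm_triangle_ineq2)
    ultimately have "cmod (Y j * Y (Suc j)) \<le> 2 * cmod (Y j * Y (Suc j) - x)" by linarith
    then have "w \<notin> small_words K (Y j, Y (Suc j), Y j * Y (Suc j) - x)"
      and "w \<notin> small_words K (Y (Suc j), Y j, Y j * Y (Suc j) - x)"
      using gt K small_words_empty_if_grows[of "Y j" "Y (Suc j)" "Y j * Y (Suc j) - x" K w]
        small_words_empty_if_grows[of "Y (Suc j)" "Y j" "Y j * Y (Suc j) - x" K w]
      by (auto simp: mult.commute)
    then show ?thesis using branch[of j] False by (auto simp: small_words_def)
  qed
qed

text \<open>The Vogt-Fricke polynomial takes the value 4 in the limit of an infinite descent: all three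
  moduli tend to 2, while each entry tends to half the product of the other two.\<close>

lemma kappa_eq_4_if_descent:
  fixes t :: "nat \<Rightarrow> complex \<times> complex \<times> complex" and b :: "nat \<Rightarrow> bool"
  assumes step: "\<And>n. t (Suc n) = mstep (b n) (t n)"
    and gt2: "\<And>n. cmod (fst (t n)) > 2" "\<And>n. cmod (fst (snd (t n))) > 2" "\<And>n. cmod (tip (t n)) > 2"
    and ngrows: "\<And>n. \<not> grows (t n)"
    and inf: "\<exists>\<^sub>F n in sequentially. b n" "\<exists>\<^sub>F n in sequentially. \<not> b n"
  shows "kappa (t 0) = 4"
proof -
  define X where "X n = fst (t n)" for n
  define Y where "Y n = fst (snd (t n))" for n
  define Z where "Z n = tip (t n)" for n
  have t: "t n = (X n, Y n, Z n)" for n by (simp add: X_def Y_def Z_def)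
  have g: "cmod (X n) > 2" "cmod (Y n) > 2" "cmod (Z n) > 2" for n
    using gt2 by (auto simp: X_def Y_def Z_def)
  have Zlt: "2 * cmod (Z n) < cmod (X n) * cmod (Y n)" for n
    using ngrows[of n] g[of n] by (simp add: t norm_mult)
  have L: "X (Suc n) = X n" "Y (Suc n) = Z n" "Z (Suc n) = X n * Z n - Y n" if "b n" for n
    using step[of n] that by (simp_all add: t)
  have R: "X (Suc n) = Z n" "Y (Suc n) = Y n" "Z (Suc n) = Z n * Y n - X n" if "\<not> b n" for n
    using step[of n] that by (simp_all add: t)
  \<comment> \<open>The triangle inequality bounds the new tip from below, \<open>Zlt\<close> at the
    next vertex bounds it from above; together they compare the old second entry with its
    replacement.\<close>
  have Lgt: "cmod (X n) * cmod (Y (Suc n)) < 2 * cmod (Y n)" if "b n" for n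
  proof -
    have "cmod (X n * Z n) - cmod (Y n) \<le> cmod (Z (Suc n))"
      using L[OF that] norm_triangle_ineq2[of "X n * Z n" "Y n"] by simp
    then show ?thesis using Zlt[of "Suc n"] L[OF that] by (simp add: norm_mult)
  qed
  have Rgt: "cmod (Y n) * cmod (X (Suc n)) < 2 * cmod (X n)" if "\<not> b n" for n
  proof -
    have "cmod (Y n * Z n) - cmod (X n) \<le> cmod (Z (Suc n))"
      using R[OF that] norm_triangle_ineq2[of "Y n * Z n" "X n"] by (simp add: mult.commute)
    then show ?thesis using Zlt[of "Suc n"] R[OF that] by (simp add: norm_mult mult.commute)
  qed
  have Ydec: "cmod (Y (Suc n)) \<le> cmod (Y n)" for n
  proof (cases "b n")
    case True
    have "2 * cmod (Y (Suc n)) \<le> cmod (X n) * cmod (Y (Suc n))"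
      using g[of n] by (intro mult_right_mono) auto
    then show ?thesis using Lgt[OF True] by linarith
  qed (simp add: R)
  have Xdec: "cmod (X (Suc n)) \<le> cmod (X n)" for n
  proof (cases "b n")
    case False
    have "2 * cmod (X (Suc n)) \<le> cmod (Y n) * cmod (X (Suc n))"
      using g[of n] by (intro mult_right_mono) auto
    then show ?thesis using Rgt[OF False] by linarith
  qed (simp add: L)
  obtain \<alpha> where \<alpha>: "(\<lambda>n. cmod (X n)) \<longlonglongrightarrow> \<alpha>" "\<And>n. \<alpha> \<le> cmod (X n)"
    using decseq_convergent[OF decseq_SucI[of "\<lambda>n. cmod (X n)"], of 2] Xdec g(1) by (metis less_imp_le)
  obtain \<beta> where \<beta>: "(\<lambda>n. cmod (Y n)) \<longlonglongrightarrow> \<beta>" "\<And>n. \<beta> \<le> cmod (Y n)"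
    using decseq_convergent[OF decseq_SucI[of "\<lambda>n. cmod (Y n)"], of 2] Ydec g(2) by (metis less_imp_le)
  have ge2: "\<alpha> \<ge> 2" "\<beta> \<ge> 2"
    using LIMSEQ_le_const[OF \<alpha>(1), of 2] LIMSEQ_le_const[OF \<beta>(1), of 2] g by (meson less_imp_le)+
  \<comment> \<open>\<open>Lgt\<close> and \<open>Rgt\<close> hold only at steps of their own kind.
    Both kinds recur, so both filters are nontrivial and limits may be taken along either.\<close>
  define F where "F = inf sequentially (principal {n. b n})"
  define F' where "F' = inf sequentially (principal {n. \<not> b n})"
  have F: "F \<noteq> bot" "F' \<noteq> bot" "F \<le> sequentially" "F' \<le> sequentially"
    using inf by (auto simp: F_def F'_def frequently_def trivial_limit_def eventually_inf_principal)
  have evF: "eventually b F" "eventually (\<lambda>n. \<not> b n) F'"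
    by (auto simp: F_def F'_def eventually_inf_principal)
  have \<alpha>F: "((\<lambda>n. cmod (X n)) \<longlongrightarrow> \<alpha>) F'" "((\<lambda>n. cmod (X n)) \<longlongrightarrow> \<alpha>) F"
       "((\<lambda>n. cmod (X (Suc n))) \<longlongrightarrow> \<alpha>) F'"
    using \<alpha>(1) LIMSEQ_Suc[OF \<alpha>(1)] F by (auto intro: tendsto_mono)
  have \<beta>F: "((\<lambda>n. cmod (Y n)) \<longlongrightarrow> \<beta>) F'" "((\<lambda>n. cmod (Y n)) \<longlongrightarrow> \<beta>) F"
       "((\<lambda>n. cmod (Y (Suc n))) \<longlongrightarrow> \<beta>) F"
    using \<beta>(1) LIMSEQ_Suc[OF \<beta>(1)] F by (auto intro: tendsto_mono)
  have "\<alpha> * \<beta> \<le> 2 * \<beta>"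
    using tendsto_le[OF F(1) tendsto_mult_left[OF \<beta>F(2), of 2] tendsto_mult[OF \<alpha>F(2) \<beta>F(3)]]
      eventually_mono[OF evF(1)] Lgt by (metis (mono_tags, lifting) less_imp_le)
  moreover have "\<beta> * \<alpha> \<le> 2 * \<alpha>"
    using tendsto_le[OF F(2) tendsto_mult_left[OF \<alpha>F(1), of 2] tendsto_mult[OF \<beta>F(1) \<alpha>F(3)]]
      eventually_mono[OF evF(2)] Rgt by (metis (mono_tags, lifting) less_imp_le)
  ultimately have "\<alpha> = 2" "\<beta> = 2" using ge2 by auto
  then have X2: "(\<lambda>n. cmod (X n)) \<longlonglongrightarrow> 2" and Y2: "(\<lambda>n. cmod (Y n)) \<longlonglongrightarrow> 2"
    using \<alpha> \<beta> by auto
  have XY4: "(\<lambda>n. cmod (X n) * cmod (Y n)) \<longlonglongrightarrow> 4"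
    using tendsto_mult[OF X2 Y2] by simp
  have Z2: "(\<lambda>n. cmod (Z n)) \<longlonglongrightarrow> 2"
  proof (rule tendsto_sandwich[where f = "\<lambda>_. 2" and h = "\<lambda>n. cmod (X n) * cmod (Y n) / 2"])
    show "(\<lambda>n. cmod (X n) * cmod (Y n) / 2) \<longlonglongrightarrow> 2" using tendsto_divide[OF XY4 tendsto_const, of 2] by simp
    show "\<forall>\<^sub>F n in sequentially. cmod (Z n) \<le> cmod (X n) * cmod (Y n) / 2"
      using Zlt by (intro always_eventually allI) (metis less_divide_eq_numeral1(1) less_imp_le mult.commute)
    show "\<forall>\<^sub>F n in sequentially. 2 \<le> cmod (Z n)" using g(3) by (simp add: less_imp_le)
  qed simp
  \<comment> \<open>The other root for the third variable. After a step it is the entry just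
    discarded, so its modulus is squeezed as well.\<close>
  define V where "V n = X n * Y n - Z n" for n
  have "cmod (V (Suc n)) = (if b n then cmod (Y n) else cmod (X n))" for n
    by (simp add: V_def L R)
  moreover have "(\<lambda>n. if b n then cmod (Y n) else cmod (X n)) \<longlonglongrightarrow> 2"
  proof (rule tendsto_sandwich[where f = "\<lambda>_. 2" and h = "\<lambda>n. max (cmod (X n)) (cmod (Y n))"])
    show "(\<lambda>n. max (cmod (X n)) (cmod (Y n))) \<longlonglongrightarrow> 2" using tendsto_max[OF X2 Y2] by simp
    show "\<forall>\<^sub>F n in sequentially. 2 \<le> (if b n then cmod (Y n) else cmod (X n))" using g by (simp add: less_imp_le)
  qed auto
  ultimately have "(\<lambda>n. cmod (V (Suc n))) \<longlonglongrightarrow> 2" by simp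
  then have O2: "(\<lambda>n. cmod (V n)) \<longlonglongrightarrow> 2" by (rule LIMSEQ_imp_Suc)
  \<comment> \<open>Parallelogram law for \<open>Z\<close> and \<open>V\<close>, whose sum is
    \<open>X Y\<close>. The limits of the three moduli are 2, 2 and 4, so the difference tends to
    0.\<close>
  have par: "(cmod (2 * Z n - X n * Y n))\<^sup>2 = 2 * (cmod (Z n))\<^sup>2 + 2 * (cmod (V n))\<^sup>2 - (cmod (X n) * cmod (Y n))\<^sup>2" for n
  proof -
    have "(cmod (u - v))\<^sup>2 = 2 * (cmod u)\<^sup>2 + 2 * (cmod v)\<^sup>2 - (cmod (u + v))\<^sup>2" for u v
      unfolding cmod_power2 by (simp add: power2_eq_square algebra_simps)
    from this[of "Z n" "V n"] show ?thesis by (simp add: V_def norm_mult algebra_simps)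
  qed
  have "(\<lambda>n. (cmod (2 * Z n - X n * Y n))\<^sup>2) \<longlonglongrightarrow> 2 * 2\<^sup>2 + 2 * 2\<^sup>2 - 4\<^sup>2"
    unfolding par by (intro tendsto_intros Z2 O2 XY4)
  then have "(\<lambda>n. (cmod (2 * Z n - X n * Y n))\<^sup>2) \<longlonglongrightarrow> 0" by simp
  from tendsto_real_sqrt[OF this] have D: "(\<lambda>n. 2 * Z n - X n * Y n) \<longlonglongrightarrow> 0"
    by (simp add: tendsto_norm_zero_iff)
  have "eventually (\<lambda>n. cmod (X n) < 3) F" "eventually (\<lambda>n. cmod (Y n) < 3) F"
    using order_tendstoD(2)[OF tendsto_mono[OF F(3) X2], of 3] order_tendstoD(2)[OF tendsto_mono[OF F(3) Y2], of 3]
    by simp_all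
  then have bnd: "eventually (\<lambda>n. cmod (X n) \<le> 3) F" "eventually (\<lambda>n. cmod (Y n) \<le> 3) F"
    by (auto elim: eventually_mono)
  have DF: "((\<lambda>n. 2 * Z n - X n * Y n) \<longlongrightarrow> 0) F" "((\<lambda>n. 2 * Z (Suc n) - X (Suc n) * Y (Suc n)) \<longlongrightarrow> 0) F"
    using tendsto_mono[OF F(3) D] tendsto_mono[OF F(3) LIMSEQ_Suc[OF D]] .
  have "((\<lambda>n. X n * (2 * Z n - X n * Y n)) \<longlongrightarrow> 0) F"
    using lim_null_mult_left_bounded[OF bnd(1) DF(1)] .
  from tendsto_diff[OF this tendsto_mult_left[OF DF(2), of 2]]
  have "((\<lambda>n. X n * (2 * Z n - X n * Y n) - 2 * (2 * Z (Suc n) - X (Suc n) * Y (Suc n))) \<longlongrightarrow> 0) F" by simp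
  \<comment> \<open>At a \<open>True\<close> step the new triple is (X, Z, XZ - Y); this combination
    of the two consecutive defects eliminates \<open>Z\<close>.\<close>
  then have EY: "((\<lambda>n. (4 - (X n)\<^sup>2) * Y n) \<longlongrightarrow> 0) F"
    by (rule tendsto_cong[THEN iffD1, rotated])
      (rule eventually_mono[OF evF(1)], simp add: L algebra_simps power2_eq_square)
  have E: "((\<lambda>n. 4 - (X n)\<^sup>2) \<longlongrightarrow> 0) F"
  proof (rule Lim_null_comparison)
    have "cmod (4 - (X n)\<^sup>2) * 1 \<le> cmod (4 - (X n)\<^sup>2) * cmod (Y n)" for n
      using g(2)[of n] by (intro mult_left_mono) auto
    then show "\<forall>\<^sub>F n in F. cmod (4 - (X n)\<^sup>2) \<le> cmod ((4 - (X n)\<^sup>2) * Y n)"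
      by (simp add: norm_mult)
    show "((\<lambda>n. cmod ((4 - (X n)\<^sup>2) * Y n)) \<longlongrightarrow> 0) F" using tendsto_norm[OF EY] by simp
  qed
  have EYY: "((\<lambda>n. Y n * ((4 - (X n)\<^sup>2) * Y n)) \<longlongrightarrow> 0) F"
    using lim_null_mult_left_bounded[OF bnd(2) EY] .
  \<comment> \<open>Completing the square in \<open>Z\<close>: \<open>kappa\<close> equals 4 + (2Z -
    XY)^2 / 4 - (4 - X^2)(4 - Y^2) / 4.\<close>
  have kap: "kappa (t n) = (2 * Z n - X n * Y n)\<^sup>2 / 4 + 4 - (4 * (4 - (X n)\<^sup>2) - Y n * ((4 - (X n)\<^sup>2) * Y n)) / 4" for n
    by (simp add: t power2_eq_square field_simps)
  have "((\<lambda>n. kappa (t n)) \<longlongrightarrow> 0\<^sup>2 / 4 + 4 - (4 * 0 - 0) / 4) F"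
    unfolding kap by (intro tendsto_intros DF(1) E EYY) auto
  moreover have "(\<lambda>n. kappa (t n)) = (\<lambda>n. kappa (t 0))"
  proof
    show "kappa (t n) = kappa (t 0)" for n by (induction n) (simp_all add: step)
  qed
  ultimately have "((\<lambda>n. kappa (t 0)) \<longlongrightarrow> 4) F" by simp
  then show ?thesis using F(1) by (simp add: tendsto_const_iff)
qed

text \<open>Koenig's lemma supplies the path: it follows subtrees containing infinitely many small
  words and so avoids every vertex that \<open>grows\<close>. The finiteness at level 2 carries over
  to every \<open>K\<close> because all but finitely many tips on the path exceed 2, whatever
  \<open>K\<close> is.\<close>

theorem finite_small_words:
  assumes \<kappa>: "kappa s \<noteq> 4"
    and x: "fst s \<notin> complex_of_real ` {-2..2}" and y: "fst (snd s) \<notin> complex_of_real ` {-2..2}"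
    and tips: "\<And>w. tip (mnode s w) \<notin> complex_of_real ` {-2..2}"
    and fin2: "finite (small_words 2 s)"
  shows "finite (small_words K s)"
proof -
  \<comment> \<open>The estimate along a constant path asks for a threshold of at least 2; enlarging
    the threshold only enlarges the set.\<close>
  define K' where "K' = max K 2"
  define P where "P s = infinite (small_words K' s)" for s
  have "\<not> P s"
  proof
    assume "P s"
    define nx where "nx s = P (mstep True s)" for s
    define wd where "wd = rec_nat [] (\<lambda>_ w. w @ [nx (mnode s w)])"
    have wd [simp]: "wd 0 = []" "wd (Suc n) = wd n @ [nx (mnode s (wd n))]" for n
      by (simp_all add: wd_def)
    define t where "t n = mnode s (wd n)" for n
    define b where "b n = nx (t n)" for n
    have step: "t (Suc n) = mstep (b n) (t n)" for n by (simp add: t_def b_def)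
    have P_step: "P (mstep (nx s) s)" if "P s" for s
    proof (cases "nx s")
      case False
      then have "infinite (small_words K' (mstep False s))"
        using that finite_subset[OF small_words_step[of K' s]] by (auto simp: nx_def P_def)
      then show ?thesis using False by (simp add: P_def)
    qed (auto simp: nx_def)
    have Pt: "P (t n)" for n
      by (induction n) (use \<open>P s\<close> P_step in \<open>simp_all add: step b_def, simp add: t_def\<close>)
    have ng: "\<not> grows (t n)" for n
      using Pt[of n] finite_small_words_if_grows[of "t n" K'] unfolding P_def by blast
    have len: "length (wd n) = n" for n by (induction n) auto
    then have inj: "inj wd" by (metis injI)
    have "finite (wd -` small_words 2 s)" using fin2 inj by (rule finite_vimageI)
    then obtain N where N: "\<And>n. n \<ge> N \<Longrightarrow> n \<notin> wd -` small_words 2 s"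
      by (metis finite_nat_set_iff_bounded not_le)
    have Zgt: "cmod (tip (t n)) > 2" if "n \<ge> N" for n
      using N[OF that] by (simp add: small_words_def t_def)
    have XY: "fst (t n) \<notin> complex_of_real ` {-2..2} \<and> fst (snd (t n)) \<notin> complex_of_real ` {-2..2}" for n
    proof (induction n)
      case 0
      then show ?case using x y by (simp add: t_def)
    next
      case (Suc n)
      have "tip (t n) \<notin> complex_of_real ` {-2..2}" using tips by (simp add: t_def)
      then show ?case using Suc by (cases "t n"; cases "b n") (simp_all add: step)
    qed
    have const: "\<exists>\<^sub>F n in sequentially. b n \<noteq> c" for c
    proof (rule ccontr)
      assume "\<not> ?thesis"
      then obtain M where M: "\<And>n. n \<ge> M \<Longrightarrow> b n = c"
        by (auto simp: not_frequently eventually_sequentially)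
      define u where "u j = t (M + j)" for j
      have ust: "u (Suc j) = mstep c (u j)" for j using step[of "M + j"] M[of "M + j"] by (simp add: u_def)
      define x' where "x' = (if c then fst (u 0) else fst (snd (u 0)))"
      define Y where "Y j = (if c then fst (snd (u j)) else fst (u j))" for j
      have u: "u j = (if c then (x', Y j, Y (Suc j)) else (Y j, x', Y (Suc j)))" for j
      proof -
        have 1: "(if c then fst (u j) else fst (snd (u j))) = x'" for j
          by (induction j) (auto simp: x'_def ust split: if_splits, (metis mstep.simps fst_conv snd_conv prod.collapse)+)
        have 2: "tip (u j) = Y (Suc j)"
          unfolding Y_def ust by (cases "u j"; cases c) auto
        show ?thesis
          using 1[of j] 2 by (cases "u j"; cases c) (auto simp: Y_def)
      qed
      have rec: "Y (Suc (Suc k)) = x' * Y (Suc k) - Y k" for k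
        using ust[of k] by (cases c) (simp_all add: u)
      have x'2: "x' \<notin> complex_of_real ` {-2..2}" using XY[of M] by (auto simp: x'_def u_def)
      have YN: "cmod (Y (Suc j)) > 2" if "j \<ge> N" for j
        using Zgt[of "M + j"] that u[of j] by (simp add: u_def split: if_splits)
      from trace_recurrence_dichotomy[of x' Y, OF x'2 rec] show False
      proof
        \<comment> \<open>Here the tips would fall below 2 although the path has left the finite set
          \<open>small_words 2 s\<close>.\<close>
        assume "Y \<longlonglongrightarrow> 0"
        then have "\<forall>\<^sub>F j in sequentially. cmod (Y j) < 2"
          using order_tendstoD(2)[OF tendsto_norm, of Y 0 sequentially 2] by simp
        then obtain j0 where "\<And>j. j \<ge> j0 \<Longrightarrow> cmod (Y j) < 2" by (auto simp: eventually_sequentially)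
        from this[of "Suc (max j0 N)"] YN[of "max j0 N"] show False by (simp add: le_SucI)
      next
        assume "filterlim Y at_infinity sequentially"
        then have "filterlim (\<lambda>j. cmod (Y j)) at_top sequentially" by (rule filterlim_at_infinity_imp_norm_at_top)
        then have "\<forall>\<^sub>F j in sequentially. cmod (Y j) > K' + cmod x'" by (simp add: filterlim_at_top_dense)
        then obtain i where i: "\<And>j. j \<ge> i \<Longrightarrow> cmod (Y j) > K' + cmod x'" by (auto simp: eventually_sequentially)
        have "w \<notin> small_words K' (u i)" for w
          by (rule small_words_const_path[where c = c and Y = Y and x = x' and i = i])
            (use ust i in \<open>auto simp: u K'_def mult.commute\<close>)
        then have "small_words K' (u i) = {}" by blast
        then show False using Pt[of "M + i"] by (simp add: P_def u_def)
      qed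
    qed
    have iT: "\<exists>\<^sub>F n in sequentially. b n" and iF: "\<exists>\<^sub>F n in sequentially. \<not> b n"
      using const[of False] const[of True] by simp_all
    \<comment> \<open>After one turn of each kind beyond \<open>N\<close>, both side entries are
      former tips, and entries above 2 are only ever replaced by tips above 2.\<close>
    obtain n1 where n1: "n1 \<ge> N" "b n1" using iT by (auto simp: frequently_sequentially)
    obtain n2 where n2: "n2 \<ge> N" "\<not> b n2" using iF by (auto simp: frequently_sequentially)
    have Ygt: "cmod (fst (snd (t n))) > 2" if "n \<ge> Suc n1" for n
      using that
    proof (induction n rule: dec_induct)
      case base
      then show ?case using n1 Zgt[of n1] by (cases "t n1") (simp add: step)
    next
      case (step n)
      then show ?case using n1 Zgt[of n] by (cases "t n"; cases "b n") (simp_all add: \<open>\<And>n. t (Suc n) = mstep (b n) (t n)\<close>)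
    qed
    have Xgt: "cmod (fst (t n)) > 2" if "n \<ge> Suc n2" for n
      using that
    proof (induction n rule: dec_induct)
      case base
      then show ?case using n2 Zgt[of n2] by (cases "t n2") (simp add: step)
    next
      case (step n)
      then show ?case using n2 Zgt[of n] by (cases "t n"; cases "b n") (simp_all add: \<open>\<And>n. t (Suc n) = mstep (b n) (t n)\<close>)
    qed
    define M where "M = Suc (max n1 n2)"
    have shift: "\<exists>\<^sub>F n in sequentially. Q (n + M)" if "\<exists>\<^sub>F n in sequentially. Q n" for Q :: "nat \<Rightarrow> bool"
      using that eventually_sequentially_seg[of "\<lambda>n. \<not> Q n" M] by (simp add: frequently_def)
    have "kappa (t (0 + M)) = 4"
    proof (rule kappa_eq_4_if_descent[where b = "\<lambda>n. b (n + M)" and t = "\<lambda>n. t (n + M)"])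
      show "t (Suc n + M) = mstep (b (n + M)) (t (n + M))" for n using step[of "n + M"] by simp
      show "2 < cmod (fst (t (n + M)))" for n by (rule Xgt) (simp add: M_def)
      show "2 < cmod (fst (snd (t (n + M))))" for n by (rule Ygt) (simp add: M_def)
      show "2 < cmod (tip (t (n + M)))" for n using n1 by (intro Zgt) (simp add: M_def)
    qed (intro ng shift iT iF)+
    moreover have "kappa (t n) = kappa s" for n by (induction n) (simp_all add: step, simp add: t_def)
    ultimately show False using \<kappa> by simp
  qed
  then have "finite (small_words K' s)" by (simp add: P_def)
  then show ?thesis by (rule finite_subset[rotated]) (auto simp: small_words_def K'_def)
qed

section \<open>Reduced words and the Cayley tree\<close>

definition flip :: "letter \<Rightarrow> letter" where
  "flip l = (fst l, \<not> snd l)"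

definition push :: "letter \<Rightarrow> letter list \<Rightarrow> letter list" where
  "push l w = (case w of [] \<Rightarrow> [l] | m # v \<Rightarrow> if m = flip l then v else l # w)"

definition reduce :: "letter list \<Rightarrow> letter list" where
  "reduce w = foldr push w []"

definition winv :: "letter list \<Rightarrow> letter list" where
  "winv w = rev (map flip w)"

lemma flip_simps [simp]: "flip (flip l) = l" "fst (flip l) = fst l" "snd (flip l) = (\<not> snd l)" "flip (x, b) = (x, \<not> b)"
  by (simp_all add: flip_def)

lemma flip_neq [simp]: "flip l \<noteq> l" "l \<noteq> flip l"
  by (metis flip_simps(3))+

lemma eq_flip_iff: "l = flip k \<longleftrightarrow> fst k = fst l \<and> snd k \<noteq> snd l"
  by (cases k; cases l) auto

lemma reduced_iff_successively: "reduced w \<longleftrightarrow> successively (\<lambda>k l. l \<noteq> flip k) w"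
  by (induction w rule: reduced.induct) (simp_all add: eq_flip_iff)

lemma reduced_Cons_tail: "reduced (l # w) \<Longrightarrow> reduced w"
  by (cases w) auto

lemma reduced_push: "reduced w \<Longrightarrow> reduced (push l w)"
  by (cases w) (auto simp: push_def eq_flip_iff dest: reduced_Cons_tail)

lemma reduced_reduce [simp]: "reduced (reduce w)"
  unfolding reduce_def by (induction w) (simp_all add: reduced_push)

lemma reduce_reduced: "reduced w \<Longrightarrow> reduce w = w"
proof (induction w)
  case (Cons l w)
  then have "reduce w = w" by (blast dest: reduced_Cons_tail)
  then show ?case using Cons.prems by (cases w) (auto simp: reduce_def push_def eq_flip_iff)
qed (simp add: reduce_def)

lemma winv_simps [simp]: "winv [] = []" "winv (l # w) = winv w @ [flip l]" "winv (u @ v) = winv v @ winv u"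
    "length (winv w) = length w"
  by (simp_all add: winv_def)

lemma reduced_winv: "reduced w \<Longrightarrow> reduced (winv w)"
  by (auto simp: reduced_iff_successively winv_def successively_map intro: successively_mono)

section \<open>Values of words in a group\<close>

context group
begin

lemma inv_mult_cancel [simp]:
  "\<lbrakk>x \<in> carrier G; y \<in> carrier G\<rbrakk> \<Longrightarrow> inv x \<otimes> (x \<otimes> y) = y"
  "\<lbrakk>x \<in> carrier G; y \<in> carrier G\<rbrakk> \<Longrightarrow> x \<otimes> (inv x \<otimes> y) = y"
  by (simp_all add: m_assoc[symmetric])

lemma letter_val_closed [simp, intro]:
  "\<lbrakk>U \<in> carrier G; V \<in> carrier G\<rbrakk> \<Longrightarrow> letter_val G U V l \<in> carrier G"
  by (cases l; cases "fst l") auto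

lemma letter_val_flip:
  "\<lbrakk>U \<in> carrier G; V \<in> carrier G\<rbrakk> \<Longrightarrow> letter_val G U V (flip l) = inv (letter_val G U V l)"
  by (cases l; cases "fst l") auto

lemma word_val_simps [simp]:
  "word_val G U V [] = \<one>" "word_val G U V (l # w) = letter_val G U V l \<otimes> word_val G U V w"
  by (simp_all add: word_val_def)

lemma word_val_closed [simp, intro]:
  "\<lbrakk>U \<in> carrier G; V \<in> carrier G\<rbrakk> \<Longrightarrow> word_val G U V w \<in> carrier G"
  by (induction w) auto

lemma word_val_append:
  "\<lbrakk>U \<in> carrier G; V \<in> carrier G\<rbrakk> \<Longrightarrow> word_val G U V (w @ v) = word_val G U V w \<otimes> word_val G U V v"
  by (induction w) (auto simp: m_assoc)

lemma word_val_winv: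
  "\<lbrakk>U \<in> carrier G; V \<in> carrier G\<rbrakk> \<Longrightarrow> word_val G U V (winv w) = inv (word_val G U V w)"
  by (induction w) (auto simp: word_val_append letter_val_flip inv_mult_group)

lemma word_val_push:
  "\<lbrakk>U \<in> carrier G; V \<in> carrier G\<rbrakk> \<Longrightarrow> word_val G U V (push l w) = letter_val G U V l \<otimes> word_val G U V w"
  by (cases w) (auto simp: push_def letter_val_flip)

lemma word_val_reduce:
  "\<lbrakk>U \<in> carrier G; V \<in> carrier G\<rbrakk> \<Longrightarrow> word_val G U V (reduce w) = word_val G U V w"
  unfolding reduce_def by (induction w) (auto simp: word_val_push)

lemma subgroup_words:
  assumes "U \<in> carrier G" "V \<in> carrier G"
  shows "subgroup (range (word_val G U V)) G"
proof
  show "range (word_val G U V) \<subseteq> carrier G" using assms by auto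
  show "\<one> \<in> range (word_val G U V)" by (rule range_eqI[of _ _ "[]"]) simp
  fix x assume "x \<in> range (word_val G U V)"
  then obtain u where u: "x = word_val G U V u" by auto
  then show "inv x \<in> range (word_val G U V)"
    by (intro range_eqI[of _ _ "winv u"]) (simp add: word_val_winv assms)
  fix y assume "y \<in> range (word_val G U V)"
  then obtain v where "y = word_val G U V v" by auto
  then show "x \<otimes> y \<in> range (word_val G U V)"
    using u by (intro range_eqI[of _ _ "u @ v"]) (simp add: word_val_append assms)
qed

end

section \<open>Longest common prefixes\<close>

fun lcp :: "'a list \<Rightarrow> 'a list \<Rightarrow> nat" where
  "lcp (x # xs) (y # ys) = (if x = y then Suc (lcp xs ys) else 0)"
| "lcp _ _ = 0"

lemma lcp_commute: "lcp x y = lcp y x"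
  by (induction x y rule: lcp.induct) (auto elim: lcp.elims)

text \<open>Two prefixes of the same word \<open>y\<close> are comparable. This is the tree property
  of the Cayley graph, in the form that the cancellation estimates use.\<close>

lemma lcp_ultra: "min (lcp x y) (lcp y z) \<le> lcp x z"
proof (induction x y arbitrary: z rule: lcp.induct)
  case (1 x xs y ys)
  show ?case
  proof (cases z)
    case (Cons c cs)
    then show ?thesis using 1[of cs] by (auto simp: min_def split: if_splits)
  qed simp
qed auto

lemma lcp_split:
  obtains p u v where "x = p @ u" "y = p @ v" "length p = lcp x y" "u = [] \<or> v = [] \<or> hd u \<noteq> hd v"
proof -
  have "\<exists>p u v. x = p @ u \<and> y = p @ v \<and> length p = lcp x y \<and> (u = [] \<or> v = [] \<or> hd u \<noteq> hd v)"
  proof (induction x y rule: lcp.induct)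
    case (1 x xs y ys)
    show ?case
    proof (cases "x = y")
      case True
      then obtain p u v where "xs = p @ u" "ys = p @ v" "length p = lcp xs ys" "u = [] \<or> v = [] \<or> hd u \<noteq> hd v"
        using 1 by blast
      then show ?thesis using True by (intro exI[of _ "x # p"] exI[of _ u] exI[of _ v]) auto
    next
      case False
      then show ?thesis by (intro exI[of _ "[]"] exI[of _ "x # xs"] exI[of _ "y # ys"]) auto
    qed
  qed auto
  then show ?thesis using that by blast
qed

lemma lcp_append_self [simp]: "lcp p (p @ q) = length p"
  by (induction p) auto

lemma lcp_le_length: "lcp x y \<le> length x"
  by (induction x y rule: lcp.induct) auto

lemma lcp_nth: "i < lcp x y \<Longrightarrow> x ! i = y ! i"
  by (induction x y arbitrary: i rule: lcp.induct) (auto simp: nth_Cons split: nat.splits if_splits)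

text \<open>Cancellation in \<open>w w\<close> cannot reach the middle of \<open>w\<close>: there a
  letter would be its own inverse, or two adjacent letters would cancel.\<close>

lemma lcp_winv:
  assumes "reduced w" "w \<noteq> []"
  shows "2 * lcp (winv w) w < length w"
proof (rule ccontr)
  assume "\<not> ?thesis"
  then have ge: "length w \<le> 2 * lcp (winv w) w" by simp
  have mirror: "w ! i = flip (w ! (length w - Suc i))" if "i < lcp (winv w) w" for i
    using lcp_nth[OF that] lcp_le_length[of "winv w" w] that
    by (auto simp: winv_def rev_nth)
  have pos: "length w > 0" using assms by simp
  \<comment> \<open>The middle position, or the left one of the two middle positions.\<close>
  define i where "i = (length w - 1) div 2"
  have i: "i < lcp (winv w) w" using ge pos unfolding i_def by linarith
  show False
  proof (cases "even (length w)")
    case True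
    then have "length w - Suc i = Suc i" "Suc i < length w" using pos unfolding i_def by presburger+
    then have "w ! i = flip (w ! Suc i)" "Suc i < length w" using mirror[OF i] by auto
    then show False using assms(1) unfolding reduced_iff_successively successively_conv_nth by auto
  next
    case False
    then have "length w - Suc i = i" using pos unfolding i_def by presburger
    then show False using mirror[OF i] by (metis flip_neq(1))
  qed
qed

section \<open>Length and Gromov product in the free group\<close>

locale free2 = group G for G (structure) +
  fixes a b
  assumes basis: "free_basis G a b"
begin

lemma gens_closed [simp, intro]: "a \<in> carrier G" "b \<in> carrier G"
  using basis by (auto simp: free_basis_def)

definition nf :: "'a \<Rightarrow> letter list" where
  "nf = the_inv_into {w. reduced w} (word_val G a b)"

lemma nf: assumes "g \<in> carrier G" shows "reduced (nf g)" "word_val G a b (nf g) = g"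
  using basis assms the_inv_into_into[of "word_val G a b" "{w. reduced w}" g]
    f_the_inv_into_f[of "word_val G a b" "{w. reduced w}" g]
  by (auto simp: nf_def free_basis_def bij_betw_def)

lemma nf_word_val: "nf (word_val G a b w) = reduce w"
  using basis the_inv_into_f_f[of "word_val G a b" "{w. reduced w}" "reduce w"]
  by (auto simp: nf_def free_basis_def bij_betw_def word_val_reduce)

lemma nf_eq: "\<lbrakk>reduced w; word_val G a b w = g\<rbrakk> \<Longrightarrow> nf g = w"
  using nf_word_val[of w] reduce_reduced[of w] by simp

lemma nf_inject:
  assumes "x \<in> carrier G" "y \<in> carrier G" "nf x = nf y"
  shows "x = y"
  using nf(2)[OF assms(1)] nf(2)[OF assms(2)] unfolding assms(3) by (rule trans[OF sym])

text \<open>Integer-valued so that Gromov products can be subtracted.\<close>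

definition len :: "'a \<Rightarrow> int" where
  "len g = int (length (nf g))"

text \<open>The Gromov product at the identity in the Cayley tree.\<close>

definition gp :: "'a \<Rightarrow> 'a \<Rightarrow> int" where
  "gp x y = int (lcp (nf x) (nf y))"

lemma nf_inv: "x \<in> carrier G \<Longrightarrow> nf (inv x) = winv (nf x)"
  by (rule nf_eq) (simp_all add: reduced_winv nf word_val_winv)

lemma len_inv [simp]: "x \<in> carrier G \<Longrightarrow> len (inv x) = len x"
  by (simp add: len_def nf_inv)

lemma len_mult:
  assumes "x \<in> carrier G" "y \<in> carrier G"
  shows "len (inv x \<otimes> y) = len x + len y - 2 * gp x y"
proof -
  obtain p u v where p: "nf x = p @ u" "nf y = p @ v" "length p = lcp (nf x) (nf y)" "u = [] \<or> v = [] \<or> hd u \<noteq> hd v"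
    by (rule lcp_split)
  have red: "reduced u" "reduced v"
    using nf(1)[OF assms(1)] nf(1)[OF assms(2)] p by (auto simp: reduced_iff_successively successively_append_iff)
  have "reduced (winv u @ v)"
    using reduced_winv[OF red(1)] red(2) p(4) unfolding reduced_iff_successively successively_append_iff
    by (cases u) auto
  moreover have "word_val G a b (winv u @ v) = inv x \<otimes> y"
  proof -
    have "x = word_val G a b p \<otimes> word_val G a b u" "y = word_val G a b p \<otimes> word_val G a b v"
      using nf(2)[OF assms(1)] nf(2)[OF assms(2)] p by (auto simp: word_val_append)
    then show ?thesis by (simp add: word_val_append word_val_winv inv_mult_group m_assoc)
  qed
  ultimately have "nf (inv x \<otimes> y) = winv u @ v" by (rule nf_eq)
  then show ?thesis using p by (simp add: len_def gp_def)
qed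

lemma len_mult': "\<lbrakk>x \<in> carrier G; y \<in> carrier G\<rbrakk> \<Longrightarrow> len (x \<otimes> y) = len x + len y - 2 * gp (inv x) y"
  using len_mult[of "inv x" y] by simp

lemma gp_ultra: "min (gp x y) (gp y z) \<le> gp x z"
  using lcp_ultra[of "nf x" "nf y" "nf z"] by (simp add: gp_def min_def split: if_splits)

lemma gp_commute: "gp x y = gp y x"
  by (simp add: gp_def lcp_commute)

lemma gp_bounds: "0 \<le> gp x y" "gp x y \<le> len x" "gp x y \<le> len y"
  using lcp_le_length[of "nf x" "nf y"] lcp_le_length[of "nf y" "nf x"]
  by (simp_all add: gp_def len_def lcp_commute)

lemma nf_one [simp]: "nf \<one> = []"
  by (rule nf_eq) auto

lemma len_one [simp]: "len \<one> = 0"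
  by (simp add: len_def)

lemma len_pos: "\<lbrakk>x \<in> carrier G; x \<noteq> \<one>\<rbrakk> \<Longrightarrow> 1 \<le> len x"
  using nf_inject[of x \<one>] by (cases "nf x") (auto simp: len_def)

lemma gp_inv_self: "\<lbrakk>x \<in> carrier G; x \<noteq> \<one>\<rbrakk> \<Longrightarrow> 2 * gp (inv x) x < len x"
  using lcp_winv[of "nf x"] nf(1)[of x] nf_inject[of x \<one>]
  by (cases "nf x = []") (auto simp: gp_def len_def nf_inv)

lemma prefix_exists:
  assumes "x \<in> carrier G" "0 \<le> k" "k \<le> len x"
  obtains s where "s \<in> carrier G" "len s = k" "gp s x = k"
proof -
  define p where "p = take (nat k) (nf x)"
  have "reduced p" using nf(1)[OF assms(1)] append_take_drop_id[of "nat k" "nf x"]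
    unfolding p_def reduced_iff_successively by (metis successively_append_iff)
  then have s: "nf (word_val G a b p) = p" by (simp add: nf_word_val reduce_reduced)
  have "lcp p (nf x) = length p" unfolding p_def by (metis append_take_drop_id lcp_append_self)
  then show ?thesis
    using assms s by (intro that[of "word_val G a b p"]) (auto simp: len_def gp_def p_def)
qed

text \<open>Generation without freeness: phrased by subgroups, it passes to conjugates and through
  Nielsen moves without any normal forms. Freeness enters the reduction only as
  non-commutation.\<close>

definition gens :: "'a \<Rightarrow> 'a \<Rightarrow> bool" where
  "gens U V \<longleftrightarrow> U \<in> carrier G \<and> V \<in> carrier G \<and>
     (\<forall>H. subgroup H G \<longrightarrow> U \<in> H \<longrightarrow> V \<in> H \<longrightarrow> H = carrier G)"

lemma gens_word:
  assumes "gens U V" "g \<in> carrier G"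
  obtains w where "reduced w" "word_val G U V w = g"
proof -
  have UV: "U \<in> carrier G" "V \<in> carrier G" using assms by (auto simp: gens_def)
  have "U = word_val G U V [(GX, True)]" "V = word_val G U V [(GY, True)]" using UV by auto
  then have "U \<in> range (word_val G U V)" "V \<in> range (word_val G U V)" by blast+
  then have "range (word_val G U V) = carrier G"
    using assms subgroup_words[OF UV] by (auto simp: gens_def)
  then obtain w where "g = word_val G U V w" using assms(2) by (metis rangeE)
  then show ?thesis using that[of "reduce w"] UV by (simp add: word_val_reduce)
qed

section \<open>Cancellation in pairs that no conjugated Nielsen move shortens\<close>

context
  fixes U V
  assumes UV [simp, intro]: "U \<in> carrier G" "V \<in> carrier G" and ne1: "U \<noteq> \<one>" "V \<noteq> \<one>"
    and minimal: "\<And>l l' s. \<lbrakk>fst l \<noteq> fst l'; s \<in> carrier G\<rbrakk> \<Longrightarrow>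
        len (letter_val G U V l) + len (letter_val G U V l')
        \<le> len (inv s \<otimes> letter_val G U V l \<otimes> s)
          + len (inv s \<otimes> (letter_val G U V l \<otimes> letter_val G U V l') \<otimes> s)"
begin

abbreviation vl where "vl \<equiv> letter_val G U V"

lemma vl_flip [simp]: "vl (flip l) = inv (vl l)"
  by (rule letter_val_flip) auto

lemma len_vl: "1 \<le> len (vl l)"
  using ne1 len_pos[of U] len_pos[of V] by (cases l; cases "fst l") auto

lemma vl_ne_one: "vl l \<noteq> \<one>"
  using len_vl[of l] by auto

text \<open>For different generators, minimality with trivial conjugator says that neither factor is
  longer than the product; the second bound comes from the inverted and swapped pair. For a repeated
  letter, cancellation stops before the middle.\<close>

lemma half_cancel:
  assumes "l' \<noteq> flip l"
  shows "2 * gp (inv (vl l)) (vl l') \<le> len (vl l)" "2 * gp (inv (vl l)) (vl l') \<le> len (vl l')"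
proof -
  have "2 * gp (inv (vl l)) (vl l') \<le> len (vl l) \<and> 2 * gp (inv (vl l)) (vl l') \<le> len (vl l')"
  proof (cases "fst l = fst l'")
    case True
    then have "l' = l" using assms by (auto simp: eq_flip_iff prod_eq_iff)
    then show ?thesis using gp_inv_self[of "vl l"] vl_ne_one[of l] by simp
  next
    case False
    have 1: "len (vl l') \<le> len (vl l \<otimes> vl l')"
      using minimal[of l l' \<one>] False by simp
    have "len (vl l) \<le> len (inv (vl l') \<otimes> inv (vl l))"
      using minimal[of "flip l'" "flip l" \<one>] False by simp
    also have "\<dots> = len (vl l \<otimes> vl l')"
      using len_inv[of "vl l \<otimes> vl l'"] by (simp add: inv_mult_group)
    finally show ?thesis using 1 len_mult'[of "vl l" "vl l'"] by simp
  qed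
  then show "2 * gp (inv (vl l)) (vl l') \<le> len (vl l)" "2 * gp (inv (vl l)) (vl l') \<le> len (vl l')" by auto
qed

text \<open>If both halves of \<open>u\<close> cancelled in \<open>v u v\<close>, conjugating \<open>(u, u v)\<close> by the first half of \<open>u\<close>
  would contradict minimality.\<close>

lemma cancel_both_sides:
  assumes kl: "l \<noteq> flip k" and lm: "m \<noteq> flip l"
  shows "gp (inv (vl k)) (vl l) + gp (inv (vl l)) (vl m) < len (vl l)"
proof (rule ccontr)
  let ?u = "vl l" and ?v = "vl m"
  assume "\<not> ?thesis"
  then have h: "2 * gp (inv (vl k)) ?u = len ?u" "2 * gp (inv ?u) ?v = len ?u"
    using half_cancel(2)[OF kl] half_cancel(1)[OF lm] by linarith+
  have self: "2 * gp (inv ?u) ?u < len ?u" using gp_inv_self[of ?u] vl_ne_one by simp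
  \<comment> \<open>A repeated letter would cancel less than half of \<open>u\<close>, by
    \<open>self\<close>. As there are only two generators, \<open>k\<close> and \<open>m\<close>
    then belong to the same one.\<close>
  have nk: "fst k \<noteq> fst l"
  proof
    assume "fst k = fst l"
    then have "k = l" using kl by (auto simp: eq_flip_iff prod_eq_iff)
    then show False using h self by simp
  qed
  have nm: "fst m \<noteq> fst l"
  proof
    assume "fst m = fst l"
    then have "m = l" using lm by (auto simp: eq_flip_iff prod_eq_iff)
    then show False using h self by simp
  qed
  have "fst k = fst m" using nk nm by (metis gen.exhaust)
  then have "k = flip m \<or> k = m" by (auto simp: eq_flip_iff prod_eq_iff)
  then show False
  proof
    \<comment> \<open>Now \<open>v\<close> begins with the first half of \<open>u\<close> and with
      the first half of \<open>inv u\<close>, so \<open>u\<close> would cancel half of itself in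
      \<open>u u\<close>.\<close>
    assume "k = flip m"
    then have "2 * gp ?v ?u = len ?u" using h by simp
    then show False using h self gp_ultra[of "inv ?u" ?v ?u] by linarith
  next
    assume "k = m"
    then have hv: "2 * gp (inv ?v) ?u = len ?u" using h by simp
    define c where "c = gp (inv ?u) ?v"
    have c: "len ?u = 2 * c" "gp (inv ?v) ?u = c" "gp (inv ?u) ?v = c" "1 \<le> c"
      using h hv len_vl[of l] by (auto simp: c_def)
    have lv: "2 * c \<le> len ?v" using half_cancel(2)[OF lm] c by simp
    \<comment> \<open>\<open>s\<close> is the first half of \<open>u\<close> and \<open>t\<close>
      the second. Conjugation by \<open>s\<close> turns \<open>u\<close> into \<open>t s\<close> and
      \<open>u v\<close> into \<open>t v s\<close>, where both outer factors are absorbed by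
      \<open>v\<close>.\<close>
    obtain s where s [simp]: "s \<in> carrier G" and ls: "len s = c" "gp s ?u = c"
      using prefix_exists[of ?u c] c by auto
    define t where "t = inv s \<otimes> ?u"
    have t [simp]: "t \<in> carrier G" by (simp add: t_def)
    have lt: "len t = c" using len_mult[of s ?u] ls c by (simp add: t_def)
    have 1: "len (inv s \<otimes> ?u \<otimes> s) \<le> 2 * c"
      using len_mult'[of t s] lt ls gp_bounds(1)[of "inv t" s] by (simp add: t_def)
    have "gp (inv t) (inv ?u) = c"
    proof -
      have "t \<otimes> inv ?u = inv s" by (simp add: t_def m_assoc)
      then show ?thesis using len_mult'[of t "inv ?u"] lt ls c by simp
    qed
    then have "gp (inv t) ?v \<ge> c" using gp_ultra[of "inv t" "inv ?u" ?v] c by linarith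
    then have gtv: "gp (inv t) ?v = c" using gp_bounds(2)[of "inv t" ?v] lt by simp
    then have ltv: "len (t \<otimes> ?v) = len ?v - c" using len_mult'[of t ?v] lt by simp
    have "gp (inv (t \<otimes> ?v)) (inv ?v) = len ?v - c"
      using len_mult'[of "t \<otimes> ?v" "inv ?v"] ltv lt by (simp add: m_assoc)
    moreover have "gp (inv ?v) s \<ge> c"
      using gp_ultra[of "inv ?v" ?u s] c ls gp_commute[of s ?u] by simp
    ultimately have "gp (inv (t \<otimes> ?v)) s \<ge> c"
      using gp_ultra[of "inv (t \<otimes> ?v)" "inv ?v" s] lv by linarith
    then have "len (t \<otimes> ?v \<otimes> s) \<le> len ?v - 2 * c"
      using len_mult'[of "t \<otimes> ?v" s] ltv ls by simp
    moreover have "t \<otimes> ?v \<otimes> s = inv s \<otimes> (?u \<otimes> ?v) \<otimes> s" by (simp add: t_def m_assoc)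
    ultimately show False
      using minimal[of l m s] nm 1 c by simp
  qed
qed

text \<open>By \<open>cancel_both_sides\<close> every syllable keeps a letter between its two
  cancelled ends, so what happens at its left end does not depend on what follows. Carrying the
  preceding letter \<open>k\<close> makes this local fact inductive.\<close>

lemma len_word_ge_aux:
  assumes "reduced (l # w)" "l \<noteq> flip k"
  shows "gp (inv (vl k)) (word_val G U V (l # w)) = gp (inv (vl k)) (vl l) \<and>
    int (length (l # w)) \<le> len (word_val G U V (l # w)) - gp (inv (vl k)) (vl l)"
  using assms
proof (induction w arbitrary: l k)
  case Nil
  have "2 * gp (inv (vl k)) (vl l) \<le> len (vl l)" using half_cancel[OF Nil(2)] by simp
  then show ?case using len_vl[of l] by simp
next
  case (Cons l' w)
  define W where "W = word_val G U V (l' # w)"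
  have W [simp]: "W \<in> carrier G" by (simp add: W_def)
  have l': "l' \<noteq> flip l" "reduced (l' # w)" using Cons.prems by (auto simp: eq_flip_iff)
  have IH: "gp (inv (vl l)) W = gp (inv (vl l)) (vl l')" "int (length (l' # w)) \<le> len W - gp (inv (vl l)) (vl l')"
    using Cons.IH[OF l'(2,1)] by (auto simp: W_def)
  define c where "c = gp (inv (vl l)) (vl l')"
  define c' where "c' = gp (inv (vl k)) (vl l)"
  have cc: "c' + c < len (vl l)" using cancel_both_sides[OF Cons.prems(2) l'(1)] by (simp add: c_def c'_def)
  have lenW: "len (vl l \<otimes> W) = len (vl l) + len W - 2 * c"
    using len_mult'[of "vl l" W] IH by (simp add: c_def)
  have "gp (vl l) (vl l \<otimes> W) = len (vl l) - c"
    using len_mult[of "vl l" "vl l \<otimes> W"] lenW by simp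
  then have "gp (inv (vl k)) (vl l \<otimes> W) = c'"
    using gp_ultra[of "inv (vl k)" "vl l" "vl l \<otimes> W"] gp_ultra[of "inv (vl k)" "vl l \<otimes> W" "vl l"]
      gp_commute[of "vl l" "vl l \<otimes> W"] cc by (simp add: c'_def min_def split: if_splits)
  then show ?case using IH(2) cc lenW by (simp add: W_def[symmetric] c_def c'_def del: word_val_simps(2)) (simp add: W_def)
qed

lemma len_word_ge: "reduced w \<Longrightarrow> int (length w) \<le> len (word_val G U V w)"
proof (cases w)
  case (Cons l v)
  assume "reduced w"
  then show ?thesis using len_word_ge_aux[of l v l] gp_bounds(1)[of "inv (vl l)" "vl l"] Cons by simp
qed simp

end

end

section \<open>Nielsen reduction for pairs\<close>

context group
begin

fun gstep :: "bool \<Rightarrow> 'a \<times> 'a \<Rightarrow> 'a \<times> 'a" where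
  "gstep True (A, B) = (A, A \<otimes> B)"
| "gstep False (A, B) = (A \<otimes> B, B)"

definition gnode :: "'a \<times> 'a \<Rightarrow> bool list \<Rightarrow> 'a \<times> 'a" where
  "gnode s w = foldl (\<lambda>s b. gstep b s) s w"

lemma gnode_simps [simp]:
  "gnode s [] = s" "gnode s (c # w) = gnode (gstep c s) w" "gnode s (w @ v) = gnode (gnode s w) v"
  by (simp_all add: gnode_def)

lemma gnode_closed:
  "\<lbrakk>fst s \<in> carrier G; snd s \<in> carrier G\<rbrakk> \<Longrightarrow> fst (gnode s w) \<in> carrier G \<and> snd (gnode s w) \<in> carrier G"
proof (induction w arbitrary: s)
  case (Cons c w)
  then show ?case by (cases s; cases c) (simp_all add: Cons.IH)
qed simp

end

context free2
begin

text \<open>From \<open>(a, b)\<close> the tree reaches only elements whose two exponent sums have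
  equal sign; \<open>inv b\<close> provides the opposite sign.\<close>

definition seed :: "bool \<Rightarrow> 'a \<times> 'a" where
  "seed e = (a, if e then b else inv b)"

lemma seed_closed [simp]: "fst (seed e) \<in> carrier G" "snd (seed e) \<in> carrier G"
  by (simp_all add: seed_def)

text \<open>The two letters encode the signed permutation applied to \<open>(A, B)\<close>.\<close>

definition signed_conj :: "'a \<Rightarrow> 'a \<Rightarrow> letter \<Rightarrow> letter \<Rightarrow> 'a \<Rightarrow> 'a \<Rightarrow> 'a \<Rightarrow> bool" where
  "signed_conj A B l l' s U V \<longleftrightarrow> s \<in> carrier G \<and> fst l \<noteq> fst l' \<and>
     U = inv s \<otimes> letter_val G A B l \<otimes> s \<and> V = inv s \<otimes> letter_val G A B l' \<otimes> s"

definition reached :: "'a \<Rightarrow> 'a \<Rightarrow> bool" where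
  "reached U V \<longleftrightarrow> (\<exists>e w l l' s. signed_conj (fst (gnode (seed e) w)) (snd (gnode (seed e) w)) l l' s U V)"

lemma reached_node:
  assumes "gnode (seed e) w = (A, B)" "s \<in> carrier G" "fst l \<noteq> fst l'"
    "U = inv s \<otimes> letter_val G A B l \<otimes> s" "V = inv s \<otimes> letter_val G A B l' \<otimes> s"
  shows "reached U V"
  unfolding reached_def signed_conj_def using assms
  by (intro exI[of _ e] exI[of _ w] exI[of _ l] exI[of _ l'] exI[of _ s]) auto

lemma letter_val_conj:
  assumes "A \<in> carrier G" "B \<in> carrier G" "s \<in> carrier G"
  shows "letter_val G (inv s \<otimes> A \<otimes> s) (inv s \<otimes> B \<otimes> s) l = inv s \<otimes> letter_val G A B l \<otimes> s"
  using assms by (cases l; cases "fst l") (auto simp: inv_mult_group m_assoc)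

lemma letter_val_letters:
  assumes "A \<in> carrier G" "B \<in> carrier G"
  obtains k where "fst k = fst (if fst l = GX then m else m')"
    "letter_val G (letter_val G A B m) (letter_val G A B m') l = letter_val G A B k"
proof -
  obtain x c where l: "l = (x, c)" by (cases l)
  show ?thesis
    using that[of "if c then (if fst l = GX then m else m') else flip (if fst l = GX then m else m')"]
    by (cases x) (auto simp: l letter_val_flip assms)
qed

lemma reached_letters:
  assumes "reached U V" "fst l \<noteq> fst l'" "t \<in> carrier G"
  shows "reached (inv t \<otimes> letter_val G U V l \<otimes> t) (inv t \<otimes> letter_val G U V l' \<otimes> t)"
proof -
  obtain e w m m' s where sc: "signed_conj (fst (gnode (seed e) w)) (snd (gnode (seed e) w)) m m' s U V"
    using assms(1) by (auto simp: reached_def)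
  obtain A B where AB: "gnode (seed e) w = (A, B)" by fastforce
  have c [simp]: "A \<in> carrier G" "B \<in> carrier G" using gnode_closed[of "seed e" w] AB by auto
  have s [simp]: "s \<in> carrier G" and mm: "fst m \<noteq> fst m'"
    and UV: "U = inv s \<otimes> letter_val G A B m \<otimes> s" "V = inv s \<otimes> letter_val G A B m' \<otimes> s"
    using sc AB by (auto simp: signed_conj_def)
  obtain k where k: "fst k = fst (if fst l = GX then m else m')"
      "letter_val G (letter_val G A B m) (letter_val G A B m') l = letter_val G A B k"
    by (rule letter_val_letters[OF c])
  obtain k' where k': "fst k' = fst (if fst l' = GX then m else m')"
      "letter_val G (letter_val G A B m) (letter_val G A B m') l' = letter_val G A B k'"
    by (rule letter_val_letters[OF c])
  show ?thesis
  proof (rule reached_node[OF AB])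
    show "s \<otimes> t \<in> carrier G" using assms by simp
    show "fst k \<noteq> fst k'" using k k' mm assms(2) by (auto split: if_splits) (metis gen.exhaust)+
    show "inv t \<otimes> letter_val G U V l \<otimes> t = inv (s \<otimes> t) \<otimes> letter_val G A B k \<otimes> (s \<otimes> t)"
      "inv t \<otimes> letter_val G U V l' \<otimes> t = inv (s \<otimes> t) \<otimes> letter_val G A B k' \<otimes> (s \<otimes> t)"
      unfolding UV letter_val_conj[OF letter_val_closed[OF c] letter_val_closed[OF c] s] k k'
      using assms(3) by (simp_all add: inv_mult_group m_assoc)
  qed
qed

text \<open>Division moves towards the root. At a child with parent (A', B') one quotient leads back
  to the parent and the other to the sibling, up to signs and conjugation; at the root both lead to
  a child of the other seed.\<close>

lemma reached_div_node:
  assumes AB: "gnode (seed e) w = (A, B)"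
  shows "reached A (inv A \<otimes> B)" "reached B (inv B \<otimes> A)"
proof -
  have c [simp]: "A \<in> carrier G" "B \<in> carrier G" using gnode_closed[of "seed e" w] AB by auto
  have "reached A (inv A \<otimes> B) \<and> reached B (inv B \<otimes> A)"
  proof (cases w rule: rev_cases)
    case Nil
    then have AB': "A = a" "B = (if e then b else inv b)" using AB by (auto simp: seed_def)
    have n: "gnode (seed (\<not> e)) [True] = (a, a \<otimes> inv B)" "gnode (seed (\<not> e)) [False] = (a \<otimes> inv B, inv B)"
      by (simp_all add: seed_def AB')
    show ?thesis
      by (intro conjI reached_node[OF n(1), of a "(GX, True)" "(GY, False)"]
           reached_node[OF n(2), of "inv B" "(GY, False)" "(GX, True)"] reached_node[OF n(2), of "B" "(GY, False)" "(GX, True)"])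
        (use c in \<open>simp_all add: AB'(1) inv_mult_group m_assoc\<close>)
  next
    case (snoc v c)
    obtain A' B' where n: "gnode (seed e) v = (A', B')" by fastforce
    have c' [simp]: "A' \<in> carrier G" "B' \<in> carrier G" using gnode_closed[of "seed e" v] n by auto
    have n1: "gnode (seed e) (v @ [True]) = (A', A' \<otimes> B')" "gnode (seed e) (v @ [False]) = (A' \<otimes> B', B')"
      using n by simp_all
    show ?thesis
    proof (cases c)
      case True
      then have AB': "A = A'" "B = A' \<otimes> B'" using AB snoc n by auto
      have "reached A (inv A \<otimes> B)"
        by (rule reached_node[OF n, of \<one> "(GX, True)" "(GY, True)"]) (simp_all add: AB')
      moreover have "reached B (inv B \<otimes> A)"
        by (rule reached_node[OF n1(2), of \<one> "(GX, True)" "(GY, False)"]) (simp_all add: AB' inv_mult_group m_assoc)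
      ultimately show ?thesis ..
    next
      case False
      then have AB': "A = A' \<otimes> B'" "B = B'" using AB snoc n by auto
      have "reached A (inv A \<otimes> B)"
        by (rule reached_node[OF n1(1), of "A' \<otimes> B'" "(GY, True)" "(GX, False)"]) (simp_all add: AB' inv_mult_group m_assoc)
      moreover have "reached B (inv B \<otimes> A)"
        by (rule reached_node[OF n, of B' "(GY, True)" "(GX, True)"]) (simp_all add: AB' inv_mult_group m_assoc)
      ultimately show ?thesis ..
    qed
  qed
  then show "reached A (inv A \<otimes> B)" "reached B (inv B \<otimes> A)" by auto
qed

text \<open>The inverse of the reduction move from (U, V) to (U, UV). Letters of equal sign give a
  quotient of the node, treated by \<open>reached_div_node\<close>; letters of opposite sign give a
  product, hence a child.\<close>

lemma reached_div:
  assumes "reached U V" shows "reached U (inv U \<otimes> V)"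
proof -
  obtain e w m m' s where sc: "signed_conj (fst (gnode (seed e) w)) (snd (gnode (seed e) w)) m m' s U V"
    using assms by (auto simp: reached_def)
  obtain A B where AB: "gnode (seed e) w = (A, B)" by fastforce
  have c [simp]: "A \<in> carrier G" "B \<in> carrier G" using gnode_closed[of "seed e" w] AB by auto
  have s [simp]: "s \<in> carrier G" and mm: "fst m \<noteq> fst m'"
    and UV: "U = inv s \<otimes> letter_val G A B m \<otimes> s" "V = inv s \<otimes> letter_val G A B m' \<otimes> s"
    using sc AB by (auto simp: signed_conj_def)
  define \<alpha> \<beta> where "\<alpha> = letter_val G A B m" and "\<beta> = letter_val G A B m'"
  have [simp]: "\<alpha> \<in> carrier G" "\<beta> \<in> carrier G" by (auto simp: \<alpha>_def \<beta>_def)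
  have n: "gnode (seed e) (w @ [True]) = (A, A \<otimes> B)" "gnode (seed e) (w @ [False]) = (A \<otimes> B, B)"
    using AB by simp_all
  note d = reached_div_node[OF AB]
  have "reached \<alpha> (inv \<alpha> \<otimes> \<beta>)"
  proof -
    obtain x p y q where m: "m = (x, p)" "m' = (y, q)" by (cases m; cases m') auto
    consider "x = GX" "y = GY" "p" "q" | "x = GX" "y = GY" "\<not> p" "q" | "x = GX" "y = GY" "p" "\<not> q" | "x = GX" "y = GY" "\<not> p" "\<not> q"
      | "x = GY" "y = GX" "p" "q" | "x = GY" "y = GX" "\<not> p" "q" | "x = GY" "y = GX" "p" "\<not> q" | "x = GY" "y = GX" "\<not> p" "\<not> q"
      using mm m by (cases x; cases y; cases p; cases q) auto
    then show ?thesis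
    proof cases
      case 1 then show ?thesis using d(1) by (simp add: \<alpha>_def \<beta>_def m)
    next
      case 2 then show ?thesis
        by (intro reached_node[OF n(1), of \<one> "(GX, False)" "(GY, True)"]) (simp_all add: \<alpha>_def \<beta>_def m)
    next
      case 3 then show ?thesis
        by (intro reached_node[OF n(1), of A "(GX, True)" "(GY, False)"])
          (simp_all add: \<alpha>_def \<beta>_def m inv_mult_group m_assoc)
    next
      case 4
      have "inv (inv A) \<otimes> letter_val G A (inv A \<otimes> B) (GX, False) \<otimes> inv A = \<alpha>"
        "inv (inv A) \<otimes> letter_val G A (inv A \<otimes> B) (GY, False) \<otimes> inv A = inv \<alpha> \<otimes> \<beta>"
        using 4 by (simp_all add: \<alpha>_def \<beta>_def m inv_mult_group m_assoc)
      then show ?thesis using reached_letters[OF d(1), of "(GX, False)" "(GY, False)" "inv A"] by simp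
    next
      case 5 then show ?thesis using d(2) by (simp add: \<alpha>_def \<beta>_def m)
    next
      case 6 then show ?thesis
        by (intro reached_node[OF n(2), of "inv B" "(GY, False)" "(GX, True)"])
          (simp_all add: \<alpha>_def \<beta>_def m inv_mult_group m_assoc)
    next
      case 7 then show ?thesis
        by (intro reached_node[OF n(2), of \<one> "(GY, True)" "(GX, False)"])
          (simp_all add: \<alpha>_def \<beta>_def m inv_mult_group m_assoc)
    next
      case 8
      have "inv (inv B) \<otimes> letter_val G B (inv B \<otimes> A) (GX, False) \<otimes> inv B = \<alpha>"
        "inv (inv B) \<otimes> letter_val G B (inv B \<otimes> A) (GY, False) \<otimes> inv B = inv \<alpha> \<otimes> \<beta>"
        using 8 by (simp_all add: \<alpha>_def \<beta>_def m inv_mult_group m_assoc)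
      then show ?thesis using reached_letters[OF d(2), of "(GX, False)" "(GY, False)" "inv B"] by simp
    qed
  qed
  from reached_letters[OF this, of "(GX, True)" "(GY, True)" s] show ?thesis
    by (simp add: UV \<alpha>_def[symmetric] \<beta>_def[symmetric] inv_mult_group m_assoc)
qed

lemma gens_letters:
  assumes UV: "gens U V" and l: "fst l \<noteq> fst l'" and s: "s \<in> carrier G"
  shows "gens (inv s \<otimes> letter_val G U V l \<otimes> s) (inv s \<otimes> (letter_val G U V l \<otimes> letter_val G U V l') \<otimes> s)"
    (is "gens ?U' ?V'")
proof -
  have c [simp]: "U \<in> carrier G" "V \<in> carrier G" using UV by (auto simp: gens_def)
  let ?u = "letter_val G U V l" and ?v = "letter_val G U V l'"
  have "H = carrier G" if H: "subgroup H G" "?U' \<in> H" "?V' \<in> H" for H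
  proof -
    note HH = subgroup.m_closed[OF H(1)] subgroup.m_inv_closed[OF H(1)] subgroup.one_closed[OF H(1)]
    \<comment> \<open>The conjugate subgroup \<open>s H (inv s)\<close>.\<close>
    define K where "K = {g \<in> carrier G. inv s \<otimes> g \<otimes> s \<in> H}"
    have K: "subgroup K G"
    proof (rule subgroup.intro)
      show "K \<subseteq> carrier G" by (auto simp: K_def)
      show "\<one> \<in> K" using s HH(3) by (simp add: K_def)
      show "x \<otimes> y \<in> K" if "x \<in> K" "y \<in> K" for x y
      proof -
        have xy: "x \<in> carrier G" "y \<in> carrier G" "inv s \<otimes> x \<otimes> s \<in> H" "inv s \<otimes> y \<otimes> s \<in> H"
          using that by (simp_all add: K_def)
        from HH(1)[OF xy(3,4)] show ?thesis using xy(1,2) s by (simp add: K_def m_assoc)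
      qed
      show "inv x \<in> K" if "x \<in> K" for x
      proof -
        have x: "x \<in> carrier G" "inv s \<otimes> x \<otimes> s \<in> H" using that by (simp_all add: K_def)
        from HH(2)[OF x(2)] show ?thesis using x(1) s by (simp add: K_def m_assoc inv_mult_group)
      qed
    qed
    note KK = subgroup.m_closed[OF K] subgroup.m_inv_closed[OF K]
    have u: "?u \<in> K" "?u \<otimes> ?v \<in> K" using H(2,3) by (simp_all add: K_def)
    from KK(1)[OF KK(2)[OF u(1)] u(2)] have v: "?v \<in> K" by simp
    have inv: "x \<in> K" if "inv x \<in> K" "x \<in> carrier G" for x
      using KK(2)[OF that(1)] that(2) by simp
    obtain x p y q where m: "l = (x, p)" "l' = (y, q)" by (cases l; cases l') auto
    have "U \<in> K" "V \<in> K"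
      using u(1) v l inv[of U] inv[of V] by (cases x; cases y; auto simp: m split: if_splits)+
    then have KG: "K = carrier G" using UV K by (simp add: gens_def)
    have "g \<in> H" if "g \<in> carrier G" for g
    proof -
      have "s \<otimes> g \<otimes> inv s \<in> K" using that s KG by simp
      then show ?thesis using that s by (simp add: K_def m_assoc)
    qed
    then show ?thesis using subgroup.subset[OF H(1)] by blast
  qed
  then show ?thesis using s by (auto simp: gens_def)
qed

text \<open>Keeps the invariant that rules out a trivial entry when the reduction stops.\<close>

lemma noncommuting_letters:
  assumes c [simp]: "U \<in> carrier G" "V \<in> carrier G" and UV: "U \<otimes> V \<noteq> V \<otimes> U"
    and l: "fst l \<noteq> fst l'" and s [simp]: "s \<in> carrier G"
  shows "(inv s \<otimes> letter_val G U V l \<otimes> s) \<otimes> (inv s \<otimes> (letter_val G U V l \<otimes> letter_val G U V l') \<otimes> s)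
    \<noteq> (inv s \<otimes> (letter_val G U V l \<otimes> letter_val G U V l') \<otimes> s) \<otimes> (inv s \<otimes> letter_val G U V l \<otimes> s)"
proof
  let ?u = "letter_val G U V l" and ?v = "letter_val G U V l'"
  assume "(inv s \<otimes> ?u \<otimes> s) \<otimes> (inv s \<otimes> (?u \<otimes> ?v) \<otimes> s) = (inv s \<otimes> (?u \<otimes> ?v) \<otimes> s) \<otimes> (inv s \<otimes> ?u \<otimes> s)"
  then have "inv s \<otimes> (?u \<otimes> (?u \<otimes> (?v \<otimes> s))) = inv s \<otimes> (?u \<otimes> (?v \<otimes> (?u \<otimes> s)))"
    by (simp add: m_assoc)
  then have "?u \<otimes> (?v \<otimes> s) = ?v \<otimes> (?u \<otimes> s)" by simp
  then have uv: "?u \<otimes> ?v = ?v \<otimes> ?u" by (simp add: m_assoc[symmetric])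
  have comm: "inv x \<otimes> y = y \<otimes> inv x" if "x \<otimes> y = y \<otimes> x" "x \<in> carrier G" "y \<in> carrier G" for x y
  proof -
    have "inv x \<otimes> (x \<otimes> y) \<otimes> inv x = inv x \<otimes> (y \<otimes> x) \<otimes> inv x" by (simp only: that(1))
    then show ?thesis by (simp add: m_assoc that(2,3))
  qed
  have "letter_val G U V (flip l) \<otimes> ?v = ?v \<otimes> letter_val G U V (flip l)"
    using comm[OF uv] by (simp add: letter_val_flip)
  moreover have "letter_val G U V (flip l') \<otimes> ?u = ?u \<otimes> letter_val G U V (flip l')"
    using comm[OF uv[symmetric]] by (simp add: letter_val_flip)
  moreover have "letter_val G U V (flip l') \<otimes> letter_val G U V (flip l) = letter_val G U V (flip l) \<otimes> letter_val G U V (flip l')"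
    using arg_cong[OF uv, of "\<lambda>x. inv x"] by (simp add: letter_val_flip inv_mult_group)
  ultimately show False
    using uv UV l by (cases l; cases l'; cases "fst l"; cases "fst l'") (auto split: if_splits)
qed

text \<open>In a pair that cannot be shortened, a reduced word of n letters has a value of length at
  least n. So \<open>a\<close> and \<open>b\<close>, being of length one, are single letters in
  \<open>U\<close> and \<open>V\<close>, and the pair is the root up to order and signs.\<close>

lemma reached_if_short:
  assumes UV: "gens U V" "U \<otimes> V \<noteq> V \<otimes> U"
    and minimal: "\<And>l l' s. \<lbrakk>fst l \<noteq> fst l'; s \<in> carrier G\<rbrakk> \<Longrightarrow>
        len (letter_val G U V l) + len (letter_val G U V l')
        \<le> len (inv s \<otimes> letter_val G U V l \<otimes> s)
          + len (inv s \<otimes> (letter_val G U V l \<otimes> letter_val G U V l') \<otimes> s)"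
  shows "reached U V"
proof -
  have c [simp]: "U \<in> carrier G" "V \<in> carrier G" using UV(1) by (auto simp: gens_def)
  have ne: "U \<noteq> \<one>" "V \<noteq> \<one>" using UV(2) by auto
  have len1: "\<exists>l. g = letter_val G U V l" if g: "g \<in> carrier G" "nf g = [k]" for g k
  proof -
    obtain w where w: "reduced w" "word_val G U V w = g" using gens_word[OF UV(1) g(1)] .
    have "int (length w) \<le> len g" using len_word_ge[OF c ne minimal w(1)] w(2) by simp
    then have "length w \<le> 1" using g(2) by (simp add: len_def)
    moreover have "w \<noteq> []" using w(2) g(2) by auto
    ultimately obtain l where "w = [l]" by (cases w) auto
    then have "g = letter_val G U V l" using w(2) by simp
    then show ?thesis by blast
  qed
  have nab: "nf a = [(GX, True)]" "nf b = [(GY, True)]" "nf (inv a) = [(GX, False)]"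
    by (rule nf_eq; simp)+
  obtain l where l: "a = letter_val G U V l" using len1[of a] nab by auto
  obtain l' where l': "b = letter_val G U V l'" using len1[of b] nab by auto
  have ll': "fst l \<noteq> fst l'"
  proof
    assume "fst l = fst l'"
    then have "l' = l \<or> l' = flip l" by (auto simp: eq_flip_iff prod_eq_iff)
    then have "b = a \<or> b = inv a" using l l' by (auto simp: letter_val_flip)
    then show False using nab by auto
  qed
  have n: "gnode (seed True) [] = (a, b)" by (simp add: seed_def)
  obtain x p y q where m: "l = (x, p)" "l' = (y, q)" by (cases l; cases l') auto
  show ?thesis
  proof (cases x)
    case GX
    then have "y = GY" using ll' m by (cases y) auto
    then show ?thesis using l l' GX m
      by (intro reached_node[OF n, of \<one> "(GX, p)" "(GY, q)"]) (auto split: if_splits)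
  next
    case GY
    then have "y = GX" using ll' m by (cases y) auto
    then show ?thesis using l l' GY m
      by (intro reached_node[OF n, of \<one> "(GY, q)" "(GX, p)"]) (auto split: if_splits)
  qed
qed

text \<open>Induction on the total length: a conjugated Nielsen move shortens the pair, and the
  result pulls back by \<open>reached_div\<close>, conjugation and a choice of letters.\<close>

theorem reached_if_gens:
  assumes "gens U V" "U \<otimes> V \<noteq> V \<otimes> U"
  shows "reached U V"
  using assms
proof (induction "nat (len U + len V)" arbitrary: U V rule: less_induct)
  case less
  have c [simp]: "U \<in> carrier G" "V \<in> carrier G" using less.prems by (auto simp: gens_def)
  show ?case
  proof (cases "\<forall>l l' s. fst l \<noteq> fst l' \<longrightarrow> s \<in> carrier G \<longrightarrow>
        len (letter_val G U V l) + len (letter_val G U V l')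
        \<le> len (inv s \<otimes> letter_val G U V l \<otimes> s)
          + len (inv s \<otimes> (letter_val G U V l \<otimes> letter_val G U V l') \<otimes> s)")
    case True
    then show ?thesis using reached_if_short[OF less.prems] by blast
  next
    case False
    then obtain l l' s where ll': "fst l \<noteq> fst l'" and s [simp]: "s \<in> carrier G"
      and lt: "len (inv s \<otimes> letter_val G U V l \<otimes> s)
          + len (inv s \<otimes> (letter_val G U V l \<otimes> letter_val G U V l') \<otimes> s)
        < len (letter_val G U V l) + len (letter_val G U V l')"
      by (meson not_le)
    define u v where "u = letter_val G U V l" and "v = letter_val G U V l'"
    have uv [simp]: "u \<in> carrier G" "v \<in> carrier G" by (auto simp: u_def v_def)
    obtain x p y q where m: "l = (x, p)" "l' = (y, q)" by (cases l; cases l') auto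
    have luv: "len u + len v = len U + len V"
      using ll' m by (cases x; cases y) (auto simp: u_def v_def)
    have pos: "0 \<le> len g" for g by (simp add: len_def)
    have "reached (inv s \<otimes> u \<otimes> s) (inv s \<otimes> (u \<otimes> v) \<otimes> s)"
    proof (rule less.hyps)
      show "nat (len (inv s \<otimes> u \<otimes> s) + len (inv s \<otimes> (u \<otimes> v) \<otimes> s)) < nat (len U + len V)"
        using lt luv pos[of "inv s \<otimes> u \<otimes> s"] pos[of "inv s \<otimes> (u \<otimes> v) \<otimes> s"]
        by (simp add: u_def v_def)
      show "gens (inv s \<otimes> u \<otimes> s) (inv s \<otimes> (u \<otimes> v) \<otimes> s)"
        unfolding u_def v_def by (rule gens_letters[OF less.prems(1) ll' s])
      show "(inv s \<otimes> u \<otimes> s) \<otimes> (inv s \<otimes> (u \<otimes> v) \<otimes> s) \<noteq> (inv s \<otimes> (u \<otimes> v) \<otimes> s) \<otimes> (inv s \<otimes> u \<otimes> s)"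
        unfolding u_def v_def by (rule noncommuting_letters[OF c less.prems(2) ll' s])
    qed
    from reached_div[OF this] have "reached (inv s \<otimes> u \<otimes> s) (inv s \<otimes> v \<otimes> s)"
      by (simp add: inv_mult_group m_assoc)
    note r = reached_letters[OF this, of _ _ "inv s", unfolded letter_val_conj[OF uv s]]
    have r': "reached (letter_val G u v k) (letter_val G u v k')" if "fst k \<noteq> fst k'" for k k'
      using r[OF that] by (simp add: m_assoc)
    show ?thesis
    proof (cases x)
      case GX
      then have "y = GY" using ll' m by (cases y) auto
      then show ?thesis using r'[of "(GX, p)" "(GY, q)"] GX by (simp add: u_def v_def m split: if_splits)
    next
      case GY
      then have "y = GX" using ll' m by (cases y) auto
      then show ?thesis using r'[of "(GY, q)" "(GX, p)"] GY by (simp add: u_def v_def m split: if_splits)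
    qed
  qed
qed

end

section \<open>Automorphisms and the abelianisation\<close>

lemma word_val_hom:
  assumes "group G" "group H" "h \<in> hom G H" "U \<in> carrier G" "V \<in> carrier G"
  shows "h (word_val G U V w) = word_val H (h U) (h V) w"
proof -
  interpret group_hom G H h by (intro group_hom.intro group_hom_axioms.intro assms)
  have l: "h (letter_val G U V l) = letter_val H (h U) (h V) l" for l
    by (cases l; cases "fst l") (auto simp: assms(4,5))
  show ?thesis
    by (induction w) (simp_all add: l assms(4,5))
qed

context group
begin

lemma carrier_AutoGroup [simp]: "carrier (AutoGroup G) = auto G"
  by (simp add: AutoGroup_def)

lemma auto_hom: "h \<in> auto G \<Longrightarrow> h \<in> hom G G"
  by (simp add: auto_def)

lemma auto_closed: "\<lbrakk>h \<in> auto G; g \<in> carrier G\<rbrakk> \<Longrightarrow> h g \<in> carrier G"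
  by (auto simp: auto_def hom_def)

lemma auto_mult: "\<lbrakk>h \<in> auto G; x \<in> carrier G; y \<in> carrier G\<rbrakk> \<Longrightarrow> h (x \<otimes> y) = h x \<otimes> h y"
  by (auto simp: auto_def hom_def)

lemma auto_inv: "\<lbrakk>h \<in> auto G; x \<in> carrier G\<rbrakk> \<Longrightarrow> h (inv x) = inv (h x)"
  using group_hom.hom_inv[of G G h x] auto_hom is_group by (simp add: group_hom_def group_hom_axioms_def)

lemma auto_one: "h \<in> auto G \<Longrightarrow> h \<one> = \<one>"
  using group_hom.hom_one[of G G h] auto_hom is_group by (simp add: group_hom_def group_hom_axioms_def)

lemma auto_eqI:
  assumes "h \<in> auto G" "k \<in> auto G" "\<And>g. g \<in> carrier G \<Longrightarrow> h g = k g"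
  shows "h = k"
  using assms by (intro extensionalityI[of h "carrier G"]) (auto simp: auto_def Bij_def)

lemma AutoGroup_apply:
  "\<lbrakk>h \<in> auto G; k \<in> auto G; g \<in> carrier G\<rbrakk> \<Longrightarrow> (h \<otimes>\<^bsub>AutoGroup G\<^esub> k) g = h (k g)"
  by (simp add: AutoGroup_def BijGroup_def auto_def compose_def)

lemma AutoGroup_one_apply: "g \<in> carrier G \<Longrightarrow> \<one>\<^bsub>AutoGroup G\<^esub> g = g"
  by (simp add: AutoGroup_def BijGroup_def)

lemma AutoGroup_inv_apply:
  assumes "h \<in> auto G" "g \<in> carrier G"
  shows "h ((inv\<^bsub>AutoGroup G\<^esub> h) g) = g" "(inv\<^bsub>AutoGroup G\<^esub> h) g \<in> carrier G"
proof -
  interpret A: group "AutoGroup G" by (rule AutoGroup)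
  have "inv\<^bsub>AutoGroup G\<^esub> h \<in> auto G" using A.inv_closed[of h] assms by simp
  moreover have "(h \<otimes>\<^bsub>AutoGroup G\<^esub> inv\<^bsub>AutoGroup G\<^esub> h) g = g"
    using A.r_inv[of h] assms by (simp add: AutoGroup_one_apply)
  ultimately show "h ((inv\<^bsub>AutoGroup G\<^esub> h) g) = g" "(inv\<^bsub>AutoGroup G\<^esub> h) g \<in> carrier G"
    using assms AutoGroup_apply[of h "inv\<^bsub>AutoGroup G\<^esub> h" g] auto_closed by simp_all
qed

lemma inner_in_auto:
  assumes x: "x \<in> carrier G"
  shows "(\<lambda>g\<in>carrier G. x \<otimes> g \<otimes> inv x) \<in> auto G"
proof -
  have "bij_betw (\<lambda>g\<in>carrier G. x \<otimes> g \<otimes> inv x) (carrier G) (carrier G)"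
    by (rule bij_betwI[where g = "\<lambda>g. inv x \<otimes> g \<otimes> x"]) (use x in \<open>auto simp: m_assoc\<close>)
  then show ?thesis
    using x by (auto simp: auto_def Bij_def hom_def m_assoc)
qed

text \<open>Membership in \<open>auto G\<close> is carried along because the products of
  \<open>AutoGroup G\<close> are evaluated pointwise only for automorphisms.\<close>

lemma Inn_e_induct [consumes 1, case_names one inner elliptic inv mult]:
  assumes "\<phi> \<in> Inn_e G"
    and "Q \<one>\<^bsub>AutoGroup G\<^esub>"
    and "\<And>x. x \<in> carrier G \<Longrightarrow> Q (\<lambda>g\<in>carrier G. x \<otimes> g \<otimes> inv x)"
    and "\<And>\<phi> X Y. \<lbrakk>\<phi> \<in> auto G; free_basis G X Y; \<phi> X = inv X; \<phi> Y = inv Y\<rbrakk> \<Longrightarrow> Q \<phi>"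
    and inv: "\<And>\<phi>. \<lbrakk>\<phi> \<in> auto G; Q \<phi>\<rbrakk> \<Longrightarrow> Q (inv\<^bsub>AutoGroup G\<^esub> \<phi>)"
    and mult: "\<And>\<phi> \<psi>. \<lbrakk>\<phi> \<in> auto G; \<psi> \<in> auto G; Q \<phi>; Q \<psi>\<rbrakk> \<Longrightarrow> Q (\<phi> \<otimes>\<^bsub>AutoGroup G\<^esub> \<psi>)"
  shows "\<phi> \<in> auto G \<and> Q \<phi>"
proof -
  interpret A: group "AutoGroup G" by (rule AutoGroup)
  have gen: "h \<in> auto G \<and> Q h" if "h \<in> inner_autos G \<union> elliptic_involutions G" for h
    using that assms(3,4) inner_in_auto by (auto simp: inner_autos_def elliptic_involutions_def)
  show ?thesis
    using assms(1) unfolding Inn_e_def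
  proof (induction rule: generate.induct)
    case one
    then show ?case using A.one_closed assms(2) by simp
  next
    case (incl h)
    then show ?case using gen by blast
  next
    case (inv h)
    then show ?case using gen[of h] assms(5)[of h] A.inv_closed[of h] by simp
  next
    case (eng h1 h2)
    then show ?case using mult A.m_closed[of h1 h2] by simp
  qed
qed

lemma Inn_e_auto: "\<phi> \<in> Inn_e G \<Longrightarrow> \<phi> \<in> auto G"
  using Inn_e_induct[of \<phi> "\<lambda>_. True"] by simp

lemma inner_in_Inn_e: "x \<in> carrier G \<Longrightarrow> (\<lambda>g\<in>carrier G. x \<otimes> g \<otimes> inv x) \<in> Inn_e G"
  unfolding Inn_e_def by (rule generate.incl) (auto simp: inner_autos_def)

lemma subgroup_Inn_e: "subgroup (Inn_e G) (AutoGroup G)"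
  unfolding Inn_e_def
proof (rule group.generate_is_subgroup[OF AutoGroup])
  show "inner_autos G \<union> elliptic_involutions G \<subseteq> carrier (AutoGroup G)"
    using inner_in_auto by (auto simp: inner_autos_def elliptic_involutions_def)
qed

end

section \<open>Exponent sums and the Stern-Brocot tree\<close>

fun letter_vec :: "letter \<Rightarrow> int \<times> int" where
  "letter_vec (GX, s) = (if s then 1 else -1, 0)"
| "letter_vec (GY, s) = (0, if s then 1 else -1)"

definition expsum :: "letter list \<Rightarrow> int \<times> int" where
  "expsum w = sum_list (map letter_vec w)"

lemma letter_vec_flip: "letter_vec (flip l) = - letter_vec l"
  by (cases l; cases "fst l") auto

lemma expsum_push: "expsum (push l w) = letter_vec l + expsum w"
  by (cases w) (auto simp: push_def expsum_def letter_vec_flip)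

lemma expsum_reduce: "expsum (reduce w) = expsum w"
  unfolding reduce_def by (induction w) (simp_all add: expsum_push, simp_all add: expsum_def)

text \<open>The coefficients of the product of the pair at \<open>w\<close> in the pair at the root: adjacent entries of
  the Stern-Brocot tree.\<close>

fun coef :: "bool list \<Rightarrow> nat \<times> nat" where
  "coef [] = (1, 1)"
| "coef (True # w) = (fst (coef w) + snd (coef w), snd (coef w))"
| "coef (False # w) = (fst (coef w), fst (coef w) + snd (coef w))"

lemma coef_pos: "0 < fst (coef w) \<and> 0 < snd (coef w)"
  by (induction w rule: coef.induct) auto

text \<open>Both entries are positive, so the larger one reveals the first step and equality occurs
  only at the root: the subtractive Euclidean algorithm.\<close>

lemma coef_inject: "coef w = coef v \<Longrightarrow> w = v"
proof (induction w arbitrary: v rule: coef.induct)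
  case 1
  then show ?case using coef_pos[of "tl v"] by (cases v rule: coef.cases) (auto simp: prod_eq_iff)
next
  case (2 w)
  then show ?case using coef_pos[of w] coef_pos[of "tl v"]
    by (cases v rule: coef.cases) (auto simp: prod_eq_iff)
next
  case (3 w)
  then show ?case using coef_pos[of w] coef_pos[of "tl v"]
    by (cases v rule: coef.cases) (auto simp: prod_eq_iff)
qed

section \<open>Bases obtained from the universal property\<close>

context free2
begin

text \<open>The endomorphism with \<open>a\<close> to \<open>U\<close> and \<open>b\<close> to
  \<open>V\<close> given by the universal property.\<close>

definition ext :: "'a \<Rightarrow> 'a \<Rightarrow> 'a \<Rightarrow> 'a" where
  "ext U V g = word_val G U V (nf g)"

context
  fixes U V assumes UV [simp]: "U \<in> carrier G" "V \<in> carrier G"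
begin

lemma ext_word: "ext U V (word_val G a b w) = word_val G U V w"
  by (simp add: ext_def nf_word_val word_val_reduce)

lemma ext_gens [simp]: "ext U V a = U" "ext U V b = V"
  using ext_word[of "[(GX, True)]"] ext_word[of "[(GY, True)]"] by simp_all

lemma ext_closed [simp]: "ext U V g \<in> carrier G"
  by (simp add: ext_def)

lemma ext_mult: assumes "x \<in> carrier G" "y \<in> carrier G"
  shows "ext U V (x \<otimes> y) = ext U V x \<otimes> ext U V y"
proof -
  have "x \<otimes> y = word_val G a b (nf x @ nf y)" using assms by (simp add: word_val_append nf)
  then have "ext U V (x \<otimes> y) = word_val G U V (nf x @ nf y)" by (simp only: ext_word)
  then show ?thesis by (simp add: word_val_append ext_def)
qed

lemma ext_hom: "ext U V \<in> hom G G"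
  by (auto simp: hom_def ext_mult)

lemma ext_inv: "x \<in> carrier G \<Longrightarrow> ext U V (inv x) = inv (ext U V x)"
  using group_hom.hom_inv[of G G "ext U V" x] ext_hom is_group by (simp add: group_hom_def group_hom_axioms_def)

end

lemma ext_ext_id:
  assumes [simp]: "U \<in> carrier G" "V \<in> carrier G" "U' \<in> carrier G" "V' \<in> carrier G"
    and "ext U V U' = a" "ext U V V' = b" "g \<in> carrier G"
  shows "ext U V (ext U' V' g) = g"
  using word_val_hom[OF is_group is_group ext_hom[of U V], of U' V' "nf g"] assms(5-7)
  by (simp add: ext_def[of U' V'] nf)

text \<open>The two endomorphisms invert each other on the generators, so both are bijective and
  carry the given basis to a basis. Applied with explicit inverses, this covers the seeds and the
  tree steps.\<close>

lemma free_basis_change: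
  assumes [simp]: "U \<in> carrier G" "V \<in> carrier G" "U' \<in> carrier G" "V' \<in> carrier G"
    and "ext U V U' = a" "ext U V V' = b" "ext U' V' U = a" "ext U' V' V = b"
  shows "free_basis G U V"
proof -
  have "bij_betw (ext U V) (carrier G) (carrier G)"
    by (rule bij_betwI[where g = "ext U' V'"]) (use ext_ext_id assms in auto)
  then have "bij_betw (ext U V \<circ> word_val G a b) {w. reduced w} (carrier G)"
    using basis by (auto simp: free_basis_def intro: bij_betw_trans)
  then show ?thesis by (simp add: free_basis_def ext_word comp_def cong: bij_betw_cong)
qed

lemma free_basis_gstep: "free_basis G (fst (gstep c (a, b))) (snd (gstep c (a, b)))"
proof (cases c)
  case True
  then show ?thesis
    by (auto intro!: free_basis_change[of _ _ a "inv a \<otimes> b"] simp: ext_mult ext_inv)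
next
  case False
  then show ?thesis
    by (auto intro!: free_basis_change[of _ _ "a \<otimes> inv b" b] simp: ext_mult ext_inv m_assoc)
qed

lemma free_basis_seed: "free_basis G (fst (seed e)) (snd (seed e))"
  using basis by (auto simp: seed_def intro!: free_basis_change[of _ _ a "inv b"] simp: ext_inv)

end

lemma (in group) free_basis_gnode:
  "free_basis G (fst s) (snd s) \<Longrightarrow> free_basis G (fst (gnode s w)) (snd (gnode s w))"
proof (induction w arbitrary: s)
  case (Cons c w)
  interpret free2 G "fst s" "snd s" using Cons.prems by unfold_locales
  show ?case using Cons.IH[OF free_basis_gstep[of c]] by simp
qed simp

lemma (in group) primitive_gnode:
  assumes "free_basis G (fst s) (snd s)"
  shows "primitive_elem G (fst (gnode s w))" "primitive_elem G (snd (gnode s w))"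
    "primitive_elem G (fst (gnode s w) \<otimes> snd (gnode s w))"
  using free_basis_gnode[OF assms, of w] free_basis_gnode[OF assms, of "w @ [True]"]
  by (cases "gnode s w"; auto simp: primitive_elem_def)+

section \<open>Exponent sums as invariants of the classes\<close>

context free2
begin

definition ab :: "'a \<Rightarrow> int \<times> int" where
  "ab g = expsum (nf g)"

lemma ab_word: "ab (word_val G a b w) = expsum w"
  by (simp add: ab_def nf_word_val expsum_reduce)

lemma ab_mult: "\<lbrakk>x \<in> carrier G; y \<in> carrier G\<rbrakk> \<Longrightarrow> ab (x \<otimes> y) = ab x + ab y"
  using ab_word[of "nf x @ nf y"] by (simp add: word_val_append nf ab_def expsum_def)

lemma ab_one [simp]: "ab \<one> = 0"
  by (simp add: ab_def expsum_def zero_prod_def)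

lemma ab_inv: "x \<in> carrier G \<Longrightarrow> ab (inv x) = - ab x"
  using ab_mult[of "inv x" x] by (simp add: eq_neg_iff_add_eq_0)

lemma ab_gens [simp]: "ab a = (1, 0)" "ab b = (0, 1)"
  using ab_word[of "[(GX, True)]"] ab_word[of "[(GY, True)]"] by (simp_all add: expsum_def)

lemma ab_letter: "\<lbrakk>U \<in> carrier G; V \<in> carrier G\<rbrakk> \<Longrightarrow> ab (letter_val G (inv U) (inv V) l) = - ab (letter_val G U V l)"
  by (cases l; cases "fst l") (auto simp: ab_inv)

text \<open>Inner automorphisms act trivially on the abelianisation and every elliptic involution
  acts by -1, whichever basis defines it.\<close>

lemma ab_Inn_e:
  assumes "\<phi> \<in> Inn_e G"
  shows "(\<forall>g\<in>carrier G. ab (\<phi> g) = ab g) \<or> (\<forall>g\<in>carrier G. ab (\<phi> g) = - ab g)"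
  using assms
proof (rule Inn_e_induct[THEN conjunct2], goal_cases)
  case 1
  then show ?case by (simp add: AutoGroup_one_apply)
next
  case (2 x)
  then show ?case by (auto simp: ab_mult ab_inv)
next
  case (3 \<phi> X Y)
  have XY: "X \<in> carrier G" "Y \<in> carrier G" using 3 by (auto simp: free_basis_def)
  have "ab (word_val G (inv X) (inv Y) w) = - ab (word_val G X Y w)" for w
    by (induction w) (simp_all add: ab_mult XY ab_letter)
  moreover have "\<phi> (word_val G X Y w) = word_val G (inv X) (inv Y) w" for w
    using word_val_hom[OF is_group is_group auto_hom[OF 3(1)] XY, of w] 3 by simp
  moreover have "\<exists>w. g = word_val G X Y w" if "g \<in> carrier G" for g
    using 3(2) that unfolding free_basis_def bij_betw_def by (metis imageE)
  ultimately show ?case by metis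
next
  case (4 \<phi>)
  then show ?case using AutoGroup_inv_apply[OF 4(1)] by (metis minus_minus)
next
  case (5 \<phi> \<psi>)
  then show ?case using auto_closed[of \<psi>] by (auto simp: AutoGroup_apply)
qed

lemma ab_gnode:
  assumes "A \<in> carrier G" "B \<in> carrier G"
  shows "ab (fst (gnode (A, B) w) \<otimes> snd (gnode (A, B) w)) =
    (int (fst (coef w)) * fst (ab A) + int (snd (coef w)) * fst (ab B),
     int (fst (coef w)) * snd (ab A) + int (snd (coef w)) * snd (ab B))"
  using assms
proof (induction w arbitrary: A B rule: coef.induct)
  case 1
  then show ?case by (simp add: ab_mult prod_eq_iff)
qed (simp_all add: ab_mult algebra_simps)

text \<open>Turns the finiteness of a set of classes, as in the second BQ-condition, into finiteness
  of a set of words.\<close>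

lemma inj_class_gnode:
  "inj (\<lambda>w. Inn_e_class G (fst (gnode (seed e) w) \<otimes> snd (gnode (seed e) w)))"
proof (rule injI)
  fix w v
  let ?P = "\<lambda>w. fst (gnode (seed e) w) \<otimes> snd (gnode (seed e) w)"
  assume eq: "Inn_e_class G (?P w) = Inn_e_class G (?P v)"
  have c: "?P w \<in> carrier G" for w using gnode_closed[of "seed e" w] by simp
  interpret A: group "AutoGroup G" by (rule AutoGroup)
  have "?P w \<in> Inn_e_class G (?P w)"
    unfolding Inn_e_class_def using subgroup.one_closed[OF subgroup_Inn_e] AutoGroup_one_apply[OF c[of w]]
    by (metis (mono_tags, lifting) mem_Collect_eq)
  then obtain \<phi> where \<phi>: "\<phi> \<in> Inn_e G" "?P w = \<phi> (?P v)" unfolding eq by (auto simp: Inn_e_class_def)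
  have "ab (?P w) = ab (?P v) \<or> ab (?P w) = - ab (?P v)"
    using ab_Inn_e[OF \<phi>(1)] \<phi>(2) c[of v] by auto
  moreover have "ab (?P w) = (int (fst (coef w)), (if e then 1 else -1) * int (snd (coef w)))" for w
    using ab_gnode[of "fst (seed e)" "snd (seed e)" w] by (simp add: seed_def ab_inv)
  \<comment> \<open>The first exponent sum is positive at every vertex, which excludes the sign
    -1.\<close>
  ultimately have "coef w = coef v"
    using coef_pos[of w] coef_pos[of v] by (auto simp: prod_eq_iff split: if_splits)
  then show "w = v" by (rule coef_inject)
qed

end

section \<open>Traces in SL(2,C)\<close>

text \<open>The adjugate, which is the inverse on SL(2,C) and is linear in the entries.\<close>

definition adj2 :: "complex^2^2 \<Rightarrow> complex^2^2" where
  "adj2 A = (\<chi> i j. if i = j then A $ (if i = 1 then 2 else 1) $ (if i = 1 then 2 else 1) else - (A $ i $ j))"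

lemma adj2_nth [simp]:
  "adj2 A $ 1 $ 1 = A $ 2 $ 2" "adj2 A $ 2 $ 2 = A $ 1 $ 1"
  "adj2 A $ 1 $ 2 = - (A $ 1 $ 2)" "adj2 A $ 2 $ 1 = - (A $ 2 $ 1)"
  by (simp_all add: adj2_def)

lemma mat2_eq_iff: "A = B \<longleftrightarrow> A $ 1 $ 1 = B $ 1 $ 1 \<and> A $ 1 $ 2 = B $ 1 $ 2 \<and> A $ 2 $ 1 = B $ 2 $ 1 \<and> A $ 2 $ 2 = B $ 2 $ 2"
  for A B :: "'a^2^2"
  by (auto simp: vec_eq_iff forall_2)

lemma mat2_mult_nth [simp]: "(A ** B) $ i $ j = A $ i $ 1 * B $ 1 $ j + A $ i $ 2 * B $ 2 $ j"
  for A B :: "'a::semiring_1^2^2"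
  by (simp add: matrix_matrix_mult_def sum_2)

lemma mat2_vec_nth [simp]: "(A *v x) $ i = A $ i $ 1 * x $ 1 + A $ i $ 2 * x $ 2"
  for A :: "'a::semiring_1^2^2"
  by (simp add: matrix_vector_mult_def sum_2)

lemma mat1_nth2 [simp]:
  "(mat c :: 'a::zero^2^2) $ 1 $ 1 = c" "(mat c :: 'a::zero^2^2) $ 2 $ 2 = c"
  "(mat c :: 'a::zero^2^2) $ 1 $ 2 = 0" "(mat c :: 'a::zero^2^2) $ 2 $ 1 = 0"
  by (simp_all add: mat_def)

lemma mat2_sub_distrib:
  "(A - B) ** C = A ** C - B ** C" "C ** (A - B) = C ** A - C ** B"
  for A B C :: "'a::ring_1^2^2"
  by (simp_all add: mat2_eq_iff algebra_simps)

lemma trace2: "trace A = A $ 1 $ 1 + A $ 2 $ 2" for A :: "'a::semiring_1^2^2"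
  by (simp add: trace_def sum_2)

lemma group_SL2C: "group SL2C"
proof (rule groupI)
  show "\<exists>y\<in>carrier SL2C. y \<otimes>\<^bsub>SL2C\<^esub> x = \<one>\<^bsub>SL2C\<^esub>" if "x \<in> carrier SL2C" for x
    using that by (intro bexI[of _ "adj2 x"]) (auto simp: SL2C_def det_2 mat2_eq_iff algebra_simps)
qed (auto simp: SL2C_def det_mul matrix_mul_assoc)

lemma inv_SL2C: "A \<in> carrier SL2C \<Longrightarrow> inv\<^bsub>SL2C\<^esub> A = adj2 A"
  by (rule group.inv_equality[OF group_SL2C]) (auto simp: SL2C_def det_2 mat2_eq_iff algebra_simps)

lemma adj2_mult: "det A = 1 \<Longrightarrow> adj2 A ** A = mat 1" "det A = 1 \<Longrightarrow> A ** adj2 A = mat 1"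
  by (auto simp: det_2 mat2_eq_iff algebra_simps)

definition lie :: "complex^2^2 \<Rightarrow> complex^2^2 \<Rightarrow> complex^2^2" where
  "lie A B = A ** B - B ** A"

text \<open>The commutator AB - BA intertwines (A, B) with the pair of their adjugates. When it is
  invertible, conjugation by it realises the elliptic involution of the basis.\<close>

lemma lie_adj2:
  "lie A B ** A = adj2 A ** lie A B" "lie A B ** adj2 A = A ** lie A B"
  "lie A B ** B = adj2 B ** lie A B" "lie A B ** adj2 B = B ** lie A B"
  by (simp_all add: lie_def mat2_eq_iff algebra_simps)

text \<open>Cayley-Hamilton, A^2 = tr(A) A - det(A); this is what makes the traces along the tree a
  Markoff map.\<close>

lemma trace_step:
  fixes A B :: "complex^2^2"
  assumes "det A = 1" "det B = 1"
  shows "trace (A ** (A ** B)) = trace A * trace (A ** B) - trace B"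
    "trace ((A ** B) ** B) = trace (A ** B) * trace B - trace A"
proof -
  have "trace (A ** (A ** B)) = trace A * trace (A ** B) - det A * trace B"
    "trace ((A ** B) ** B) = trace (A ** B) * trace B - det B * trace A"
    by (simp_all add: trace2 det_2 algebra_simps)
  then show "trace (A ** (A ** B)) = trace A * trace (A ** B) - trace B"
    "trace ((A ** B) ** B) = trace (A ** B) * trace B - trace A"
    using assms by simp_all
qed

text \<open>The right side is 4 - \<open>kappa\<close>, that is 2 minus the trace of the group
  commutator; so an invertible commutator excludes the value 4 of \<open>kappa\<close>.\<close>

lemma det_lie:
  assumes "det A = 1" "det B = 1"
  shows "det (lie A B) = 4 - ((trace A)\<^sup>2 + (trace B)\<^sup>2 + (trace (A ** B))\<^sup>2 - trace A * trace B * trace (A ** B))"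
proof -
  have "det (lie A B) = 4 * det A * det B - (det B * (trace A)\<^sup>2 + det A * (trace B)\<^sup>2 + (trace (A ** B))\<^sup>2 - trace A * trace B * trace (A ** B))"
    by (simp add: lie_def trace2 det_2 power2_eq_square algebra_simps)
  then show ?thesis using assms by simp
qed

lemma trace_conj:
  assumes "det C \<noteq> 0" "C ** M = N ** C"
  shows "trace M = trace (N :: complex^2^2)"
proof -
  obtain D where D: "C ** D = mat 1" "D ** C = mat 1"
    using assms(1) invertible_det_nz[of C] by (auto simp: invertible_def)
  have "trace M = trace (D ** (C ** M))" by (simp add: matrix_mul_assoc D)
  also have "\<dots> = trace ((N ** C) ** D)" unfolding assms(2) by (rule trace_mul_sym)
  also have "\<dots> = trace N" by (simp add: matrix_mul_assoc[symmetric] D)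
  finally show ?thesis .
qed

lemma det_adj2 [simp]: "det (adj2 A) = det A"
  by (simp add: det_2 mult.commute)

lemma singular_kernel:
  assumes "det (M :: complex^2^2) = 0"
  obtains v where "v \<noteq> 0" "M *v v = 0"
proof -
  have "\<exists>v. v \<noteq> 0 \<and> M *v v = 0"
  proof (cases "M $ 1 $ 1 = 0 \<and> M $ 1 $ 2 = 0")
    case True
    show ?thesis
    proof (cases "M $ 2 $ 1 = 0 \<and> M $ 2 $ 2 = 0")
      case T2: True
      show ?thesis by (rule exI[of _ "vector [1, 0]"]) (use True T2 in \<open>simp add: vec_eq_iff forall_2\<close>)
    next
      case False
      then show ?thesis using True
        by (intro exI[of _ "vector [M $ 2 $ 2, - (M $ 2 $ 1)]"]) (auto simp: vec_eq_iff forall_2)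
    qed
  next
    case False
    then show ?thesis using assms
      by (intro exI[of _ "vector [M $ 1 $ 2, - (M $ 1 $ 1)]"]) (auto simp: vec_eq_iff forall_2 det_2 algebra_simps)
  qed
  then show ?thesis using that by blast
qed

lemma ex_eigenvalue:
  fixes M :: "complex^2^2"
  obtains l where "det (M - mat l) = 0"
proof -
  define r where "r = csqrt ((trace M)\<^sup>2 - 4 * det M)"
  have r: "r\<^sup>2 = (trace M)\<^sup>2 - 4 * det M" by (simp add: r_def)
  have "4 * det (M - mat ((trace M + r) / 2)) = 0"
    using r by (simp add: det_2 trace2 power2_eq_square field_simps)
  then show ?thesis using that by simp
qed

section \<open>Representations and the consequences of irreducibility\<close>

locale SL2_rep = group G for G (structure) +
  fixes \<rho> :: "'a \<Rightarrow> complex^2^2"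
  assumes rho: "\<rho> \<in> hom G SL2C"
begin

lemma rho_det [simp]: "g \<in> carrier G \<Longrightarrow> det (\<rho> g) = 1"
  using rho by (auto simp: hom_def SL2C_def)

lemma rho_mult: "\<lbrakk>g \<in> carrier G; h \<in> carrier G\<rbrakk> \<Longrightarrow> \<rho> (g \<otimes> h) = \<rho> g ** \<rho> h"
  using rho by (auto simp: hom_def SL2C_def)

lemma rho_one [simp]: "\<rho> \<one> = mat 1"
proof -
  have "\<rho> \<one> = \<one>\<^bsub>SL2C\<^esub>"
    using group_hom.hom_one[of G SL2C \<rho>] rho group_SL2C is_group by (simp add: group_hom_def group_hom_axioms_def)
  then show ?thesis by (simp add: SL2C_def)
qed

lemma rho_inv: "g \<in> carrier G \<Longrightarrow> \<rho> (inv g) = adj2 (\<rho> g)"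
  using group_hom.hom_inv[of G SL2C \<rho> g] rho group_SL2C is_group inv_SL2C[of "\<rho> g"]
  by (simp add: group_hom_def group_hom_axioms_def SL2C_def)

lemma rho_inv_mult: "g \<in> carrier G \<Longrightarrow> \<rho> (inv g) ** \<rho> g = mat 1" "g \<in> carrier G \<Longrightarrow> \<rho> g ** \<rho> (inv g) = mat 1"
  by (simp_all add: rho_inv adj2_mult)

lemma word_invariant:
  assumes "X \<in> carrier G" "Y \<in> carrier G"
    and "\<And>v. v \<in> V \<Longrightarrow> \<rho> X *v v \<in> V \<and> adj2 (\<rho> X) *v v \<in> V \<and> \<rho> Y *v v \<in> V \<and> adj2 (\<rho> Y) *v v \<in> V"
  shows "v \<in> V \<Longrightarrow> \<rho> (word_val G X Y w) *v v \<in> V"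
proof (induction w arbitrary: v)
  case (Cons l w)
  have "\<rho> (letter_val G X Y l) *v u \<in> V" if "u \<in> V" for u
    using assms(3)[OF that] assms(1,2) by (cases l; cases "fst l") (auto simp: rho_inv)
  then show ?case
    using Cons assms(1,2) by (simp add: rho_mult matrix_vector_mul_assoc[symmetric])
qed simp

context
  fixes X Y
  assumes irr: "irreducible_rep G \<rho>" and XY: "X \<in> carrier G" "Y \<in> carrier G"
    and words: "\<And>g. g \<in> carrier G \<Longrightarrow> \<exists>w. g = word_val G X Y w"
begin

lemma invariant_subspace_trivial:
  assumes "vec.subspace V"
    and inv: "\<And>v. v \<in> V \<Longrightarrow> \<rho> X *v v \<in> V \<and> adj2 (\<rho> X) *v v \<in> V \<and> \<rho> Y *v v \<in> V \<and> adj2 (\<rho> Y) *v v \<in> V"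
  shows "V = {0} \<or> V = UNIV"
proof -
  have "\<rho> g *v v \<in> V" if "g \<in> carrier G" "v \<in> V" for g v
    using words[OF that(1)] word_invariant[OF XY inv that(2)] by auto
  then show ?thesis using irr assms(1) unfolding irreducible_rep_def by blast
qed

lemma subspace_kernel: "vec.subspace {v :: complex^2. M *v v = 0}" for M :: "complex^2^2"
  by (rule vec.subspaceI) (simp_all add: matrix_vector_right_distrib vec.scale)

text \<open>Schur's lemma: the kernel of M - l for an eigenvalue l is invariant and nonzero. Since
  adj A = tr(A) - A, commuting with A includes commuting with its inverse.\<close>

lemma commuting_scalar:
  assumes "M ** \<rho> X = \<rho> X ** M" "M ** \<rho> Y = \<rho> Y ** M"
  obtains l where "M = mat l"
proof -
  obtain l where l: "det (M - mat l) = 0" using ex_eigenvalue .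
  define N where "N = M - mat l"
  have comm: "N ** A = A ** N \<and> N ** adj2 A = adj2 A ** N" if "M ** A = A ** M" for A
  proof -
    have "N ** A = M ** A - mat l ** A" "A ** N = A ** M - A ** mat l"
      by (simp_all add: N_def mat2_sub_distrib)
    moreover have mat: "mat m ** B = B ** mat m" for m and B :: "complex^2^2"
      by (simp add: mat2_eq_iff mult.commute)
    ultimately have 1: "N ** A = A ** N" using that by simp
    have "adj2 A = mat (trace A) - A" by (simp add: mat2_eq_iff trace2)
    then have "N ** adj2 A = N ** mat (trace A) - N ** A" "adj2 A ** N = mat (trace A) ** N - A ** N"
      by (simp_all only: mat2_sub_distrib)
    then show ?thesis using 1 mat by simp
  qed
  have nv: "A *v v \<in> {v. N *v v = 0}" if "N ** A = A ** N" "v \<in> {v. N *v v = 0}" for A v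
  proof -
    have "N *v (A *v v) = A *v (N *v v)" using that(1) by (simp only: matrix_vector_mul_assoc)
    then show ?thesis using that(2) by simp
  qed
  have "{v. N *v v = 0} = {0} \<or> {v. N *v v = 0} = UNIV"
    by (rule invariant_subspace_trivial[OF subspace_kernel]) (use comm assms nv in blast)
  moreover obtain v where "v \<noteq> 0" "N *v v = 0" using l N_def singular_kernel by blast
  ultimately have "\<And>v. N *v v = 0" by blast
  from this[of "vector [1, 0]"] this[of "vector [0, 1]"] have "N = 0"
    by (simp add: mat2_eq_iff vec_eq_iff forall_2)
  then show ?thesis using that[of l] by (simp add: N_def)
qed

text \<open>By \<open>lie_adj2\<close> the kernel of the commutator is invariant. If it is nonzero,
  the two matrices commute, so both are scalar by Schur's lemma, and then every line is
  invariant.\<close>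

lemma det_lie_nonzero: "det (lie (\<rho> X) (\<rho> Y)) \<noteq> 0"
proof
  let ?C = "lie (\<rho> X) (\<rho> Y)"
  assume "det ?C = 0"
  then obtain v where v: "v \<noteq> 0" "?C *v v = 0" by (rule singular_kernel)
  have "A *v v \<in> {v. ?C *v v = 0}" if "?C ** A = B ** ?C" "v \<in> {v. ?C *v v = 0}" for A B v
  proof -
    have "?C *v (A *v v) = B *v (?C *v v)" using that(1) by (simp only: matrix_vector_mul_assoc)
    then show ?thesis using that(2) by simp
  qed
  then have "{v. ?C *v v = 0} = {0} \<or> {v. ?C *v v = 0} = UNIV"
    by (intro invariant_subspace_trivial[OF subspace_kernel]) (use lie_adj2 in blast)
  with v have C: "\<And>v. ?C *v v = 0" by blast
  from C[of "vector [1, 0]"] C[of "vector [0, 1]"] have "?C = 0"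
    by (simp add: mat2_eq_iff vec_eq_iff forall_2)
  then have comm: "\<rho> X ** \<rho> Y = \<rho> Y ** \<rho> X" by (simp add: lie_def)
  obtain l where l: "\<rho> X = mat l" using commuting_scalar[of "\<rho> X"] comm by metis
  obtain m where m: "\<rho> Y = mat m" using commuting_scalar[of "\<rho> Y"] comm by metis
  \<comment> \<open>An arbitrary line.\<close>
  let ?V = "{v :: complex^2. v $ 2 = 0}"
  have "?V = {0} \<or> ?V = UNIV"
    by (rule invariant_subspace_trivial) (auto simp: l m intro!: vec.subspaceI)
  moreover have "vector [1, 0] \<in> ?V" "vector [1, 0] \<noteq> (0 :: complex^2)" "vector [0, 1] \<notin> ?V"
    by (simp_all add: vec_eq_iff forall_2)
  ultimately show False by blast
qed

text \<open>The commutator conjugates the value of a word to the value of the same word in the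
  inverted generators. Hence elliptic involutions preserve traces and \<open>trace_fun\<close> does
  not depend on the chosen representative.\<close>

lemma trace_reverse: "trace (\<rho> (word_val G (inv X) (inv Y) w)) = trace (\<rho> (word_val G X Y w))"
proof -
  let ?C = "lie (\<rho> X) (\<rho> Y)"
  have l: "?C ** \<rho> (letter_val G X Y l) = \<rho> (letter_val G (inv X) (inv Y) l) ** ?C" for l
    using XY by (cases l; cases "fst l") (auto simp: rho_inv lie_adj2)
  have "?C ** \<rho> (word_val G X Y w) = \<rho> (word_val G (inv X) (inv Y) w) ** ?C"
  proof (induction w)
    case (Cons k w)
    have "?C ** \<rho> (word_val G X Y (k # w)) = ?C ** \<rho> (letter_val G X Y k) ** \<rho> (word_val G X Y w)"
      using XY by (simp add: rho_mult matrix_mul_assoc)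
    also have "\<dots> = \<rho> (letter_val G (inv X) (inv Y) k) ** (?C ** \<rho> (word_val G X Y w))"
      by (simp add: l matrix_mul_assoc)
    also have "\<dots> = \<rho> (word_val G (inv X) (inv Y) (k # w)) ** ?C"
      using XY by (simp add: Cons rho_mult matrix_mul_assoc)
    finally show ?case .
  qed (simp add: rho_one)
  from trace_conj[OF det_lie_nonzero this] show ?thesis by simp
qed

end
end

section \<open>Bounded traces under the BQ-conditions\<close>

locale BQ_rep = free2 + SL2_rep +
  assumes irr: "irreducible_rep G \<rho>" and BQ: "BQ_conditions G \<rho>"
begin

lemma trace_Inn_e:
  assumes "\<phi> \<in> Inn_e G"
  shows "\<forall>g\<in>carrier G. trace (\<rho> (\<phi> g)) = trace (\<rho> g)"
  using assms
proof (rule Inn_e_induct[THEN conjunct2], goal_cases)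
  case 1
  then show ?case by (simp add: AutoGroup_one_apply)
next
  case (2 x)
  show ?case
  proof
    fix g assume g: "g \<in> carrier G"
    have "trace (\<rho> (x \<otimes> g \<otimes> inv x)) = trace (\<rho> (inv x) ** (\<rho> x ** \<rho> g))"
      using 2 g by (simp add: rho_mult) (rule trace_mul_sym)
    also have "\<dots> = trace (\<rho> g)" using 2 by (simp add: matrix_mul_assoc rho_inv_mult)
    finally show "trace (\<rho> ((\<lambda>g\<in>carrier G. x \<otimes> g \<otimes> inv x) g)) = trace (\<rho> g)" using g by simp
  qed
next
  case (3 \<phi> X Y)
  have XY: "X \<in> carrier G" "Y \<in> carrier G" using 3 by (auto simp: free_basis_def)
  have w: "\<exists>w. g = word_val G X Y w" if "g \<in> carrier G" for g
    using 3(2) that unfolding free_basis_def bij_betw_def by (metis imageE)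
  have "\<phi> (word_val G X Y w) = word_val G (inv X) (inv Y) w" for w
    using word_val_hom[OF is_group is_group auto_hom[OF 3(1)] XY, of w] 3 by simp
  then show ?case using w trace_reverse[OF irr XY w] by metis
next
  case (4 \<phi>)
  then show ?case using AutoGroup_inv_apply[OF 4(1)] by metis
next
  case (5 \<phi> \<psi>)
  then show ?case using auto_closed[of \<psi>] by (auto simp: AutoGroup_apply)
qed

lemma trace_fun_class:
  assumes "W \<in> carrier G" shows "trace_fun \<rho> (Inn_e_class G W) = trace (\<rho> W)"
proof -
  have "W \<in> Inn_e_class G W"
    unfolding Inn_e_class_def using subgroup.one_closed[OF subgroup_Inn_e] AutoGroup_one_apply[OF assms]
    by (metis (mono_tags, lifting) mem_Collect_eq)
  then have "(SOME V. V \<in> Inn_e_class G W) \<in> Inn_e_class G W" by (rule someI)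
  then show ?thesis using trace_Inn_e assms by (auto simp: trace_fun_def Inn_e_class_def)
qed

lemma trace_primitive:
  assumes "W \<in> carrier G" "primitive_elem G W"
  shows "trace (\<rho> W) \<notin> complex_of_real ` {-2..2}"
  using assms BQ trace_fun_class[OF assms(1)] by (auto simp: BQ_conditions_def Omega_def)

definition traces :: "'a \<times> 'a \<Rightarrow> complex \<times> complex \<times> complex" where
  "traces s = (trace (\<rho> (fst s)), trace (\<rho> (snd s)), trace (\<rho> (fst s \<otimes> snd s)))"

lemma traces_gstep:
  assumes "fst s \<in> carrier G" "snd s \<in> carrier G"
  shows "traces (gstep c s) = mstep c (traces s)"
proof (cases s)
  case (Pair A B)
  then have c [simp]: "A \<in> carrier G" "B \<in> carrier G" using assms by auto
  note tr = trace_step[of "\<rho> A" "\<rho> B"]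
  show ?thesis by (cases c) (use tr in \<open>simp_all add: Pair traces_def rho_mult\<close>)
qed

lemma traces_gnode:
  "\<lbrakk>fst s \<in> carrier G; snd s \<in> carrier G\<rbrakk> \<Longrightarrow> traces (gnode s w) = mnode (traces s) w"
proof (induction w arbitrary: s)
  case (Cons c w)
  have "fst (gstep c s) \<in> carrier G" "snd (gstep c s) \<in> carrier G"
    using Cons.prems gnode_closed[of s "[c]"] by auto
  then show ?case using Cons by (simp add: traces_gstep)
qed simp

text \<open>All traces on the tree belong to primitive elements, so the first BQ-condition keeps
  them off [-2,2]. The second one, through \<open>inj_class_gnode\<close>, gives finiteness at level
  2, and irreducibility gives \<open>kappa\<close> different from 4.\<close>

theorem finite_small_traces:
  "finite {w. cmod (trace (\<rho> (fst (gnode (seed e) w) \<otimes> snd (gnode (seed e) w)))) \<le> K}"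
proof -
  let ?P = "\<lambda>w. fst (gnode (seed e) w) \<otimes> snd (gnode (seed e) w)"
  have c: "fst (gnode (seed e) w) \<in> carrier G" "snd (gnode (seed e) w) \<in> carrier G" "?P w \<in> carrier G" for w
    using gnode_closed[of "seed e" w] by simp_all
  note prim = primitive_gnode[OF free_basis_seed[of e]]
  have tip: "tip (mnode (traces (seed e)) w) = trace (\<rho> (?P w))" for w
    unfolding traces_gnode[of "seed e" w, OF seed_closed, symmetric] by (simp add: traces_def)
  have w: "\<exists>w. g = word_val G (fst (seed e)) (snd (seed e)) w" if "g \<in> carrier G" for g
    using free_basis_seed[of e] that unfolding free_basis_def bij_betw_def by (metis imageE)
  have "finite (small_words K (traces (seed e)))"
  proof (rule finite_small_words)
    have "det (lie (\<rho> (fst (seed e))) (\<rho> (snd (seed e)))) = 4 - kappa (traces (seed e))"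
      by (simp add: det_lie traces_def rho_mult)
    then show "kappa (traces (seed e)) \<noteq> 4"
      using det_lie_nonzero[OF irr _ _ w] by fastforce
    show "fst (traces (seed e)) \<notin> complex_of_real ` {-2..2}"
      using trace_primitive[OF _ prim(1)[of "[]"]] by (simp add: traces_def)
    show "fst (snd (traces (seed e))) \<notin> complex_of_real ` {-2..2}"
      using trace_primitive[OF _ prim(2)[of "[]"]] by (simp add: traces_def)
    show "tip (mnode (traces (seed e)) w) \<notin> complex_of_real ` {-2..2}" for w
      unfolding tip by (rule trace_primitive[OF c(3) prim(3)])
    have "finite ((\<lambda>w. Inn_e_class G (?P w)) -` {C \<in> Omega G. cmod (trace_fun \<rho> C) \<in> {0..2}})"
      by (rule finite_vimageI) (use BQ inj_class_gnode in \<open>auto simp: BQ_conditions_def\<close>)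
    moreover have "small_words 2 (traces (seed e)) \<subseteq> (\<lambda>w. Inn_e_class G (?P w)) -` {C \<in> Omega G. cmod (trace_fun \<rho> C) \<in> {0..2}}"
      using c prim(3) by (auto simp: small_words_def tip trace_fun_class[OF c(3)] Omega_def)
    ultimately show "finite (small_words 2 (traces (seed e)))" by (rule finite_subset[rotated])
  qed
  then show ?thesis by (simp add: small_words_def tip)
qed

end

section \<open>Geometry of hyperbolic space\<close>

text \<open>The chart centred at \<open>p\<close> composes the similarity taking \<open>p\<close> to \<open>j\<close> with the hyperboloid model:
  the point \<open>w\<close> stands for \<open>(hc w, w)\<close> on the upper sheet, with \<open>cosh d = hc w * hc w' - w \<bullet> w'\<close>.\<close>

definition hc :: "real \<times> complex \<Rightarrow> real" where
  "hc w = sqrt (1 + (norm w)\<^sup>2)"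

definition chart :: "point3 \<Rightarrow> point3 \<Rightarrow> real \<times> complex" where
  "chart p x = (let t = snd x / snd p; z = (fst x - fst p) / of_real (snd p)
     in (((cmod z)\<^sup>2 + t\<^sup>2 - 1) / (2 * t), z / of_real t))"

text \<open>The height comes back as t = 1 / (hc w - fst w), because \<open>hc\<close> and the first
  chart coordinate differ by exactly 1/t.\<close>

definition chart_inv :: "point3 \<Rightarrow> real \<times> complex \<Rightarrow> point3" where
  "chart_inv p w = (let t = 1 / (hc w - fst w)
     in (fst p + of_real (snd p * t) * snd w, snd p * t))"

lemma mem_H3: "p \<in> H3 \<longleftrightarrow> snd p > 0"
  by (auto simp: H3_def)

lemma norm_pair_sq: "(norm (w :: real \<times> complex))\<^sup>2 = (fst w)\<^sup>2 + (cmod (snd w))\<^sup>2"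
  by (simp add: norm_prod_def)

lemma hc_ge_1: "1 \<le> hc w"
  by (simp add: hc_def)

lemma hc_sq: "(hc w)\<^sup>2 = 1 + (norm w)\<^sup>2"
  by (simp add: hc_def add_nonneg_nonneg)

lemma hc_gt_fst: "\<bar>fst w\<bar> < hc w"
proof -
  have "\<bar>fst w\<bar>\<^sup>2 < (hc w)\<^sup>2" by (simp add: hc_sq norm_pair_sq add_pos_nonneg)
  then show ?thesis using hc_ge_1[of w] by (metis power_less_imp_less_base order_trans zero_le_one)
qed

lemma hc_chart:
  assumes "p \<in> H3" "x \<in> H3"
  shows "hc (chart p x) = ((cmod ((fst x - fst p) / of_real (snd p)))\<^sup>2 + (snd x / snd p)\<^sup>2 + 1) / (2 * (snd x / snd p))"
proof -
  define t where "t = snd x / snd p"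
  define n where "n = (cmod ((fst x - fst p) / of_real (snd p)))\<^sup>2"
  have t: "t > 0" using assms by (simp add: t_def mem_H3)
  have n: "n \<ge> 0" by (simp add: n_def)
  have "1 + (norm (chart p x))\<^sup>2 = 1 + ((n + t\<^sup>2 - 1) / (2 * t))\<^sup>2 + n / t\<^sup>2"
    using t by (simp add: norm_pair_sq chart_def Let_def t_def n_def norm_divide power_divide)
  also have "\<dots> = ((n + t\<^sup>2 + 1) / (2 * t))\<^sup>2"
    using t by (simp add: field_simps power2_eq_square)
  finally have "hc (chart p x) = \<bar>(n + t\<^sup>2 + 1) / (2 * t)\<bar>" by (simp add: hc_def)
  moreover have "0 \<le> (n + t\<^sup>2 + 1) / (2 * t)" using t n by simp
  ultimately have "hc (chart p x) = (n + t\<^sup>2 + 1) / (2 * t)" by (simp only: abs_of_nonneg)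
  then show ?thesis by (simp only: t_def n_def)
qed

definition cosh_dist :: "point3 \<Rightarrow> point3 \<Rightarrow> real" where
  "cosh_dist p q = 1 + ((cmod (fst p - fst q))\<^sup>2 + (snd p - snd q)\<^sup>2) / (2 * snd p * snd q)"

lemma cosh_dist_ge_1: "\<lbrakk>p \<in> H3; q \<in> H3\<rbrakk> \<Longrightarrow> 1 \<le> cosh_dist p q"
  by (simp add: cosh_dist_def mem_H3)

lemma cosh_hdist: "\<lbrakk>p \<in> H3; q \<in> H3\<rbrakk> \<Longrightarrow> cosh (hdist p q) = cosh_dist p q"
  using cosh_dist_ge_1[of p q] by (simp add: hdist_def cosh_dist_def[symmetric] cosh_arcosh_real)

lemma hdist_nonneg: "\<lbrakk>p \<in> H3; q \<in> H3\<rbrakk> \<Longrightarrow> 0 \<le> hdist p q"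
  using cosh_dist_ge_1[of p q] by (simp add: hdist_def cosh_dist_def[symmetric] arcosh_nonneg_real)

lemma hdist_commute: "hdist p q = hdist q p"
  by (simp add: hdist_def norm_minus_commute power2_commute mult.commute mult.left_commute)

lemma hdist_self [simp]: "hdist p p = 0"
  by (simp add: hdist_def)

lemma cosh_dist_chart:
  assumes "p \<in> H3" "x \<in> H3" "y \<in> H3"
  shows "cosh_dist x y = hc (chart p x) * hc (chart p y) - chart p x \<bullet> chart p y"
proof -
  define t where "t = snd x / snd p"
  define s where "s = snd y / snd p"
  define z where "z = (fst x - fst p) / of_real (snd p)"
  define w where "w = (fst y - fst p) / of_real (snd p)"
  have pos: "snd p > 0" "t > 0" "s > 0" using assms by (simp_all add: t_def s_def mem_H3)
  have "fst x - fst y = of_real (snd p) * (z - w)" using pos by (simp add: z_def w_def field_simps)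
  then have 1: "cmod (fst x - fst y) = snd p * cmod (z - w)" using pos by (simp add: norm_mult)
  have 2: "snd x = snd p * t" "snd y = snd p * s" using pos by (simp_all add: t_def s_def)
  have "cosh_dist x y = 1 + ((snd p)\<^sup>2 * ((cmod (z - w))\<^sup>2 + (t - s)\<^sup>2)) / ((snd p)\<^sup>2 * (2 * t * s))"
    unfolding cosh_dist_def 1 2 by (simp add: power2_eq_square algebra_simps)
  also have "\<dots> = 1 + ((cmod (z - w))\<^sup>2 + (t - s)\<^sup>2) / (2 * t * s)" using pos by simp
  also have "(cmod (z - w))\<^sup>2 = (cmod z)\<^sup>2 + (cmod w)\<^sup>2 - 2 * (z \<bullet> w)"
    by (simp add: power2_norm_eq_inner inner_diff inner_commute)
  finally have L: "cosh_dist x y = ((cmod z)\<^sup>2 + (cmod w)\<^sup>2 - 2 * (z \<bullet> w) + t\<^sup>2 + s\<^sup>2) / (2 * t * s)"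
    using pos by (simp add: field_simps power2_eq_square)
  have c: "chart p x = (((cmod z)\<^sup>2 + t\<^sup>2 - 1) / (2 * t), z / of_real t)"
    "chart p y = (((cmod w)\<^sup>2 + s\<^sup>2 - 1) / (2 * s), w / of_real s)"
    by (simp_all add: chart_def Let_def t_def s_def z_def w_def)
  have h: "hc (chart p x) = ((cmod z)\<^sup>2 + t\<^sup>2 + 1) / (2 * t)" "hc (chart p y) = ((cmod w)\<^sup>2 + s\<^sup>2 + 1) / (2 * s)"
    using hc_chart assms by (simp_all add: t_def s_def z_def w_def)
  have zr: "z / of_real t = (1 / t) *\<^sub>R z" "w / of_real s = (1 / s) *\<^sub>R w"
    by (simp_all add: scaleR_conv_of_real field_simps)
  have inn: "chart p x \<bullet> chart p y = ((cmod z)\<^sup>2 + t\<^sup>2 - 1) / (2 * t) * (((cmod w)\<^sup>2 + s\<^sup>2 - 1) / (2 * s)) + (z \<bullet> w) / (t * s)"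
    unfolding c zr by simp
  show ?thesis unfolding L h inn using pos by (simp add: field_simps power2_eq_square)
qed

lemma chart_self [simp]: "p \<in> H3 \<Longrightarrow> chart p p = 0"
  by (simp add: chart_def Let_def mem_H3 zero_prod_def)

lemma hc_zero [simp]: "hc 0 = 1"
  by (simp add: hc_def)

lemma cosh_hdist_chart: "\<lbrakk>p \<in> H3; x \<in> H3\<rbrakk> \<Longrightarrow> cosh (hdist p x) = hc (chart p x)"
  using cosh_dist_chart[of p p x] by (simp add: cosh_hdist)

lemma sinh_hdist_chart: assumes "p \<in> H3" "x \<in> H3" shows "sinh (hdist p x) = norm (chart p x)"
proof -
  have "(sinh (hdist p x))\<^sup>2 = (norm (chart p x))\<^sup>2"
    using cosh_hdist_chart[OF assms] hc_sq[of "chart p x"] by (simp add: sinh_square_eq)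
  then show ?thesis using hdist_nonneg[OF assms] by (simp add: power2_eq_iff_nonneg)
qed

lemma chart_inv_H3: "p \<in> H3 \<Longrightarrow> chart_inv p w \<in> H3"
  using hc_gt_fst[of w] by (simp add: chart_inv_def Let_def mem_H3)

lemma chart_chart_inv: assumes "p \<in> H3" shows "chart p (chart_inv p w) = w"
proof -
  define t where "t = 1 / (hc w - fst w)"
  have d: "hc w - fst w > 0" using hc_gt_fst[of w] by simp
  have t: "t > 0" using d by (simp add: t_def)
  have p: "snd p > 0" using assms by (simp add: mem_H3)
  have z: "(fst (chart_inv p w) - fst p) / of_real (snd p) = of_real t * snd w"
    and s: "snd (chart_inv p w) / snd p = t"
    using p by (simp_all add: chart_inv_def Let_def t_def)
  have cm: "(cmod (snd w))\<^sup>2 = (hc w)\<^sup>2 - 1 - (fst w)\<^sup>2" by (simp add: hc_sq norm_pair_sq)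
  have "(cmod (of_real t * snd w))\<^sup>2 + t\<^sup>2 - 1 = t\<^sup>2 * ((hc w)\<^sup>2 - (fst w)\<^sup>2) - 1"
    unfolding norm_mult power_mult_distrib cm norm_of_real power2_abs by (simp add: algebra_simps)
  also have "\<dots> = (t * (hc w - fst w)) * (t * (hc w + fst w)) - 1"
    by (simp add: power2_eq_square algebra_simps)
  also have "\<dots> = t * (hc w + fst w) - t * (hc w - fst w)" using d by (simp add: t_def)
  also have "\<dots> = 2 * t * fst w" by (simp add: algebra_simps)
  finally have "((cmod (of_real t * snd w))\<^sup>2 + t\<^sup>2 - 1) / (2 * t) = fst w" using t by simp
  then show ?thesis unfolding chart_def Let_def z s using t by (simp add: prod_eq_iff)
qed

lemma chart_inject: assumes "p \<in> H3" "x \<in> H3" "y \<in> H3" "chart p x = chart p y" shows "x = y"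
proof -
  have "cosh_dist x y = 1"
    using cosh_dist_chart[OF assms(1-3)] assms(4) hc_sq[of "chart p y"]
    by (simp add: power2_eq_square[symmetric] power2_norm_eq_inner[symmetric])
  then have "(cmod (fst x - fst y))\<^sup>2 + (snd x - snd y)\<^sup>2 = 0"
    using assms by (simp add: cosh_dist_def mem_H3)
  then show ?thesis by (simp add: add_nonneg_eq_0_iff prod_eq_iff)
qed

lemma chart_inv_chart: "\<lbrakk>p \<in> H3; x \<in> H3\<rbrakk> \<Longrightarrow> chart_inv p (chart p x) = x"
  using chart_inject[of p "chart_inv p (chart p x)" x] by (simp add: chart_inv_H3 chart_chart_inv)

lemma hdist_eq_0_iff: "\<lbrakk>p \<in> H3; q \<in> H3\<rbrakk> \<Longrightarrow> hdist p q = 0 \<longleftrightarrow> p = q"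
  using sinh_hdist_chart[of p q] chart_inject[of p p q] by auto

lemma hdist_pos: "\<lbrakk>p \<in> H3; q \<in> H3; p \<noteq> q\<rbrakk> \<Longrightarrow> 0 < hdist p q"
  using hdist_eq_0_iff hdist_nonneg by fastforce

context
  fixes p x y assumes H [simp]: "p \<in> H3" "x \<in> H3" "y \<in> H3"
begin

lemma cosh_hdist_chart2: "cosh (hdist x y) = cosh (hdist p x) * cosh (hdist p y) - chart p x \<bullet> chart p y"
  by (simp add: cosh_hdist cosh_dist_chart[of p x y] cosh_dist_chart[of p p])

text \<open>The Cauchy-Schwarz inequality in the chart at \<open>p\<close>, read through the
  addition formula for cosh. Its two equality cases yield the two criteria below.\<close>

lemma hdist_triangle: "hdist x y \<le> hdist x p + hdist p y"
proof -
  have "- (chart p x \<bullet> chart p y) \<le> sinh (hdist p x) * sinh (hdist p y)"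
    using Cauchy_Schwarz_ineq2[of "chart p x" "chart p y"] by (simp add: sinh_hdist_chart)
  then have "cosh (hdist x y) \<le> cosh (hdist p x + hdist p y)"
    by (simp add: cosh_hdist_chart2 cosh_add)
  then show ?thesis by (simp add: cosh_real_nonneg_le_iff hdist_nonneg hdist_commute[of x p])
qed

lemma hdist_eq_add_iff: "hdist x y = hdist p x + hdist p y \<longleftrightarrow> chart p x \<bullet> chart p y = - (norm (chart p x) * norm (chart p y))"
proof -
  have "hdist x y = hdist p x + hdist p y \<longleftrightarrow> cosh (hdist x y) = cosh (hdist p x + hdist p y)"
    by (metis H add_nonneg_nonneg arcosh_cosh_real hdist_nonneg)
  then show ?thesis by (simp add: cosh_hdist_chart2 cosh_add sinh_hdist_chart) linarith
qed

lemma hdist_eq_diff_iff: "hdist x y = \<bar>hdist p x - hdist p y\<bar> \<longleftrightarrow> chart p x \<bullet> chart p y = norm (chart p x) * norm (chart p y)"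
proof -
  have "hdist x y = \<bar>hdist p x - hdist p y\<bar> \<longleftrightarrow> cosh (hdist x y) = cosh (hdist p x - hdist p y)"
    by (metis H abs_ge_zero arcosh_cosh_real cosh_real_abs hdist_nonneg)
  then show ?thesis by (simp add: cosh_hdist_chart2 cosh_diff sinh_hdist_chart[symmetric])
qed

end

text \<open>A purely metric form of having the same direction from \<open>p\<close>: isometries
  preserve it and its failure is an open condition. It also holds when one of the points is
  \<open>p\<close> itself.\<close>

definition same_ray :: "point3 \<Rightarrow> point3 \<Rightarrow> point3 \<Rightarrow> bool" where
  "same_ray p x y \<longleftrightarrow> hdist x y = \<bar>hdist p x - hdist p y\<bar>"

definition coll :: "point3 \<Rightarrow> point3 \<Rightarrow> point3 \<Rightarrow> bool" where
  "coll p x y \<longleftrightarrow> hdist x y = \<bar>hdist p x - hdist p y\<bar> \<or> hdist x y = hdist p x + hdist p y"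

lemma same_ray_commute: "same_ray p x y = same_ray p y x"
  by (simp add: same_ray_def hdist_commute abs_minus_commute)

lemma same_ray_iff_chart:
  "\<lbrakk>p \<in> H3; x \<in> H3; y \<in> H3\<rbrakk> \<Longrightarrow> same_ray p x y \<longleftrightarrow> norm (chart p x) *\<^sub>R chart p y = norm (chart p y) *\<^sub>R chart p x"
  by (simp add: same_ray_def hdist_eq_diff_iff norm_cauchy_schwarz_eq)

lemma sgn_eq_iff:
  fixes u v :: "'a::real_normed_vector"
  assumes "u \<noteq> 0" "v \<noteq> 0"
  shows "norm u *\<^sub>R v = norm v *\<^sub>R u \<longleftrightarrow> sgn u = sgn v"
proof
  assume "norm u *\<^sub>R v = norm v *\<^sub>R u"
  then have "(inverse (norm u) * inverse (norm v)) *\<^sub>R norm u *\<^sub>R v = (inverse (norm u) * inverse (norm v)) *\<^sub>R norm v *\<^sub>R u"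
    by simp
  moreover have "inverse (norm u) * inverse (norm v) * norm u = inverse (norm v)"
    "inverse (norm u) * inverse (norm v) * norm v = inverse (norm u)"
    using assms by simp_all
  ultimately show "sgn u = sgn v" unfolding scaleR_scaleR by (simp add: sgn_div_norm)
next
  assume eq: "sgn u = sgn v"
  have "norm u *\<^sub>R norm v *\<^sub>R sgn v = norm v *\<^sub>R norm u *\<^sub>R sgn u"
    unfolding eq by (simp add: mult.commute)
  then show "norm u *\<^sub>R v = norm v *\<^sub>R u" using assms by (simp add: sgn_div_norm)
qed

lemma same_ray_iff_sgn:
  "\<lbrakk>p \<in> H3; x \<in> H3; y \<in> H3; x \<noteq> p; y \<noteq> p\<rbrakk> \<Longrightarrow> same_ray p x y \<longleftrightarrow> sgn (chart p x) = sgn (chart p y)"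
  using chart_inject[of p x p] chart_inject[of p y p] sgn_eq_iff[of "chart p x" "chart p y"]
  by (auto simp: same_ray_iff_chart)

lemma same_ray_trans:
  "\<lbrakk>p \<in> H3; x \<in> H3; y \<in> H3; z \<in> H3; y \<noteq> p; same_ray p x y; same_ray p y z\<rbrakk> \<Longrightarrow> same_ray p x z"
  by (cases "x = p"; cases "z = p") (simp_all add: same_ray_iff_sgn, simp_all add: same_ray_iff_chart)

lemma same_ray_unique: "\<lbrakk>x \<in> H3; y \<in> H3; same_ray p x y; hdist p x = hdist p y\<rbrakk> \<Longrightarrow> x = y"
  using hdist_eq_0_iff[of x y] by (simp add: same_ray_def)

lemma coll_iff_sgn:
  "\<lbrakk>p \<in> H3; x \<in> H3; y \<in> H3; x \<noteq> p; y \<noteq> p\<rbrakk> \<Longrightarrow> coll p x y \<longleftrightarrow> sgn (chart p x) = sgn (chart p y) \<or> sgn (chart p x) = - sgn (chart p y)"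
proof -
  assume a: "p \<in> H3" "x \<in> H3" "y \<in> H3" "x \<noteq> p" "y \<noteq> p"
  let ?u = "chart p x" and ?v = "chart p y"
  have nz: "?u \<noteq> 0" "?v \<noteq> 0" using a chart_inject[of p x p] chart_inject[of p y p] by auto
  have "?u \<bullet> ?v = - (norm ?u * norm ?v) \<longleftrightarrow> ?u \<bullet> (- ?v) = norm ?u * norm (- ?v)" by (simp only: inner_minus_right norm_minus_cancel) linarith
  also have "\<dots> \<longleftrightarrow> sgn ?u = - sgn ?v"
    unfolding norm_cauchy_schwarz_eq using nz sgn_eq_iff[of ?u "- ?v"] by (simp add: sgn_minus)
  finally show ?thesis
    using a same_ray_iff_sgn[of p x y] by (simp add: coll_def hdist_eq_add_iff same_ray_def)
qed

lemma coll_perms: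
  assumes "p \<in> H3" "x \<in> H3" "y \<in> H3"
  shows "coll p x y \<longleftrightarrow> coll p y x" "coll p x y \<longleftrightarrow> coll x p y"
  using hdist_nonneg[of p x] hdist_nonneg[of p y] hdist_nonneg[of x y] assms
  unfolding coll_def hdist_commute[of y x] hdist_commute[of x p] by linarith+

lemma coll_trans:
  "\<lbrakk>p \<in> H3; x \<in> H3; y \<in> H3; z \<in> H3; y \<noteq> p; coll p x y; coll p y z\<rbrakk> \<Longrightarrow> coll p x z"
proof (cases "x = p \<or> z = p")
  case True
  assume "p \<in> H3" "x \<in> H3" "z \<in> H3"
  then show ?thesis using True by (auto simp: coll_def hdist_nonneg hdist_commute)
qed (auto simp: coll_iff_sgn)

text \<open>Pigeonhole: a line leaves \<open>a\<close> in only two directions.\<close>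

lemma coll_three:
  assumes "a \<in> H3" "b \<in> H3" "b \<noteq> a" "\<And>i. i \<in> {1, 2, 3 :: nat} \<Longrightarrow> c i \<in> H3 \<and> c i \<noteq> a \<and> coll a b (c i)"
  shows "\<exists>i\<in>{1, 2, 3}. \<exists>j\<in>{1, 2, 3}. i \<noteq> j \<and> same_ray a (c i) (c j)"
proof -
  have s: "sgn (chart a b) = sgn (chart a (c i)) \<or> sgn (chart a b) = - sgn (chart a (c i))" if "i \<in> {1, 2, 3}" for i
    using assms(4)[OF that] coll_iff_sgn[of a b "c i"] assms by simp
  have r: "same_ray a (c i) (c j)" if "sgn (chart a (c i)) = sgn (chart a (c j))" "i \<in> {1, 2, 3}" "j \<in> {1, 2, 3}" for i j
    using that assms(4)[OF that(2)] assms(4)[OF that(3)] same_ray_iff_sgn[of a "c i" "c j"] assms by simp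
  from s[of 1] s[of 2] s[of 3] consider "sgn (chart a (c 1)) = sgn (chart a (c 2))" | "sgn (chart a (c 1)) = sgn (chart a (c 3))"
    | "sgn (chart a (c 2)) = sgn (chart a (c 3))"
    by (metis insertCI minus_equation_iff)
  then show ?thesis
  proof cases
    case 1 then show ?thesis using r[of 1 2] by fastforce
  next
    case 2 then show ?thesis using r[of 1 3] by fastforce
  next
    case 3 then show ?thesis using r[of 2 3] by fastforce
  qed
qed

text \<open>The constant-speed geodesic on [0,1]. The quotient of sinh values occurs because sinh of
  the distance is the radius in the chart; for \<open>p = q\<close> the chart vector is zero and the
  curve is constant.\<close>

definition geo :: "point3 \<Rightarrow> point3 \<Rightarrow> real \<Rightarrow> point3" where
  "geo p q t = chart_inv p ((sinh (t * hdist p q) / sinh (hdist p q)) *\<^sub>R chart p q)"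

context
  fixes p q assumes pq [simp]: "p \<in> H3" "q \<in> H3"
begin

lemma geo_H3 [simp]: "geo p q t \<in> H3"
  by (simp add: geo_def chart_inv_H3)

lemma chart_geo: "chart p (geo p q t) = (sinh (t * hdist p q) / sinh (hdist p q)) *\<^sub>R chart p q"
  by (simp add: geo_def chart_chart_inv)

lemma hdist_geo: assumes "0 \<le> t" shows "hdist p (geo p q t) = t * hdist p q"
proof -
  have "sinh (hdist p (geo p q t)) = \<bar>sinh (t * hdist p q) / sinh (hdist p q)\<bar> * sinh (hdist p q)"
    by (simp add: sinh_hdist_chart chart_geo)
  also have "\<dots> = sinh (t * hdist p q)"
    using assms hdist_nonneg[of p q] by (cases "hdist p q = 0") simp_all
  finally show ?thesis by simp
qed

lemma same_ray_geo: assumes "0 \<le> s" "0 \<le> t" shows "same_ray p (geo p q s) (geo p q t)"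
proof -
  define c c' where "c = sinh (s * hdist p q) / sinh (hdist p q)" and "c' = sinh (t * hdist p q) / sinh (hdist p q)"
  have "0 \<le> c" "0 \<le> c'" using assms hdist_nonneg[of p q] by (simp_all add: c_def c'_def)
  then show ?thesis
    unfolding same_ray_iff_chart[OF pq(1) geo_H3 geo_H3] chart_geo c_def[symmetric] c'_def[symmetric] by simp
qed

lemma hdist_geo_geo: "\<lbrakk>0 \<le> s; 0 \<le> t\<rbrakk> \<Longrightarrow> hdist (geo p q s) (geo p q t) = \<bar>s - t\<bar> * hdist p q"
  using same_ray_geo[of s t] hdist_nonneg[of p q]
  by (simp add: same_ray_def hdist_geo left_diff_distrib[symmetric] abs_mult)

lemma geo_0 [simp]: "geo p q 0 = p"
  using hdist_geo[of 0] hdist_eq_0_iff[of p "geo p q 0"] by simp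

lemma geo_1 [simp]: "geo p q 1 = q"
proof (cases "p = q")
  case False
  then have "sinh (hdist p q) \<noteq> 0" using hdist_pos[of p q] by simp
  then show ?thesis by (simp add: geo_def chart_inv_chart)
next
  case True
  then have "hdist p (geo p q 1) = 0" using hdist_geo[of 1] by simp
  then have "p = geo p q 1" using hdist_eq_0_iff[OF pq(1) geo_H3, of 1] by simp
  then show ?thesis using True by simp
qed

text \<open>A metric characterisation, from which reversal and compatibility with isometries follow
  without coordinates.\<close>

lemma geo_unique:
  assumes "x \<in> H3" "0 \<le> t" "t \<le> 1" "hdist p x = t * hdist p q" "hdist x q = (1 - t) * hdist p q"
  shows "x = geo p q t"
proof (cases "p = q")
  case True
  then have "hdist p x = 0" "hdist p (geo p q t) = 0" using assms hdist_geo[of t] by simp_all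
  then have "p = x" "p = geo p q t" using hdist_eq_0_iff[OF pq(1) assms(1)] hdist_eq_0_iff[OF pq(1) geo_H3, of t] by simp_all
  then show ?thesis by metis
next
  case False
  have "same_ray p x q"
  proof -
    have "t * hdist p q - hdist p q = - ((1 - t) * hdist p q)" by (simp add: algebra_simps)
    then show ?thesis unfolding same_ray_def assms(4,5)
      using assms(3) hdist_nonneg[OF pq] by (simp only: abs_minus_cancel) simp
  qed
  moreover have "same_ray p q (geo p q t)" using same_ray_geo[of 1 t] assms by simp
  ultimately have "same_ray p x (geo p q t)" using same_ray_trans[of p x q "geo p q t"] False assms by auto
  then show ?thesis using assms same_ray_unique[of x "geo p q t" p] by (simp add: hdist_geo)
qed

lemma continuous_on_geo: "continuous_on A (geo p q)"
proof -
  have c1: "continuous_on A (\<lambda>t. (sinh (t * hdist p q) / sinh (hdist p q)) *\<^sub>R chart p q)"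
    unfolding divide_inverse by (intro continuous_intros)
  have c2: "continuous_on UNIV (chart_inv p)"
  proof -
    have "hc w - fst w \<noteq> 0" for w using hc_gt_fst[of w] by simp
    moreover have "continuous_on UNIV (\<lambda>w. hc w)" unfolding hc_def by (intro continuous_intros)
    ultimately show ?thesis unfolding chart_inv_def Let_def
      by (intro continuous_intros) auto
  qed
  show ?thesis unfolding geo_def
    by (rule continuous_on_compose2[OF c2 c1]) simp
qed

end

lemma geo_reverse: assumes [simp]: "p \<in> H3" "q \<in> H3" and t: "0 \<le> t" "t \<le> 1" shows "geo q p (1 - t) = geo p q t"
proof (rule geo_unique)
  show "hdist p (geo q p (1 - t)) = t * hdist p q"
    using hdist_geo_geo[of q p 1 "1 - t"] t by (simp add: hdist_commute)
  show "hdist (geo q p (1 - t)) q = (1 - t) * hdist p q"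
    using hdist_geo[of q p "1 - t"] t by (simp add: hdist_commute)
qed (use t in auto)

section \<open>Midpoint convexity of the distance\<close>

text \<open>In the chart centred at \<open>a\<close>, with \<open>u\<close> and \<open>v\<close> the two midpoints, \<open>cosh (d b d) - cosh (2 d m n)\<close>
  is twice the Gram determinant of \<open>u\<close> and \<open>v\<close>.\<close>

lemma midline:
  assumes [simp]: "a \<in> H3" "b \<in> H3" "d \<in> H3"
  shows "2 * hdist (geo a b (1/2)) (geo a d (1/2)) \<le> hdist b d"
    and "2 * hdist (geo a b (1/2)) (geo a d (1/2)) = hdist b d \<Longrightarrow> coll a b d"
proof -
  define m where "m = geo a b (1/2)"
  define n where "n = geo a d (1/2)"
  define u where "u = chart a m"
  define v where "v = chart a n"
  have mn [simp]: "m \<in> H3" "n \<in> H3" by (simp_all add: m_def n_def)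
  \<comment> \<open>Double-angle formulas for cosh and sinh express a point through the midpoint of
    the segment from \<open>a\<close> to it.\<close>
  have dbl: "chart a x = (2 * hc (chart a (geo a x (1/2)))) *\<^sub>R chart a (geo a x (1/2))"
    "hc (chart a x) = 2 * (hc (chart a (geo a x (1/2))))\<^sup>2 - 1" if [simp]: "x \<in> H3" for x
  proof -
    define r where "r = hdist a x / 2"
    have h: "hc (chart a (geo a x (1/2))) = cosh r"
      using cosh_hdist_chart[of a "geo a x (1/2)"] hdist_geo[of a x "1/2"] by (simp add: r_def)
    have x: "hdist a x = 2 * r" by (simp add: r_def)
    show "hc (chart a x) = 2 * (hc (chart a (geo a x (1/2))))\<^sup>2 - 1"
      using cosh_hdist_chart[of a x] cosh_double_cosh[of r] by (simp add: h x)
    have "chart a (geo a x (1/2)) = (sinh r / sinh (2 * r)) *\<^sub>R chart a x"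
      using chart_geo[of a x "1/2"] by (simp add: x)
    then have g: "(2 * cosh r) *\<^sub>R chart a (geo a x (1/2)) = (2 * cosh r * (sinh r / sinh (2 * r))) *\<^sub>R chart a x"
      by simp
    have "chart a x = (2 * cosh r) *\<^sub>R chart a (geo a x (1/2))"
    proof (cases "chart a x = 0")
      case False
      then have "r \<noteq> 0" using chart_self[of a] hdist_eq_0_iff[of a x] by (auto simp: x)
      then have "2 * cosh r * (sinh r / sinh (2 * r)) = 1" by (simp add: sinh_double)
      then show ?thesis unfolding g by simp
    qed (use g in simp)
    then show "chart a x = (2 * hc (chart a (geo a x (1/2)))) *\<^sub>R chart a (geo a x (1/2))"
      by (subst h)
  qed
  have "cosh (hdist b d) = (2 * (hc u)\<^sup>2 - 1) * (2 * (hc v)\<^sup>2 - 1) - 4 * hc u * hc v * (u \<bullet> v)"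
    using dbl[of b] dbl[of d] by (simp add: cosh_hdist cosh_dist_chart[of a b d] u_def v_def m_def n_def)
  moreover have "cosh (2 * hdist m n) = 2 * (hc u * hc v - u \<bullet> v)\<^sup>2 - 1"
    unfolding cosh_double_cosh by (simp add: cosh_hdist cosh_dist_chart[of a m n] u_def v_def)
  ultimately have key: "cosh (hdist b d) - cosh (2 * hdist m n) = 2 * ((norm u)\<^sup>2 * (norm v)\<^sup>2 - (u \<bullet> v)\<^sup>2)"
    using hc_sq[of u] hc_sq[of v] by (simp add: power2_eq_square) algebra
  have "(u \<bullet> v)\<^sup>2 \<le> (norm u)\<^sup>2 * (norm v)\<^sup>2"
    using Cauchy_Schwarz_ineq[of u v] by (simp add: power2_norm_eq_inner)
  then have "cosh (2 * hdist m n) \<le> cosh (hdist b d)" using key by simp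
  then show "2 * hdist (geo a b (1/2)) (geo a d (1/2)) \<le> hdist b d"
    unfolding m_def[symmetric] n_def[symmetric] by (simp add: cosh_real_nonneg_le_iff hdist_nonneg)
  assume "2 * hdist (geo a b (1/2)) (geo a d (1/2)) = hdist b d"
  then have "(u \<bullet> v)\<^sup>2 = (norm u * norm v)\<^sup>2"
    using key unfolding m_def[symmetric] n_def[symmetric] by (simp add: power_mult_distrib)
  then have "u \<bullet> v = norm u * norm v \<or> u \<bullet> v = - (norm u * norm v)" by (simp add: power2_eq_iff)
  then have "coll a m n"
    unfolding coll_def hdist_eq_add_iff[OF assms(1) mn] hdist_eq_diff_iff[OF assms(1) mn] u_def v_def .
  have cm: "coll a x (geo a x (1/2))" if "x \<in> H3" for x
    using same_ray_geo[of a x 1 "1/2"] that by (simp add: same_ray_def coll_def)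
  have ne: "geo a x (1/2) \<noteq> a" if "x \<in> H3" "x \<noteq> a" for x
    using hdist_geo[of a x "1/2"] hdist_pos[of a x] that by auto
  show "coll a b d"
  proof (cases "b = a \<or> d = a")
    case True
    then show ?thesis by (auto simp: coll_def hdist_nonneg hdist_commute)
  next
    case False
    have "coll a b n"
      using coll_trans[of a b m n] cm[of b] \<open>coll a m n\<close> ne[of b] False by (simp add: m_def)
    then show ?thesis
      using coll_trans[of a b n d] cm[of d] ne[of d] False coll_perms(1)[of a d n] by (simp add: n_def)
  qed
qed

lemma geo_half_commute: "\<lbrakk>p \<in> H3; q \<in> H3\<rbrakk> \<Longrightarrow> geo p q (1/2) = geo q p (1/2)"
  using geo_reverse[of q p "1/2"] by simp

text \<open>The diagonal from \<open>a\<close> to \<open>d\<close> cuts the quadrilateral into two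
  triangles, and \<open>midline\<close> applies to each. Equality forces both triangles to be
  degenerate and the three midpoints to be aligned.\<close>

lemma midpoint_convex:
  assumes [simp]: "a \<in> H3" "b \<in> H3" "c \<in> H3" "d \<in> H3"
  shows "2 * hdist (geo a b (1/2)) (geo c d (1/2)) \<le> hdist a c + hdist b d"
    and "\<lbrakk>2 * hdist (geo a b (1/2)) (geo c d (1/2)) = hdist a c + hdist b d\<rbrakk> \<Longrightarrow> coll a b c"
proof -
  let ?m = "geo a b (1/2)" and ?n = "geo c d (1/2)" and ?k = "geo a d (1/2)"
  have k: "?k = geo d a (1/2)" "?n = geo d c (1/2)" by (simp_all add: geo_half_commute)
  have 1: "2 * hdist ?m ?k \<le> hdist b d" using midline(1)[of a b d] by simp
  have 2: "2 * hdist ?k ?n \<le> hdist a c" unfolding k using midline(1)[of d a c] by simp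
  have 3: "hdist ?m ?n \<le> hdist ?m ?k + hdist ?k ?n" by (rule hdist_triangle) simp_all
  show "2 * hdist ?m ?n \<le> hdist a c + hdist b d" using 1 2 3 by linarith
  assume "2 * hdist ?m ?n = hdist a c + hdist b d"
  then have e1: "2 * hdist ?m ?k = hdist b d" and e2: "2 * hdist ?k ?n = hdist a c"
    and e3: "hdist ?m ?n = hdist ?m ?k + hdist ?k ?n" using 1 2 3 by linarith+
  have c1: "coll a b d" using midline(2)[of a b d] e1 by simp
  have c2: "coll d a c" using midline(2)[of d a c] e2 unfolding k by simp
  show "coll a b c"
  proof (cases "d = a")
    case False
    then show ?thesis using coll_trans[of a b d c] c1 c2 coll_perms by auto
  next
    \<comment> \<open>The diagonal has length zero, so collinearity cannot pass through
      \<open>d\<close>; it comes from the midpoints instead, since \<open>a\<close> lies between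
      them.\<close>
    case True
    then have ka: "?k = a" using geo_unique[of a a a "1/2"] by simp
    have "coll a ?m ?n" using e3 ka by (simp add: coll_def hdist_commute)
    moreover have cm: "coll a x (geo a x (1/2))" if "x \<in> H3" for x
      using same_ray_geo[of a x 1 "1/2"] that by (simp add: same_ray_def coll_def)
    moreover have ne: "geo a x (1/2) \<noteq> a" if "x \<in> H3" "x \<noteq> a" for x
      using hdist_geo[of a x "1/2"] hdist_pos[of a x] that by auto
    ultimately show ?thesis
    proof (cases "b = a \<or> c = a")
      case True
      then show ?thesis by (auto simp: coll_def hdist_nonneg hdist_commute)
    next
      case False
      have n: "?n = geo a c (1/2)" using k(2) True by simp
      have "coll a b ?n"
        using coll_trans[of a b ?m ?n] cm[of b] \<open>coll a ?m ?n\<close> ne[of b] False by simp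
      then show ?thesis
        using coll_trans[of a b ?n c] cm[of c] ne[of c] False coll_perms(1)[of a c ?n] by (simp add: n)
    qed
  qed
qed

section \<open>The action of SL(2,C)\<close>

text \<open>The point \<open>(z, t)\<close> as the positive definite Hermitian matrix of determinant one on which \<open>A\<close>
  acts by \<open>H \<mapsto> A H A\<^sup>*\<close>; the polarised determinant is \<open>cosh\<close> of the distance.\<close>

definition herm :: "point3 \<Rightarrow> complex^2^2" where
  "herm p = vector [vector [of_real (((cmod (fst p))\<^sup>2 + (snd p)\<^sup>2) / snd p), fst p / of_real (snd p)],
     vector [cnj (fst p) / of_real (snd p), of_real (1 / snd p)]]"

definition adjoint2 :: "complex^2^2 \<Rightarrow> complex^2^2" where
  "adjoint2 A = (\<chi> i j. cnj (A $ j $ i))"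

lemma adjoint2_nth [simp]: "adjoint2 A $ i $ j = cnj (A $ j $ i)"
  by (simp add: adjoint2_def)

lemma adjoint2_mult: "adjoint2 (A ** B) = adjoint2 B ** adjoint2 A"
  by (simp add: mat2_eq_iff mult.commute)

lemma det_adjoint2: "det (adjoint2 A) = cnj (det A)"
  by (simp add: det_2 mult.commute)

lemma herm_nth:
  "herm p $ 1 $ 1 = of_real (((cmod (fst p))\<^sup>2 + (snd p)\<^sup>2) / snd p)"
  "herm p $ 1 $ 2 = fst p / of_real (snd p)"
  "herm p $ 2 $ 1 = cnj (fst p) / of_real (snd p)"
  "herm p $ 2 $ 2 = of_real (1 / snd p)"
  by (simp_all add: herm_def)

lemma herm_inject: "\<lbrakk>p \<in> H3; q \<in> H3; herm p = herm q\<rbrakk> \<Longrightarrow> p = q"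
  by (auto simp: mat2_eq_iff herm_nth mem_H3 prod_eq_iff field_simps)

lemma herm_of_real_sq: "complex_of_real ((cmod z)\<^sup>2) = z * cnj z"
  by (rule complex_norm_square)

lemma det_herm: "p \<in> H3 \<Longrightarrow> det (herm p) = 1"
  unfolding det_2 herm_nth of_real_divide of_real_add herm_of_real_sq
  by (simp add: mem_H3 field_simps power2_eq_square)

lemma cosh_dist_det:
  assumes "p \<in> H3" "q \<in> H3"
  shows "complex_of_real (cosh_dist p q) = (det (herm p + herm q) - 2) / 2"
proof -
  have pos: "complex_of_real (snd p) \<noteq> 0" "complex_of_real (snd q) \<noteq> 0" using assms by (auto simp: mem_H3)
  show ?thesis
    unfolding cosh_dist_def det_2 herm_nth vector_add_component of_real_divide of_real_add of_real_mult herm_of_real_sq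
    using pos by (simp add: field_simps power2_eq_square)
qed

definition act_denom :: "complex^2^2 \<Rightarrow> point3 \<Rightarrow> real" where
  "act_denom A p = (cmod (A $ 2 $ 1 * fst p + A $ 2 $ 2))\<^sup>2 + (cmod (A $ 2 $ 1))\<^sup>2 * (snd p)\<^sup>2"

definition act_num :: "complex^2^2 \<Rightarrow> point3 \<Rightarrow> complex" where
  "act_num A p = (A $ 1 $ 1 * fst p + A $ 1 $ 2) * cnj (A $ 2 $ 1 * fst p + A $ 2 $ 2)
     + A $ 1 $ 1 * cnj (A $ 2 $ 1) * of_real ((snd p)\<^sup>2)"

lemma act_eq: "SL2C_act A p = (act_num A p / of_real (act_denom A p), snd p / act_denom A p)"
  by (simp add: SL2C_act_def act_num_def act_denom_def Let_def)

lemma act_denom_pos: assumes "det A = 1" "p \<in> H3" shows "0 < act_denom A p"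
proof (cases "A $ 2 $ 1 = 0")
  case True
  then have "A $ 2 $ 2 \<noteq> 0" using assms by (auto simp: det_2)
  then show ?thesis using True by (simp add: act_denom_def)
next
  case False
  then show ?thesis using assms by (simp add: act_denom_def mem_H3 add_nonneg_pos)
qed

lemma act_H3: "\<lbrakk>det A = 1; p \<in> H3\<rbrakk> \<Longrightarrow> SL2C_act A p \<in> H3"
  using act_denom_pos[of A p] by (simp add: act_eq mem_H3)

text \<open>The determinant fixes the fourth entry, so three entries suffice to identify the image
  under the action.\<close>

lemma herm_11:
  assumes "p \<in> H3" shows "herm p $ 1 $ 1 = (1 + herm p $ 1 $ 2 * herm p $ 2 $ 1) / herm p $ 2 $ 2"
proof -
  have "herm p $ 2 $ 2 \<noteq> 0" using assms by (simp add: herm_nth mem_H3)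
  then show ?thesis using det_herm[OF assms] by (simp add: det_2 field_simps)
qed

lemma herm_act:
  assumes "det A = 1" "p \<in> H3" shows "herm (SL2C_act A p) = A ** herm p ** adjoint2 A"
proof -
  let ?M = "A ** herm p ** adjoint2 A" and ?q = "SL2C_act A p"
  define z t where "z = fst p" and "t = complex_of_real (snd p)"
  define N where "N = complex_of_real (act_denom A p)"
  have t: "t \<noteq> 0" "cnj t = t" using assms by (auto simp: t_def mem_H3)
  have N: "N \<noteq> 0" using act_denom_pos[OF assms] by (simp add: N_def)
  have h: "herm p $ 1 $ 1 = (z * cnj z + t\<^sup>2) / t" "herm p $ 1 $ 2 = z / t" "herm p $ 2 $ 1 = cnj z / t" "herm p $ 2 $ 2 = 1 / t"
    unfolding herm_nth of_real_divide of_real_add herm_of_real_sq by (simp_all add: z_def t_def)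
  have Nexp: "N = (A $ 2 $ 1 * z + A $ 2 $ 2) * cnj (A $ 2 $ 1 * z + A $ 2 $ 2) + A $ 2 $ 1 * cnj (A $ 2 $ 1) * t\<^sup>2"
    unfolding N_def act_denom_def of_real_add of_real_mult herm_of_real_sq by (simp add: z_def t_def)
  have nexp: "act_num A p = (A $ 1 $ 1 * z + A $ 1 $ 2) * cnj (A $ 2 $ 1 * z + A $ 2 $ 2) + A $ 1 $ 1 * cnj (A $ 2 $ 1) * t\<^sup>2"
    by (simp add: act_num_def z_def t_def)
  have q: "fst ?q = act_num A p / N" "complex_of_real (snd ?q) = t / N"
    by (simp_all add: act_eq N_def t_def)
  have N_real: "cnj N = N" by (simp add: N_def)
  have M22: "?M $ 2 $ 2 = N / t"
    using t by (simp add: h Nexp field_simps power2_eq_square)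
  have M12: "?M $ 1 $ 2 = act_num A p / t"
    using t by (simp add: h nexp field_simps power2_eq_square)
  have M21: "?M $ 2 $ 1 = cnj (act_num A p) / t"
    using t by (simp add: h nexp field_simps power2_eq_square)
  have q22: "herm ?q $ 2 $ 2 = ?M $ 2 $ 2" and q12: "herm ?q $ 1 $ 2 = ?M $ 1 $ 2" and q21: "herm ?q $ 2 $ 1 = ?M $ 2 $ 1"
    unfolding M22 M12 M21 herm_nth of_real_divide q using N N_real t by simp_all
  have "det ?M = 1" using assms det_herm by (simp add: det_mul det_adjoint2)
  then have "?M $ 1 $ 1 * ?M $ 2 $ 2 - ?M $ 1 $ 2 * ?M $ 2 $ 1 = 1" by (simp only: det_2)
  moreover have "?M $ 2 $ 2 \<noteq> 0" unfolding M22 using N t by simp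
  ultimately have "?M $ 1 $ 1 = (1 + ?M $ 1 $ 2 * ?M $ 2 $ 1) / ?M $ 2 $ 2"
    using eq_divide_eq[of "?M $ 1 $ 1" "1 + ?M $ 1 $ 2 * ?M $ 2 $ 1" "?M $ 2 $ 2"] by (metis diff_eq_eq)
  then have "herm ?q $ 1 $ 1 = ?M $ 1 $ 1"
    using herm_11[OF act_H3[OF assms]] unfolding q22 q12 q21 by simp
  then show ?thesis using q22 q12 q21 by (simp only: mat2_eq_iff simp_thms)
qed

lemma hdist_act:
  assumes "det A = 1" "p \<in> H3" "q \<in> H3" shows "hdist (SL2C_act A p) (SL2C_act A q) = hdist p q"
proof -
  have "A ** herm p ** adjoint2 A + A ** herm q ** adjoint2 A = A ** (herm p + herm q) ** adjoint2 A"
    by (simp add: mat2_eq_iff algebra_simps)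
  then have "complex_of_real (cosh_dist (SL2C_act A p) (SL2C_act A q)) = complex_of_real (cosh_dist p q)"
    using assms by (simp add: cosh_dist_det act_H3 herm_act det_mul det_adjoint2)
  then have "cosh_dist (SL2C_act A p) (SL2C_act A q) = cosh_dist p q" by (simp only: of_real_eq_iff)
  then show ?thesis by (simp add: hdist_def cosh_dist_def)
qed

lemma act_mult:
  assumes "det A = 1" "det B = 1" "p \<in> H3" shows "SL2C_act (A ** B) p = SL2C_act A (SL2C_act B p)"
proof (rule herm_inject)
  show "herm (SL2C_act (A ** B) p) = herm (SL2C_act A (SL2C_act B p))"
    using assms by (simp add: herm_act act_H3 det_mul adjoint2_mult matrix_mul_assoc del: mat2_mult_nth)
qed (use assms in \<open>auto intro!: act_H3 simp: det_mul\<close>)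

lemma act_one [simp]: "SL2C_act (mat 1) p = p"
  by (simp add: SL2C_act_def)

lemma continuous_on_act: assumes "det A = 1" shows "continuous_on H3 (SL2C_act A)"
proof -
  have "\<forall>p\<in>H3. act_denom A p \<noteq> 0" using act_denom_pos[OF assms] by fastforce
  moreover have "continuous_on H3 (act_denom A)" "continuous_on H3 (act_num A)"
    unfolding act_denom_def act_num_def by (intro continuous_intros)+
  ultimately show ?thesis unfolding act_eq[abs_def]
    by (intro continuous_on_Pair continuous_on_divide continuous_on_of_real continuous_on_snd continuous_on_id) auto
qed

lemma act_geo:
  assumes A: "det A = 1" and p: "p \<in> H3" "q \<in> H3" and t: "0 \<le> t" "t \<le> 1"
  shows "SL2C_act A (geo p q t) = geo (SL2C_act A p) (SL2C_act A q) t"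
proof (rule geo_unique)
  show "hdist (SL2C_act A p) (SL2C_act A (geo p q t)) = t * hdist (SL2C_act A p) (SL2C_act A q)"
    using assms by (simp add: hdist_act hdist_geo)
  show "hdist (SL2C_act A (geo p q t)) (SL2C_act A q) = (1 - t) * hdist (SL2C_act A p) (SL2C_act A q)"
    using assms hdist_geo_geo[of p q t 1] by (simp add: hdist_act)
qed (use assms in \<open>auto intro: act_H3\<close>)

text \<open>Conjugation moves \<open>p\<close> to j, where 2 cosh of the displacement is the sum of
  the squared moduli of the entries; the trace involves only two of them.\<close>

lemma trace_bound:
  assumes A: "det A = 1" and p: "p \<in> H3" shows "(cmod (trace A))\<^sup>2 \<le> 4 * cosh (hdist p (SL2C_act A p))"
proof -
  define j :: point3 where "j = (0, 1)"
  \<comment> \<open>The upper triangular matrix of determinant one that takes j to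
    \<open>p\<close>.\<close>
  define T :: "complex^2^2" where "T = vector [vector [of_real (sqrt (snd p)), fst p / of_real (sqrt (snd p))],
      vector [0, of_real (1 / sqrt (snd p))]]"
  have pos: "snd p > 0" using p by (simp add: mem_H3)
  have T: "T $ 1 $ 1 = of_real (sqrt (snd p))" "T $ 1 $ 2 = fst p / of_real (sqrt (snd p))" "T $ 2 $ 1 = 0"
    "T $ 2 $ 2 = of_real (1 / sqrt (snd p))"
    by (simp_all add: T_def)
  have dT: "det T = 1" using pos by (simp add: det_2 T)
  have j: "j \<in> H3" by (simp add: j_def mem_H3)
  have Tj: "SL2C_act T j = p"
    using pos by (simp add: SL2C_act_def Let_def T j_def prod_eq_iff power_divide norm_divide of_real_divide[symmetric] del: of_real_divide)
      (simp add: of_real_mult[symmetric] field_simps power2_eq_square del: of_real_mult)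
  define M where "M = adj2 T ** A ** T"
  have dM: "det M = 1" using A dT by (simp add: M_def det_mul)
  have "T ** M = A ** T" using adj2_mult(2)[OF dT] by (simp add: M_def matrix_mul_assoc)
  then have "SL2C_act T (SL2C_act M j) = SL2C_act A p"
    using act_mult[OF dT dM j] act_mult[OF A dT j] Tj by simp
  moreover have tr: "trace M = trace A" using trace_conj[of T M A] \<open>T ** M = A ** T\<close> dT by simp
  ultimately have d: "hdist p (SL2C_act A p) = hdist j (SL2C_act M j)"
    using hdist_act[OF dT j act_H3[OF dM j]] Tj by simp
  have hj: "herm j = mat 1" by (simp add: mat2_eq_iff herm_nth j_def)
  have "complex_of_real (2 * cosh_dist j (SL2C_act M j)) = det (mat 1 + M ** adjoint2 M) - 2"
    using cosh_dist_det[OF j act_H3[OF dM j]] herm_act[OF dM j] by (simp add: hj mult.commute)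
  also have "\<dots> = M $ 1 $ 1 * cnj (M $ 1 $ 1) + M $ 1 $ 2 * cnj (M $ 1 $ 2) + M $ 2 $ 1 * cnj (M $ 2 $ 1) + M $ 2 $ 2 * cnj (M $ 2 $ 2)
      + det M * cnj (det M) - 1"
    by (simp add: det_2 algebra_simps)
  also have "\<dots> = complex_of_real ((cmod (M $ 1 $ 1))\<^sup>2 + (cmod (M $ 1 $ 2))\<^sup>2 + (cmod (M $ 2 $ 1))\<^sup>2 + (cmod (M $ 2 $ 2))\<^sup>2)"
    unfolding of_real_add herm_of_real_sq dM by simp
  finally have c: "2 * cosh_dist j (SL2C_act M j) = (cmod (M $ 1 $ 1))\<^sup>2 + (cmod (M $ 1 $ 2))\<^sup>2 + (cmod (M $ 2 $ 1))\<^sup>2 + (cmod (M $ 2 $ 2))\<^sup>2"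
    by (simp only: of_real_eq_iff)
  have "(cmod (trace M))\<^sup>2 \<le> (cmod (M $ 1 $ 1) + cmod (M $ 2 $ 2))\<^sup>2"
    unfolding trace2 by (intro power_mono norm_triangle_ineq) simp
  also have "\<dots> \<le> 2 * ((cmod (M $ 1 $ 1))\<^sup>2 + (cmod (M $ 2 $ 2))\<^sup>2)"
    using sum_squares_bound[of "cmod (M $ 1 $ 1)" "cmod (M $ 2 $ 2)"] by (simp add: power2_sum)
  also have "\<dots> \<le> 4 * cosh_dist j (SL2C_act M j)"
  proof -
    have "4 * cosh_dist j (SL2C_act M j) = 2 * (2 * cosh_dist j (SL2C_act M j))" by simp
    then show ?thesis unfolding c by simp
  qed
  finally show ?thesis using tr d cosh_hdist[OF j act_H3[OF dM j]] by simp
qed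

lemma continuous_on_hdist:
  fixes f :: "real \<Rightarrow> point3"
  assumes "p \<in> H3" "continuous_on S f" "f ` S \<subseteq> H3" shows "continuous_on S (\<lambda>t. hdist p (f t))"
proof -
  have ne: "\<forall>t\<in>S. 2 * snd p * snd (f t) \<noteq> 0"
    using assms by (auto simp: mem_H3 image_subset_iff)
  have ge: "1 \<le> 1 + ((cmod (fst p - fst (f t)))\<^sup>2 + (snd p - snd (f t))\<^sup>2) / (2 * snd p * snd (f t))" if "t \<in> S" for t
    using assms that by (auto simp: mem_H3 image_subset_iff intro!: divide_nonneg_pos)
  have num: "continuous_on S (\<lambda>t. (cmod (fst p - fst (f t)))\<^sup>2 + (snd p - snd (f t))\<^sup>2)"
    and den: "continuous_on S (\<lambda>t. 2 * snd p * snd (f t))"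
    by (intro continuous_intros assms(2))+
  have q: "continuous_on S (\<lambda>t. 1 + ((cmod (fst p - fst (f t)))\<^sup>2 + (snd p - snd (f t))\<^sup>2) / (2 * snd p * snd (f t)))"
    by (rule continuous_on_add[OF continuous_on_const]) (rule continuous_on_divide[OF num den ne])
  show ?thesis unfolding hdist_def by (rule continuous_on_arcosh'[OF q]) (rule ge)
qed

section \<open>Straight carrier graphs\<close>

lemma UNIV_edge: "(UNIV :: edge set) = {E1, E2, E3}"
  using edge.exhaust by auto

lemma finite_edge_bool: "finite (A :: (edge \<times> bool) set)"
proof (rule finite_subset)
  show "A \<subseteq> {E1, E2, E3} \<times> UNIV" using UNIV_edge by auto
qed simp

text \<open>A dart is an edge with the choice of one of its ends; \<open>True\<close> selects the source.\<close>

definition darts :: "two_graph \<Rightarrow> vertex \<Rightarrow> (edge \<times> bool) set" where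
  "darts \<Gamma> v = {d. (if snd d then src \<Gamma> (fst d) else tgt \<Gamma> (fst d)) = v}"

lemma darts_iff: "(e, True) \<in> darts \<Gamma> v \<longleftrightarrow> src \<Gamma> e = v" "(e, False) \<in> darts \<Gamma> v \<longleftrightarrow> tgt \<Gamma> e = v"
  by (simp_all add: darts_def)

text \<open>Trivalence; a loop contributes both of its ends.\<close>

lemma three_darts:
  "\<exists>d1 d2 d3. {d1, d2, d3} \<subseteq> darts \<Gamma> v \<and> d1 \<noteq> d2 \<and> d1 \<noteq> d3 \<and> d2 \<noteq> d3"
proof -
  have "{(E1, True), (E2, True), (E3, True)} \<subseteq> darts Buckle V0" "{(E1, False), (E2, False), (E3, False)} \<subseteq> darts Buckle V1"
    "{(E1, True), (E1, False), (E3, True)} \<subseteq> darts Dumbbell V0" "{(E2, True), (E2, False), (E3, False)} \<subseteq> darts Dumbbell V1"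
    by (simp_all add: darts_iff)
  moreover have "(E1, c) \<noteq> (E2, c')" "(E1, c) \<noteq> (E3, c')" "(E2, c) \<noteq> (E3, c')" "(e, True) \<noteq> (e, False)" for c c' :: bool and e :: edge
    by simp_all
  ultimately show ?thesis by (cases \<Gamma>; cases v) blast+
qed

section \<open>Stars in the universal cover\<close>

context free2
begin

abbreviation vt :: "edge \<Rightarrow> 'a" where "vt \<equiv> voltage G a b"

abbreviation cover :: "two_graph \<Rightarrow> 'a cover_point topology" where "cover \<equiv> cover_topology G a b"

abbreviation epath :: "two_graph \<Rightarrow> 'a \<Rightarrow> edge \<Rightarrow> real \<Rightarrow> 'a cover_point" where "epath \<equiv> edge_path G a b"

lemma vt_closed [simp, intro]: "vt e \<in> carrier G"
  by (cases e) auto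

lemma topspace_cover [simp]: "topspace (cover \<Gamma>) = cover_points G"
  by (rule topspace_cover_topology) (auto intro: is_group)

lemma epath_0 [simp]: "epath \<Gamma> g e 0 = Vert g (src \<Gamma> e)"
  and epath_1 [simp]: "epath \<Gamma> g e 1 = Vert (g \<otimes> vt e) (tgt \<Gamma> e)"
  and epath_inner: "0 < t \<Longrightarrow> t < 1 \<Longrightarrow> epath \<Gamma> g e t = Inner g e t"
  by (simp_all add: edge_path_def)

lemma epath_in_cover: "g \<in> carrier G \<Longrightarrow> epath \<Gamma> g e t \<in> cover_points G"
  by (auto simp: edge_path_def cover_points_def)

lemma src_E3: "src \<Gamma> E3 = V0" and tgt_E3: "tgt \<Gamma> E3 = V1"
  by (cases \<Gamma>; simp)+

lemma cover_points_eq: "cover_points G = (\<Union>g\<in>carrier G. \<Union>e. epath \<Gamma> g e ` {0..1})"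
proof
  show "(\<Union>g\<in>carrier G. \<Union>e. epath \<Gamma> g e ` {0..1}) \<subseteq> cover_points G" using epath_in_cover by auto
  show "cover_points G \<subseteq> (\<Union>g\<in>carrier G. \<Union>e. epath \<Gamma> g e ` {0..1})"
  proof
    fix x assume "x \<in> cover_points G"
    then consider g v where "x = Vert g v" "g \<in> carrier G" | g e t where "x = Inner g e t" "g \<in> carrier G" "0 < t" "t < 1"
      by (auto simp: cover_points_def)
    then show "x \<in> (\<Union>g\<in>carrier G. \<Union>e. epath \<Gamma> g e ` {0..1})"
    proof cases
      case (1 g v)
      have "x = epath \<Gamma> g E3 (if v = V0 then 0 else 1)"
        using 1 by (cases v) (simp_all add: src_E3 tgt_E3)
      then show ?thesis using 1 by (intro UN_I[of g] UN_I[of E3]) auto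
    next
      case (2 g e t)
      then have "x = epath \<Gamma> g e t" by (simp add: epath_inner)
      then show ?thesis using 2 by (intro UN_I[of g] UN_I[of e]) auto
    qed
  qed
qed

lemma continuous_map_epath: "g \<in> carrier G \<Longrightarrow> continuous_map (top_of_set {0..1}) (cover \<Gamma>) (epath \<Gamma> g e)"
  by (auto simp: continuous_map openin_cover_topology epath_in_cover image_subset_iff)

lemma continuous_map_cover_euclidean:
  assumes "\<And>g e. g \<in> carrier G \<Longrightarrow> continuous_on {0..1} (\<lambda>t. f (epath \<Gamma> g e t))"
  shows "continuous_map (cover \<Gamma>) euclidean (f :: 'a cover_point \<Rightarrow> point3)"
  unfolding continuous_map
proof (intro conjI allI impI)
  fix U assume "openin (euclidean :: point3 topology) U"
  then have U: "open U" by simp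
  show "openin (cover \<Gamma>) {x \<in> topspace (cover \<Gamma>). f x \<in> U}"
    unfolding openin_cover_topology
  proof (intro conjI ballI allI)
    fix g e assume g: "g \<in> carrier G"
    have "{t \<in> {0..1}. epath \<Gamma> g e t \<in> {x \<in> topspace (cover \<Gamma>). f x \<in> U}} = {0..1} \<inter> (\<lambda>t. f (epath \<Gamma> g e t)) -` U"
      using epath_in_cover[OF g] by auto
    then show "openin (top_of_set {0..1}) {t \<in> {0..1}. epath \<Gamma> g e t \<in> {x \<in> topspace (cover \<Gamma>). f x \<in> U}}"
      using continuous_openin_preimage_gen[OF assms[OF g] U] by simp
  qed auto
qed auto

text \<open>Runs along the dart away from the vertex with index \<open>g\<close>. For a target end,
  the lift arriving at index \<open>g\<close> is the one that starts at \<open>g\<close> times the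
  inverse voltage.\<close>

fun dpath :: "two_graph \<Rightarrow> 'a \<Rightarrow> edge \<times> bool \<Rightarrow> real \<Rightarrow> 'a cover_point" where
  "dpath \<Gamma> g (e, True) t = epath \<Gamma> g e t"
| "dpath \<Gamma> g (e, False) t = epath \<Gamma> (g \<otimes> inv (vt e)) e (1 - t)"

lemma dpath_0: "\<lbrakk>d \<in> darts \<Gamma> v; g \<in> carrier G\<rbrakk> \<Longrightarrow> dpath \<Gamma> g d 0 = Vert g v"
  by (cases d; cases "snd d") (auto simp: darts_iff m_assoc)

lemma continuous_map_dpath:
  assumes "g \<in> carrier G" shows "continuous_map (top_of_set {0..1}) (cover \<Gamma>) (dpath \<Gamma> g d)"
proof (cases d)
  case (Pair e c)
  have "continuous_map (top_of_set {0..1}) (top_of_set {0..1}) (\<lambda>t::real. 1 - t)"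
    by (auto simp: continuous_map_in_subtopology intro!: continuous_intros)
  from continuous_map_compose[OF this continuous_map_epath[of "g \<otimes> inv (vt e)" \<Gamma> e]]
  moreover have "dpath \<Gamma> g (e, True) = epath \<Gamma> g e" "dpath \<Gamma> g (e, False) = (\<lambda>t. epath \<Gamma> (g \<otimes> inv (vt e)) e (1 - t))"
    by (simp_all add: fun_eq_iff)
  ultimately show ?thesis
    using assms continuous_map_epath[of g \<Gamma> e] by (cases c) (simp_all add: Pair comp_def)
qed

lemma dpath_in_cover: "g \<in> carrier G \<Longrightarrow> dpath \<Gamma> g d t \<in> cover_points G"
  by (cases d; cases "snd d") (auto intro!: epath_in_cover)

text \<open>Open stars of vertices cover the tree and serve as neighbourhoods. The closed stars
  below are compact, so there injectivity and continuity already give a homeomorphism.\<close>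

definition star :: "two_graph \<Rightarrow> 'a \<Rightarrow> vertex \<Rightarrow> 'a cover_point set" where
  "star \<Gamma> g v = {dpath \<Gamma> g d t | d t. d \<in> darts \<Gamma> v \<and> 0 \<le> t \<and> t < 1}"

definition cstar :: "two_graph \<Rightarrow> 'a \<Rightarrow> vertex \<Rightarrow> 'a cover_point set" where
  "cstar \<Gamma> g v = (\<Union>d\<in>darts \<Gamma> v. dpath \<Gamma> g d ` {0..1})"

lemma star_subset_cstar: "star \<Gamma> g v \<subseteq> cstar \<Gamma> g v"
proof
  fix x assume "x \<in> star \<Gamma> g v"
  then obtain d t where "x = dpath \<Gamma> g d t" "d \<in> darts \<Gamma> v" "0 \<le> t" "t < 1" by (auto simp: star_def)
  then show "x \<in> cstar \<Gamma> g v" unfolding cstar_def by (intro UN_I[of d] image_eqI[of _ _ t]) auto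
qed

lemma compactin_cstar: assumes "g \<in> carrier G" shows "compactin (cover \<Gamma>) (cstar \<Gamma> g v)"
  unfolding cstar_def
proof (rule compactin_Union)
  show "finite ((\<lambda>d. dpath \<Gamma> g d ` {0..1}) ` darts \<Gamma> v)" by (intro finite_imageI finite_edge_bool)
  have "compactin (top_of_set {0..1::real}) {0..1}" by (simp add: compactin_subtopology)
  then show "compactin (cover \<Gamma>) S" if "S \<in> (\<lambda>d. dpath \<Gamma> g d ` {0..1}) ` darts \<Gamma> v" for S
    using that image_compactin[OF _ continuous_map_dpath[OF assms]] by auto
qed

lemma epath_in_star_iff:
  assumes g: "g \<in> carrier G" "g' \<in> carrier G" and t: "0 \<le> t" "t \<le> 1"
  shows "epath \<Gamma> g' e t \<in> star \<Gamma> g v \<longleftrightarrow>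
    (t < 1 \<and> g' = g \<and> src \<Gamma> e = v) \<or> (0 < t \<and> g' \<otimes> vt e = g \<and> tgt \<Gamma> e = v)" (is "?L \<longleftrightarrow> ?R")
proof
  assume ?L
  then obtain d s where d: "epath \<Gamma> g' e t = dpath \<Gamma> g d s" "d \<in> darts \<Gamma> v" "0 \<le> s" "s < 1"
    by (auto simp: star_def)
  show ?R
  proof (cases "s = 0")
    case True
    then have "epath \<Gamma> g' e t = Vert g v" using d dpath_0 g by simp
    then show ?R using t by (auto simp: edge_path_def split: if_splits)
  next
    case False
    obtain e' c where d': "d = (e', c)" by (cases d)
    show ?R
    proof (cases c)
      case True
      then have "epath \<Gamma> g' e t = Inner g e' s" using d d' False by (simp add: epath_inner)
      then show ?R using d d' True by (auto simp: edge_path_def darts_iff split: if_splits)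
    next
      case c: False
      then have "epath \<Gamma> g' e t = Inner (g \<otimes> inv (vt e')) e' (1 - s)" using d d' False by (simp add: epath_inner)
      then have "t = 1 - s" "g' = g \<otimes> inv (vt e')" "e = e'" by (auto simp: edge_path_def split: if_splits)
      then show ?R using d d' c g by (auto simp: darts_iff m_assoc)
    qed
  qed
next
  assume ?R
  then show ?L
  proof
    assume "t < 1 \<and> g' = g \<and> src \<Gamma> e = v"
    then show ?L unfolding star_def
      by (intro CollectI exI[of _ "(e, True)"] exI[of _ t]) (use t in \<open>auto simp: darts_iff\<close>)
  next
    assume "0 < t \<and> g' \<otimes> vt e = g \<and> tgt \<Gamma> e = v"
    then show ?L unfolding star_def
      by (intro CollectI exI[of _ "(e, False)"] exI[of _ "1 - t"]) (use t g in \<open>auto simp: darts_iff m_assoc\<close>)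
  qed
qed

lemma openin_star: assumes g: "g \<in> carrier G" shows "openin (cover \<Gamma>) (star \<Gamma> g v)"
  unfolding openin_cover_topology
proof (intro conjI ballI allI)
  show "star \<Gamma> g v \<subseteq> cover_points G" using dpath_in_cover[OF g] by (auto simp: star_def)
  fix g' e assume g': "g' \<in> carrier G"
  have "{t \<in> {0..1}. epath \<Gamma> g' e t \<in> star \<Gamma> g v} =
      {0..1} \<inter> ((if g' = g \<and> src \<Gamma> e = v then {..<1} else {}) \<union> (if g' \<otimes> vt e = g \<and> tgt \<Gamma> e = v then {0<..} else {}))"
    using epath_in_star_iff[OF g g'] by auto
  also have "openin (top_of_set {0..1}) \<dots>"
    by (rule openin_open_Int) auto
  finally show "openin (top_of_set {0..1}) {t \<in> {0..1}. epath \<Gamma> g' e t \<in> star \<Gamma> g v}" .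
qed

lemma in_some_star: assumes "x \<in> cover_points G" obtains g v where "g \<in> carrier G" "x \<in> star \<Gamma> g v"
proof -
  obtain g e t where get: "g \<in> carrier G" "x = epath \<Gamma> g e t" "0 \<le> t" "t \<le> 1"
    using assms cover_points_eq[of \<Gamma>] by auto
  show ?thesis
  proof (cases "t < 1")
    case True
    then show ?thesis using that[of g "src \<Gamma> e"] get epath_in_star_iff[of g g t] by auto
  next
    case False
    then show ?thesis using that[of "g \<otimes> vt e" "tgt \<Gamma> e"] get epath_in_star_iff[of "g \<otimes> vt e" g t] by auto
  qed
qed

text \<open>Only the two ends of a loop need care: they lie on different lifts because the voltage
  of a loop is not trivial.\<close>

lemma dpath_inner_inject:
  assumes "d \<in> darts \<Gamma> v" "d' \<in> darts \<Gamma> v" "dpath \<Gamma> \<one> d t = dpath \<Gamma> \<one> d' t'" "0 < t" "t < 1" "0 < t'" "t' < 1"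
  shows "d = d'"
proof -
  obtain e c e' c' where d: "d = (e, c)" "d' = (e', c')" by (cases d; cases d')
  have I: "dpath \<Gamma> \<one> (e, c) t = (if c then Inner \<one> e t else Inner (inv (vt e)) e (1 - t))" if "0 < t" "t < 1" for e c t
    using that by (cases c) (simp_all add: epath_inner)
  have eq: "e = e'" using assms(3) unfolding d I[OF assms(4,5)] I[OF assms(6,7)] by (auto split: if_splits)
  show ?thesis
  proof (cases "c = c'")
    case False
    then have "src \<Gamma> e = tgt \<Gamma> e" using assms(1,2) d eq by (cases c; cases c') (auto simp: darts_iff)
    then have "e = E1 \<or> e = E2" by (cases \<Gamma>; cases e) auto
    moreover have "nf a = [(GX, True)]" "nf b = [(GY, True)]" by (rule nf_eq; simp)+
    then have "a \<noteq> \<one>" "b \<noteq> \<one>" by (metis nf_one list.distinct(1))+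
    ultimately have "vt e \<noteq> \<one>" by auto
    then have ne: "inv (vt e) \<noteq> \<one>" by (metis inv_one inv_inv vt_closed)
    then show ?thesis using assms(3) False ne[symmetric] unfolding d I[OF assms(4,5)] I[OF assms(6,7)] by (auto split: if_splits)
  qed (use d eq in simp)
qed

end

section \<open>Vertex placements and straight maps\<close>

locale carrier_ctx = free2 + SL2_rep +
  fixes h :: "'a \<Rightarrow> 'a"
  assumes h: "h \<in> auto G"
begin

definition act :: "'a \<Rightarrow> point3 \<Rightarrow> point3" where
  "act g = SL2C_act (\<rho> (h g))"

lemma rho_h_det [simp]: "g \<in> carrier G \<Longrightarrow> det (\<rho> (h g)) = 1"
  using auto_closed[OF h] by simp

lemma act_closed [simp, intro]: "\<lbrakk>g \<in> carrier G; x \<in> H3\<rbrakk> \<Longrightarrow> act g x \<in> H3"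
  by (simp add: act_def act_H3)

lemma act_act: "\<lbrakk>g \<in> carrier G; g' \<in> carrier G; x \<in> H3\<rbrakk> \<Longrightarrow> act (g \<otimes> g') x = act g (act g' x)"
  using auto_closed[OF h] by (simp add: act_def auto_mult[OF h] rho_mult act_mult)

lemma act_1 [simp]: "act \<one> x = x"
  by (simp add: act_def auto_one[OF h])

lemma act_inv [simp]: "\<lbrakk>g \<in> carrier G; x \<in> H3\<rbrakk> \<Longrightarrow> act (inv g) (act g x) = x" "\<lbrakk>g \<in> carrier G; x \<in> H3\<rbrakk> \<Longrightarrow> act g (act (inv g) x) = x"
  by (simp_all add: act_act[symmetric])

lemma hdist_act' [simp]: "\<lbrakk>g \<in> carrier G; x \<in> H3; y \<in> H3\<rbrakk> \<Longrightarrow> hdist (act g x) (act g y) = hdist x y"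
  by (simp add: act_def hdist_act)

lemma act_geo': "\<lbrakk>g \<in> carrier G; x \<in> H3; y \<in> H3; 0 \<le> t; t \<le> 1\<rbrakk> \<Longrightarrow> act g (geo x y t) = geo (act g x) (act g y) t"
  by (simp add: act_def act_geo)

lemma act_inject: "\<lbrakk>g \<in> carrier G; x \<in> H3; y \<in> H3; act g x = act g y\<rbrakk> \<Longrightarrow> x = y"
  by (metis act_inv(1))

text \<open>The position of the far end of the dart, for the lift starting at the vertex of index
  \<open>\<one>\<close>.\<close>

fun dend :: "two_graph \<Rightarrow> (vertex \<Rightarrow> point3) \<Rightarrow> edge \<times> bool \<Rightarrow> point3" where
  "dend \<Gamma> pos (e, True) = act (vt e) (pos (tgt \<Gamma> e))"
| "dend \<Gamma> pos (e, False) = act (inv (vt e)) (pos (src \<Gamma> e))"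

text \<open>What local injectivity of the straight map amounts to: no edge is a point and no two
  darts leave a vertex in the same direction. These are finitely many conditions on
  distances.\<close>

definition nondeg :: "two_graph \<Rightarrow> (vertex \<Rightarrow> point3) \<Rightarrow> bool" where
  "nondeg \<Gamma> pos \<longleftrightarrow> range pos \<subseteq> H3 \<and> (\<forall>v. \<forall>d\<in>darts \<Gamma> v. dend \<Gamma> pos d \<noteq> pos v \<and>
     (\<forall>d'\<in>darts \<Gamma> v. d \<noteq> d' \<longrightarrow> \<not> same_ray (pos v) (dend \<Gamma> pos d) (dend \<Gamma> pos d')))"

definition elen :: "two_graph \<Rightarrow> (vertex \<Rightarrow> point3) \<Rightarrow> edge \<Rightarrow> real" where
  "elen \<Gamma> pos e = hdist (pos (src \<Gamma> e)) (act (vt e) (pos (tgt \<Gamma> e)))"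

definition total_len :: "two_graph \<Rightarrow> (vertex \<Rightarrow> point3) \<Rightarrow> real" where
  "total_len \<Gamma> pos = (\<Sum>e\<in>{E1, E2, E3}. elen \<Gamma> pos e)"

fun straight :: "two_graph \<Rightarrow> (vertex \<Rightarrow> point3) \<Rightarrow> 'a cover_point \<Rightarrow> point3" where
  "straight \<Gamma> pos (Vert g v) = act g (pos v)"
| "straight \<Gamma> pos (Inner g e t) = act g (geo (pos (src \<Gamma> e)) (act (vt e) (pos (tgt \<Gamma> e))) t)"

context
  fixes \<Gamma> :: two_graph and pos :: "vertex \<Rightarrow> point3"
  assumes pos [simp, intro]: "\<And>v. pos v \<in> H3"
begin

lemma dend_H3 [simp]: "dend \<Gamma> pos d \<in> H3"
  by (cases d; cases "snd d") auto

lemma straight_epath: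
  "\<lbrakk>g \<in> carrier G; 0 \<le> t; t \<le> 1\<rbrakk> \<Longrightarrow>
    straight \<Gamma> pos (epath \<Gamma> g e t) = act g (geo (pos (src \<Gamma> e)) (act (vt e) (pos (tgt \<Gamma> e))) t)"
  by (auto simp: edge_path_def act_act)

lemma straight_H3: "x \<in> cover_points G \<Longrightarrow> straight \<Gamma> pos x \<in> H3"
  by (auto simp: cover_points_def)

lemma straight_dpath:
  assumes "g \<in> carrier G" "0 \<le> t" "t \<le> 1" "d \<in> darts \<Gamma> v"
  shows "straight \<Gamma> pos (dpath \<Gamma> g d t) = act g (geo (pos v) (dend \<Gamma> pos d) t)"
proof -
  obtain e c where d: "d = (e, c)" by (cases d)
  show ?thesis
  proof (cases c)
    case True
    then show ?thesis using assms d by (simp add: straight_epath darts_iff)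
  next
    case False
    let ?x = "pos (src \<Gamma> e)" and ?y = "pos (tgt \<Gamma> e)"
    have "straight \<Gamma> pos (dpath \<Gamma> g d t) = act g (act (inv (vt e)) (geo ?x (act (vt e) ?y) (1 - t)))"
      using assms d False by (simp add: straight_epath act_act)
    also have "\<dots> = act g (geo (act (inv (vt e)) ?x) ?y (1 - t))"
      using assms by (simp add: act_geo')
    also have "\<dots> = act g (geo ?y (act (inv (vt e)) ?x) t)"
      using assms by (simp add: geo_reverse)
    finally show ?thesis using assms d False by (simp add: darts_iff)
  qed
qed

lemma continuous_on_straight_epath:
  assumes "g \<in> carrier G" shows "continuous_on {0..1} (\<lambda>t. straight \<Gamma> pos (epath \<Gamma> g e t))"
proof -
  have "continuous_on {0..1} (\<lambda>t. act g (geo (pos (src \<Gamma> e)) (act (vt e) (pos (tgt \<Gamma> e))) t))"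
    unfolding act_def[of g]
    by (rule continuous_on_compose2[OF continuous_on_act[of "\<rho> (h g)"] continuous_on_geo]) (use assms in auto)
  then show ?thesis
    by (rule continuous_on_eq) (use assms in \<open>simp add: straight_epath\<close>)
qed

lemma continuous_map_straight: "continuous_map (cover \<Gamma>) euclidean (straight \<Gamma> pos)"
  by (rule continuous_map_cover_euclidean) (rule continuous_on_straight_epath)

text \<open>Points with equal image are equally far from the centre. On one dart this fixes the
  parameter; on two darts a common point off the centre would put both on the same ray.\<close>

lemma inj_on_straight_cstar:
  assumes nd: "nondeg \<Gamma> pos" and g: "g \<in> carrier G" shows "inj_on (straight \<Gamma> pos) (cstar \<Gamma> g v)"
proof (rule inj_onI)
  fix x y assume "x \<in> cstar \<Gamma> g v" "y \<in> cstar \<Gamma> g v" and eq: "straight \<Gamma> pos x = straight \<Gamma> pos y"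
  then obtain d t d' t' where x: "x = dpath \<Gamma> g d t" "d \<in> darts \<Gamma> v" "0 \<le> t" "t \<le> 1"
    and y: "y = dpath \<Gamma> g d' t'" "d' \<in> darts \<Gamma> v" "0 \<le> t'" "t' \<le> 1"
    unfolding cstar_def by auto
  let ?P = "pos v" and ?e = "dend \<Gamma> pos d" and ?e' = "dend \<Gamma> pos d'"
  have e: "geo ?P ?e t = geo ?P ?e' t'"
    by (rule act_inject[OF g]) (use eq x y g in \<open>simp_all add: straight_dpath\<close>)
  have ne: "?e \<noteq> ?P" "?e' \<noteq> ?P" using nd x y by (auto simp: nondeg_def)
  then have pos_len: "0 < hdist ?P ?e" "0 < hdist ?P ?e'" using hdist_pos[of ?P] by (metis dend_H3 pos)+
  have len: "t * hdist ?P ?e = t' * hdist ?P ?e'"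
    using arg_cong[OF e, of "hdist ?P"] x y by (simp add: hdist_geo)
  show "x = y"
  proof (cases "d = d'")
    case True
    then show ?thesis using len pos_len x y by simp
  next
    case False
    have "t = 0"
    proof (rule ccontr)
      assume "t \<noteq> 0"
      then have "geo ?P ?e t \<noteq> ?P" using hdist_geo[of ?P ?e t] pos_len x by auto
      moreover have "same_ray ?P ?e (geo ?P ?e t)" "same_ray ?P (geo ?P ?e t) ?e'"
        using same_ray_geo[of ?P ?e 1 t] same_ray_geo[of ?P ?e' t' 1] x y by (simp_all add: e)
      ultimately have "same_ray ?P ?e ?e'" using same_ray_trans[of ?P ?e "geo ?P ?e t" ?e'] by simp
      then show False using nd x y False by (auto simp: nondeg_def)
    qed
    then have "t' = 0" using len pos_len by simp
    then show ?thesis using \<open>t = 0\<close> x y g by (simp add: dpath_0)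
  qed
qed

text \<open>A continuous injection from the compact closed star into a Hausdorff space is a
  homeomorphism onto its image; restriction to the open star gives the neighbourhood.\<close>

lemma locally_homeo_straight:
  assumes nd: "nondeg \<Gamma> pos" shows "locally_homeo_onto_image (cover \<Gamma>) (straight \<Gamma> pos)"
  unfolding locally_homeo_onto_image_def
proof
  fix x assume "x \<in> topspace (cover \<Gamma>)"
  then have "x \<in> cover_points G" by simp
  then obtain g v where g: "g \<in> carrier G" "x \<in> star \<Gamma> g v" by (rule in_some_star)
  let ?K = "cstar \<Gamma> g v" and ?U = "star \<Gamma> g v" and ?f = "straight \<Gamma> pos"
  have K: "?K \<subseteq> topspace (cover \<Gamma>)" by (rule compactin_subset_topspace[OF compactin_cstar[OF g(1)]])
  have tK: "topspace (subtopology (cover \<Gamma>) ?K) = ?K" using K by auto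
  have "homeomorphic_map (subtopology (cover \<Gamma>) ?K) (top_of_set (?f ` ?K)) ?f"
  proof (rule continuous_imp_homeomorphic_map)
    show "continuous_map (subtopology (cover \<Gamma>) ?K) (top_of_set (?f ` ?K)) ?f"
      using continuous_map_straight K by (auto simp: continuous_map_in_subtopology continuous_map_from_subtopology)
    show "compact_space (subtopology (cover \<Gamma>) ?K)"
      by (rule compact_space_subtopology[OF compactin_cstar[OF g(1)]])
    show "inj_on ?f (topspace (subtopology (cover \<Gamma>) ?K))"
      unfolding tK by (rule inj_on_straight_cstar[OF nd g(1)])
    show "Hausdorff_space (top_of_set (?f ` ?K))" by (simp add: Hausdorff_space_subtopology)
  qed (use K in \<open>simp add: Int_absorb1\<close>)
  then have "homeomorphic_map (subtopology (subtopology (cover \<Gamma>) ?K) ?U) (subtopology (top_of_set (?f ` ?K)) (?f ` ?U)) ?f"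
    by (rule homeomorphic_map_subtopologies_alt)
      (use inj_on_straight_cstar[OF nd g(1), of v] star_subset_cstar[of \<Gamma> g v] in \<open>auto simp: tK dest: inj_onD\<close>)
  then have "homeomorphic_map (subtopology (cover \<Gamma>) ?U) (top_of_set (?f ` ?U)) ?f"
    using star_subset_cstar[of \<Gamma> g v]
    by (simp add: subtopology_subtopology Int_absorb1 image_mono)
  then show "\<exists>U. openin (cover \<Gamma>) U \<and> x \<in> U \<and> homeomorphic_map (subtopology (cover \<Gamma>) U) (top_of_set (?f ` U)) ?f"
    using openin_star[OF g(1)] g(2) by blast
qed

lemma straight_deck:
  assumes "W \<in> carrier G" "x \<in> cover_points G"
  shows "straight \<Gamma> pos (deck G W x) = act W (straight \<Gamma> pos x)"
  using assms by (auto simp: cover_points_def act_act)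

lemma straight_marked:
  assumes "nondeg \<Gamma> pos" "free_basis G (h a) (h b)"
  shows "Marked \<Gamma> (straight \<Gamma> pos) h \<in> marked_carriers G a b \<rho>"
  using assms locally_homeo_straight straight_H3 h straight_deck
  by (auto simp: marked_carriers_def equivariant_via_def act_def)

end

end

section \<open>Lengths and geodesic carrier graphs\<close>

text \<open>The Lipschitz bounds telescope over any subdivision.\<close>

lemma curve_length_le:
  assumes "0 \<le> K" and d: "\<And>u v. \<lbrakk>0 \<le> u; u \<le> v; v \<le> 1\<rbrakk> \<Longrightarrow> d (\<gamma> u) (\<gamma> v) \<le> ennreal (K * (v - u))"
  shows "curve_length d \<gamma> \<le> ennreal K"
  unfolding curve_length_def
proof (rule SUP_least)
  fix ts :: "real list" assume "ts \<in> {ts. sorted ts \<and> set ts \<subseteq> {0..1}}"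
  then have ts: "sorted ts" "set ts \<subseteq> {0..1}" by auto
  show "(\<Sum>i<length ts - 1. d (\<gamma> (ts ! i)) (\<gamma> (ts ! Suc i))) \<le> ennreal K"
  proof (cases "ts = []")
    case False
    define n where "n = length ts - 1"
    have rng: "0 \<le> ts ! i \<and> ts ! i \<le> 1" if "i \<le> n" for i
    proof -
      have "i < length ts" using that False unfolding n_def by (cases ts) auto
      then have "ts ! i \<in> {0..1}" using ts(2) nth_mem by blast
      then show ?thesis by simp
    qed
    have mono: "ts ! i \<le> ts ! Suc i" if "i < n" for i
      using sorted_nth_mono[OF ts(1), of i "Suc i"] that by (auto simp: n_def)
    have "(\<Sum>i<n. d (\<gamma> (ts ! i)) (\<gamma> (ts ! Suc i))) \<le> (\<Sum>i<n. ennreal (K * (ts ! Suc i - ts ! i)))"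
      by (intro sum_mono d) (use rng mono in auto)
    also have "\<dots> = ennreal (\<Sum>i<n. K * (ts ! Suc i - ts ! i))"
      using mono \<open>0 \<le> K\<close> by (intro sum_ennreal) auto
    also have "(\<Sum>i<n. K * (ts ! Suc i - ts ! i)) = K * (ts ! n - ts ! 0)"
      by (simp add: sum_distrib_left[symmetric] sum_lessThan_telescope)
    also have "ennreal \<dots> \<le> ennreal K"
      using rng[of n] rng[of 0] \<open>0 \<le> K\<close> by (intro ennreal_leI mult_left_le) auto
    finally show ?thesis by (simp add: n_def)
  qed simp
qed

lemma curve_length_ge: "d (\<gamma> 0) (\<gamma> 1) \<le> curve_length d \<gamma>"
  unfolding curve_length_def by (rule SUP_upper2[of "[0, 1]"]) auto

lemma intrinsic_dist_ge: "ennreal (hdist p q) \<le> intrinsic_dist S p q"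
  unfolding intrinsic_dist_def
proof (rule INF_greatest)
  fix \<gamma> assume "\<gamma> \<in> {\<gamma>. path \<gamma> \<and> path_image \<gamma> \<subseteq> S \<and> pathstart \<gamma> = p \<and> pathfinish \<gamma> = q}"
  then show "ennreal (hdist p q) \<le> curve_length (\<lambda>x y. ennreal (hdist x y)) \<gamma>"
    using curve_length_ge[of "\<lambda>x y. ennreal (hdist x y)" \<gamma>] by (auto simp: pathstart_def pathfinish_def)
qed

section \<open>Locally injective functions on an interval\<close>

lemma local_extremum_not_locally_injective:
  fixes f :: "real \<Rightarrow> real"
  assumes "s < m" "m < t" "continuous_on {s..t} f" "(\<forall>x\<in>{s..t}. f x \<le> f m) \<or> (\<forall>x\<in>{s..t}. f m \<le> f x)"
    and "0 < e" "inj_on f ({s..t} \<inter> ball m e)"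
  shows False
proof -
  define d where "d = min (e / 2) (min (m - s) (t - m))"
  have d: "0 < d" "d < e" "s \<le> m - d" "m + d \<le> t" using assms by (auto simp: d_def min_def)
  have "{m - d..m + d} \<subseteq> {s..t} \<inter> ball m e" using d by (auto simp: dist_real_def)
  then have "continuous_on {m - d..m + d} f" "inj_on f {m - d..m + d}"
    using assms(3,6) by (auto intro: continuous_on_subset inj_on_subset)
  from continuous_inj_imp_mono[OF _ _ this, of m]
  have "(f (m - d) < f m \<and> f m < f (m + d)) \<or> (f (m + d) < f m \<and> f m < f (m - d))" using d by simp
  moreover have "m - d \<in> {s..t}" "m + d \<in> {s..t}" using d by auto
  ultimately show False using assms(4) by force
qed

text \<open>Between two equal values there is an interior extremum, also when the function is
  constant there, and near such a point local injectivity would make the function strictly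
  monotone.\<close>

lemma locally_injective_imp_injective:
  fixes f :: "real \<Rightarrow> real"
  assumes cont: "continuous_on {a..b} f"
    and loc: "\<And>m. m \<in> {a..b} \<Longrightarrow> \<exists>e>0. inj_on f ({a..b} \<inter> ball m e)"
  shows "inj_on f {a..b}"
proof (rule linorder_inj_onI')
  fix s t assume st: "s \<in> {a..b}" "t \<in> {a..b}" "s < t"
  show "f s \<noteq> f t"
  proof
    assume eq: "f s = f t"
    have sub: "{s..t} \<subseteq> {a..b}" using st by auto
    have c: "continuous_on {s..t} f" using cont sub by (rule continuous_on_subset)
    have "{s..t} \<noteq> {}" using st by simp
    note attains = continuous_attains_sup[OF compact_Icc this c] continuous_attains_inf[OF compact_Icc this c]
    obtain M where M: "M \<in> {s..t}" "\<forall>x\<in>{s..t}. f x \<le> f M"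
      using attains(1) by blast
    obtain m where m: "m \<in> {s..t}" "\<forall>x\<in>{s..t}. f m \<le> f x"
      using attains(2) by blast
    have "\<exists>k. s < k \<and> k < t \<and> ((\<forall>x\<in>{s..t}. f x \<le> f k) \<or> (\<forall>x\<in>{s..t}. f k \<le> f x))"
    proof (cases "s < M \<and> M < t \<or> s < m \<and> m < t")
      case True
      then show ?thesis using M m by blast
    next
      case False
      then have "f M = f s" "f m = f s" using M(1) m(1) eq by (metis atLeastAtMost_iff order_le_less)+
      then have const: "f x = f s" if "x \<in> {s..t}" for x using M m that by (metis order_antisym)
      have mid: "s < (s + t) / 2" "(s + t) / 2 < t" using st by simp_all
      then have "(s + t) / 2 \<in> {s..t}" by simp
      from const[OF this] show ?thesis
        by (intro exI[of _ "(s + t) / 2"] conjI mid disjI1 ballI) (metis const order_refl)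
    qed
    then obtain k where k: "s < k" "k < t" "(\<forall>x\<in>{s..t}. f x \<le> f k) \<or> (\<forall>x\<in>{s..t}. f k \<le> f x)" by blast
    then have "k \<in> {a..b}" using st by auto
    then obtain e where e: "e > 0" "inj_on f ({a..b} \<inter> ball k e)" using loc by blast
    then have "inj_on f ({s..t} \<inter> ball k e)" using sub by (auto elim!: inj_on_subset)
    then show False using local_extremum_not_locally_injective[OF k(1,2) c k(3) e(1)] by blast
  qed
qed

text \<open>Being geodesic concerns only the image set, so an edge might run back and forth. Local
  injectivity excludes this and forces the ends of the edge to be the ends of the segment.\<close>

lemma geodesic_segment_endpoints:
  fixes c :: "real \<Rightarrow> point3"
  assumes seg: "geodesic_segment (c ` {0..1})" and cont: "continuous_on {0..1} c"
    and loc: "\<And>m. m \<in> {0..1} \<Longrightarrow> \<exists>e>0. inj_on c ({0..1} \<inter> ball m e)"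
  shows "c 0 \<noteq> c 1" "c ` {0..1} = geo (c 0) (c 1) ` {0..1}"
proof -
  obtain l \<gamma> where l: "l > 0" "\<gamma> ` {0..l} = c ` {0..1}" "c ` {0..1} \<subseteq> H3"
    and iso: "\<And>s t. \<lbrakk>s \<in> {0..l}; t \<in> {0..l}\<rbrakk> \<Longrightarrow> hdist (\<gamma> s) (\<gamma> t) = \<bar>s - t\<bar>"
    using seg unfolding geodesic_segment_def by metis
  have gH [simp]: "\<gamma> s \<in> H3" if "0 \<le> s" "s \<le> l" for s
    using l(2,3) that by (metis atLeastAtMost_iff image_eqI subsetD)
  \<comment> \<open>Arc length from one end of the segment. It turns the curve into a locally
    injective real function, hence an injective one, which takes its extreme values only at 0 and
    1.\<close>
  define \<sigma> where "\<sigma> t = hdist (\<gamma> 0) (c t)" for t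
  have \<sigma>: "\<sigma> t \<in> {0..l} \<and> \<gamma> (\<sigma> t) = c t" if "t \<in> {0..1}" for t
  proof -
    have "c t \<in> \<gamma> ` {0..l}" using that l(2) by auto
    then obtain s where s: "s \<in> {0..l}" "c t = \<gamma> s" by auto
    then have "\<sigma> t = s" using iso[of 0 s] l by (simp add: \<sigma>_def)
    then show ?thesis using s by simp
  qed
  have "continuous_on {0..1} \<sigma>"
    unfolding \<sigma>_def[abs_def] by (rule continuous_on_hdist[OF _ cont]) (use l in auto)
  moreover have "\<exists>e>0. inj_on \<sigma> ({0..1} \<inter> ball m e)" if m: "m \<in> {0..1}" for m
  proof -
    obtain e where e: "e > 0" "inj_on c ({0..1} \<inter> ball m e)" using loc[OF m] by blast
    then have "inj_on \<sigma> ({0..1} \<inter> ball m e)"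
      by (intro inj_onI) (metis \<sigma> IntE inj_onD)
    then show ?thesis using e by blast
  qed
  ultimately have inj: "inj_on \<sigma> {0..1}" and cs: "continuous_on {0..1} \<sigma>"
    using locally_injective_imp_injective by blast+
  have ends: "x = 0 \<or> x = 1" if "x \<in> {0..1}" "\<sigma> x = 0 \<or> \<sigma> x = l" for x
  proof (rule ccontr)
    assume "\<not> (x = 0 \<or> x = 1)"
    then have "0 < x" "x < 1" using that by auto
    from continuous_inj_imp_mono[OF this cs inj] show False
      using \<sigma>[of 0] \<sigma>[of 1] that(2) by auto
  qed
  have hit: "\<exists>x\<in>{0..1}. \<sigma> x = s" if s: "s \<in> {0..l}" for s
  proof -
    have "\<gamma> s \<in> c ` {0..1}" using s l(2) by auto
    then obtain x where "x \<in> {0..1}" "c x = \<gamma> s" by auto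
    then show ?thesis using iso[of 0 s] s l by (auto simp: \<sigma>_def intro!: bexI[of _ x])
  qed
  obtain x0 where x0: "x0 \<in> {0..1}" "\<sigma> x0 = 0" using hit[of 0] l by auto
  obtain x1 where x1: "x1 \<in> {0..1}" "\<sigma> x1 = l" using hit[of l] l by auto
  have "(\<sigma> 0 = 0 \<and> \<sigma> 1 = l) \<or> (\<sigma> 0 = l \<and> \<sigma> 1 = 0)"
    using ends[of x0] ends[of x1] x0 x1 l by auto
  then have ce: "(c 0 = \<gamma> 0 \<and> c 1 = \<gamma> l) \<or> (c 0 = \<gamma> l \<and> c 1 = \<gamma> 0)"
    using \<sigma>[of 0] \<sigma>[of 1] by auto
  have len: "hdist (\<gamma> 0) (\<gamma> l) = l" using iso[of 0 l] l by simp
  then have "\<gamma> 0 \<noteq> \<gamma> l" using l by auto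
  then show "c 0 \<noteq> c 1" using ce by auto
  have g: "\<gamma> s = geo (\<gamma> 0) (\<gamma> l) (s / l)" if "s \<in> {0..l}" for s
  proof (rule geo_unique)
    show "hdist (\<gamma> 0) (\<gamma> s) = s / l * hdist (\<gamma> 0) (\<gamma> l)" using len iso[of 0 s] that l by simp
    have "hdist (\<gamma> s) (\<gamma> l) = l - s" using iso[of s l] that by simp
    also have "\<dots> = (1 - s / l) * l" using l by (simp add: left_diff_distrib)
    finally show "hdist (\<gamma> s) (\<gamma> l) = (1 - s / l) * hdist (\<gamma> 0) (\<gamma> l)" unfolding len .
  qed (use that l in auto)
  have "\<gamma> ` {0..l} = geo (\<gamma> 0) (\<gamma> l) ` {0..1}"
  proof
    show "\<gamma> ` {0..l} \<subseteq> geo (\<gamma> 0) (\<gamma> l) ` {0..1}"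
    proof
      fix y assume "y \<in> \<gamma> ` {0..l}"
      then obtain s where s: "s \<in> {0..l}" "y = \<gamma> s" by auto
      then have "s / l \<in> {0..1}" using l by simp
      then show "y \<in> geo (\<gamma> 0) (\<gamma> l) ` {0..1}" using g[OF s(1)] s(2) by blast
    qed
    show "geo (\<gamma> 0) (\<gamma> l) ` {0..1} \<subseteq> \<gamma> ` {0..l}"
    proof
      fix y assume "y \<in> geo (\<gamma> 0) (\<gamma> l) ` {0..1}"
      then obtain t where t: "t \<in> {0..1}" "y = geo (\<gamma> 0) (\<gamma> l) t" by auto
      then have "t * l \<in> {0..l}" using l by (simp add: mult_left_le_one_le)
      moreover from g[OF this] have "y = \<gamma> (t * l)" using t(2) l by simp
      ultimately show "y \<in> \<gamma> ` {0..l}" by blast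
    qed
  qed
  moreover have "geo (\<gamma> l) (\<gamma> 0) ` {0..1} = geo (\<gamma> 0) (\<gamma> l) ` {0..1}"
  proof -
    have "geo (\<gamma> l) (\<gamma> 0) ` {0..1} = geo (\<gamma> l) (\<gamma> 0) ` ((\<lambda>t. 1 - t) ` {0..1})"
      by simp
    also have "\<dots> = geo (\<gamma> 0) (\<gamma> l) ` {0..1}"
      unfolding image_image by (intro image_cong) (use l in \<open>auto simp: geo_reverse\<close>)
    finally show ?thesis .
  qed
  ultimately show "c ` {0..1} = geo (c 0) (c 1) ` {0..1}" using ce l(2) by auto
qed

context carrier_ctx
begin

text \<open>An upper bound is enough: the path along the edge itself is admissible in the definition
  of the intrinsic distance.\<close>

lemma carrier_length_straight:
  fixes \<Gamma> :: two_graph and pos :: "vertex \<Rightarrow> point3"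
  assumes pos [simp]: "\<And>v. pos v \<in> H3"
  shows "carrier_length G a b (Marked \<Gamma> (straight \<Gamma> pos) h) \<le> ennreal (total_len \<Gamma> pos)"
proof -
  let ?\<Psi> = "straight \<Gamma> pos"
  let ?S = "?\<Psi> ` cover_points G"
  have nonneg: "0 \<le> elen \<Gamma> pos e" for e by (simp add: elen_def hdist_nonneg)
  have "curve_length (\<lambda>x y. intrinsic_dist ?S (?\<Psi> x) (?\<Psi> y)) (epath \<Gamma> \<one> e) \<le> ennreal (elen \<Gamma> pos e)" for e
  proof (rule curve_length_le[OF nonneg])
    fix u v :: real assume uv: "0 \<le> u" "u \<le> v" "v \<le> 1"
    define \<gamma> where "\<gamma> s = ?\<Psi> (epath \<Gamma> \<one> e (u + s * (v - u)))" for s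
    have rng: "0 \<le> u + s * (v - u) \<and> u + s * (v - u) \<le> 1" if "0 \<le> s" "s \<le> 1" for s
    proof -
      have "s * (v - u) \<le> 1 * (v - u)" using that uv by (intro mult_right_mono) auto
      then show ?thesis using that uv by simp
    qed
    have "intrinsic_dist ?S (\<gamma> 0) (\<gamma> 1) \<le> curve_length (\<lambda>x y. ennreal (hdist x y)) \<gamma>"
      unfolding intrinsic_dist_def
    proof (rule INF_lower, intro CollectI conjI)
      show "path \<gamma>" unfolding path_def \<gamma>_def
        by (rule continuous_on_compose2[OF continuous_on_straight_epath[of pos \<one> \<Gamma> e]])
          (use rng in \<open>auto intro!: continuous_intros\<close>)
      show "path_image \<gamma> \<subseteq> ?S"
        by (auto simp: path_image_def \<gamma>_def intro!: imageI epath_in_cover)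
    qed (simp_all add: pathstart_def pathfinish_def)
    also have "\<dots> \<le> ennreal (elen \<Gamma> pos e * (v - u))"
    proof (rule curve_length_le)
      show "0 \<le> elen \<Gamma> pos e * (v - u)" using nonneg uv by simp
      fix s t :: real assume st: "0 \<le> s" "s \<le> t" "t \<le> 1"
      have "hdist (\<gamma> s) (\<gamma> t) = \<bar>(u + s * (v - u)) - (u + t * (v - u))\<bar> * elen \<Gamma> pos e"
        using rng[of s] rng[of t] st by (simp add: \<gamma>_def straight_epath hdist_geo_geo elen_def)
      also have "(u + s * (v - u)) - (u + t * (v - u)) = - ((v - u) * (t - s))" by (simp add: algebra_simps)
      also have "\<bar>- ((v - u) * (t - s))\<bar> * elen \<Gamma> pos e = elen \<Gamma> pos e * (v - u) * (t - s)" using uv st by simp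
      finally show "ennreal (hdist (\<gamma> s) (\<gamma> t)) \<le> ennreal (elen \<Gamma> pos e * (v - u) * (t - s))" by simp
    qed
    finally show "intrinsic_dist ?S (?\<Psi> (epath \<Gamma> \<one> e u)) (?\<Psi> (epath \<Gamma> \<one> e v)) \<le> ennreal (elen \<Gamma> pos e * (v - u))"
      by (simp add: \<gamma>_def)
  qed
  then have "carrier_length G a b (Marked \<Gamma> ?\<Psi> h) \<le> (\<Sum>e\<in>{E1, E2, E3}. ennreal (elen \<Gamma> pos e))"
    unfolding carrier_length_def by (intro sum_mono) simp
  also have "\<dots> = ennreal (total_len \<Gamma> pos)"
    unfolding total_len_def using nonneg by (intro sum_ennreal) auto
  finally show ?thesis .
qed

context
  fixes \<Gamma> :: two_graph and \<Psi> :: "'a cover_point \<Rightarrow> point3" and pos :: "vertex \<Rightarrow> point3"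
  assumes M: "Marked \<Gamma> \<Psi> h \<in> marked_carriers G a b \<rho>" and geodesic: "is_geodesic G a b (Marked \<Gamma> \<Psi> h)"
  defines "pos \<equiv> \<lambda>v. \<Psi> (Vert \<one> v)"
begin

lemma Psi_H3: "x \<in> cover_points G \<Longrightarrow> \<Psi> x \<in> H3"
  using M by (auto simp: marked_carriers_def)

lemma pos_H3 [simp]: "pos v \<in> H3"
  unfolding pos_def by (rule Psi_H3) (auto simp: cover_points_def)

lemma Psi_deck: "\<lbrakk>W \<in> carrier G; x \<in> cover_points G\<rbrakk> \<Longrightarrow> \<Psi> (deck G W x) = act W (\<Psi> x)"
  using M by (auto simp: marked_carriers_def equivariant_via_def act_def)

lemma Psi_Vert: "g \<in> carrier G \<Longrightarrow> \<Psi> (Vert g v) = act g (pos v)"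
  using Psi_deck[of g "Vert \<one> v"] by (simp add: pos_def cover_points_def)

lemma Psi_local:
  assumes "x \<in> cover_points G"
  obtains U where "openin (cover \<Gamma>) U" "x \<in> U" "homeomorphic_map (subtopology (cover \<Gamma>) U) (top_of_set (\<Psi> ` U)) \<Psi>"
  using M assms by (auto simp: marked_carriers_def locally_homeo_onto_image_def)

lemma Psi_local_inj:
  assumes "x \<in> cover_points G"
  obtains U where "openin (cover \<Gamma>) U" "x \<in> U" "inj_on \<Psi> U"
proof -
  obtain U where U: "openin (cover \<Gamma>) U" "x \<in> U" "homeomorphic_map (subtopology (cover \<Gamma>) U) (top_of_set (\<Psi> ` U)) \<Psi>"
    using Psi_local[OF assms] .
  have "topspace (subtopology (cover \<Gamma>) U) = U" using openin_subset[OF U(1)] by auto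
  then have "inj_on \<Psi> U" using homeomorphic_imp_injective_map[OF U(3)] by simp
  then show ?thesis using that U by blast
qed

lemma Psi_continuous: "continuous_map (cover \<Gamma>) euclidean \<Psi>"
proof (rule pasting_lemma[where I = "{U. openin (cover \<Gamma>) U \<and> continuous_map (subtopology (cover \<Gamma>) U) euclidean \<Psi>}"
      and T = "\<lambda>U. U" and f = "\<lambda>_. \<Psi>"])
  fix x assume "x \<in> topspace (cover \<Gamma>)"
  then have "x \<in> cover_points G" by simp
  then obtain U where U: "openin (cover \<Gamma>) U" "x \<in> U" "homeomorphic_map (subtopology (cover \<Gamma>) U) (top_of_set (\<Psi> ` U)) \<Psi>"
    by (rule Psi_local)
  have "continuous_map (subtopology (cover \<Gamma>) U) euclidean \<Psi>"
    using homeomorphic_imp_continuous_map[OF U(3)] by (simp add: continuous_map_in_subtopology)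
  then show "\<exists>j. j \<in> {U. openin (cover \<Gamma>) U \<and> continuous_map (subtopology (cover \<Gamma>) U) euclidean \<Psi>} \<and> x \<in> j \<and> \<Psi> x = \<Psi> x"
    using U by blast
qed auto

lemma Psi_dpath_continuous:
  assumes "g \<in> carrier G" shows "continuous_on {0..1} (\<lambda>t. \<Psi> (dpath \<Gamma> g d t))"
  using continuous_map_compose[OF continuous_map_dpath[OF assms] Psi_continuous] by (simp add: comp_def)

lemma dpath_preimage_open:
  assumes "g \<in> carrier G" "openin (cover \<Gamma>) U" "dpath \<Gamma> g d m \<in> U" "m \<in> {0..1}"
  obtains e where "e > 0" "\<And>t. \<lbrakk>t \<in> {0..1}; \<bar>t - m\<bar> < e\<rbrakk> \<Longrightarrow> dpath \<Gamma> g d t \<in> U"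
proof -
  have "openin (top_of_set {0..1}) {t \<in> {0..1}. dpath \<Gamma> g d t \<in> U}"
    using openin_continuous_map_preimage[OF continuous_map_dpath[OF assms(1)] assms(2)] by simp
  then obtain e where "e > 0" "ball m e \<inter> {0..1} \<subseteq> {t \<in> {0..1}. dpath \<Gamma> g d t \<in> U}"
    using assms(3,4) unfolding openin_contains_ball by blast
  then show ?thesis by (intro that[of e]) (auto simp: dist_real_def subset_iff abs_minus_commute)
qed

lemma Psi_epath:
  assumes g: "g \<in> carrier G"
  shows "\<Psi> (epath \<Gamma> g e 0) \<noteq> \<Psi> (epath \<Gamma> g e 1)"
    "\<Psi> ` epath \<Gamma> g e ` {0..1} = geo (\<Psi> (epath \<Gamma> g e 0)) (\<Psi> (epath \<Gamma> g e 1)) ` {0..1}"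
proof -
  define c where "c t = \<Psi> (epath \<Gamma> g e t)" for t
  have img: "\<Psi> ` epath \<Gamma> g e ` {0..1} = c ` {0..1}" by (simp add: c_def image_image)
  have seg: "geodesic_segment (c ` {0..1})"
    using geodesic g unfolding is_geodesic_def img[symmetric] by simp
  have cont: "continuous_on {0..1} c" unfolding c_def using Psi_dpath_continuous[OF g, of "(e, True)"] by simp
  have loc: "\<exists>d>0. inj_on c ({0..1} \<inter> ball m d)" if m: "m \<in> {0..1}" for m
  proof -
    obtain U where U: "openin (cover \<Gamma>) U" "epath \<Gamma> g e m \<in> U" "inj_on \<Psi> U"
      using Psi_local_inj[OF epath_in_cover[OF g]] .
    obtain d where d: "d > 0" "\<And>t. \<lbrakk>t \<in> {0..1}; \<bar>t - m\<bar> < d\<rbrakk> \<Longrightarrow> dpath \<Gamma> g (e, True) t \<in> U"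
      using dpath_preimage_open[OF g U(1), of "(e, True)" m] U(2) m by auto
    \<comment> \<open>A radius of at most 1/2 keeps 0 and 1 out of the same ball, so the two ends of
      the edge need not be compared.\<close>
    have inj: "inj_on (epath \<Gamma> g e) ({0..1} \<inter> ball m (min d (1 / 2)))"
      by (rule inj_onI) (auto simp: edge_path_def dist_real_def split: if_splits)
    have sub: "epath \<Gamma> g e ` ({0..1} \<inter> ball m (min d (1 / 2))) \<subseteq> U"
      using d(2) by (auto simp: dist_real_def abs_minus_commute)
    have "inj_on (\<Psi> \<circ> epath \<Gamma> g e) ({0..1} \<inter> ball m (min d (1 / 2)))"
      by (rule comp_inj_on[OF inj]) (rule inj_on_subset[OF U(3) sub])
    then show ?thesis using d(1) by (intro exI[of _ "min d (1 / 2)"]) (auto simp: comp_def c_def[abs_def])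
  qed
  show "\<Psi> (epath \<Gamma> g e 0) \<noteq> \<Psi> (epath \<Gamma> g e 1)"
    using geodesic_segment_endpoints(1)[OF seg cont loc] by (simp add: c_def)
  show "\<Psi> ` epath \<Gamma> g e ` {0..1} = geo (\<Psi> (epath \<Gamma> g e 0)) (\<Psi> (epath \<Gamma> g e 1)) ` {0..1}"
    using geodesic_segment_endpoints(2)[OF seg cont loc] unfolding img by (simp add: c_def)
qed

lemma Psi_epath_image:
  assumes g: "g \<in> carrier G"
  shows "\<Psi> ` epath \<Gamma> g e ` {0..1} = straight \<Gamma> pos ` epath \<Gamma> g e ` {0..1}"
proof -
  have "\<Psi> ` epath \<Gamma> g e ` {0..1} = geo (act g (pos (src \<Gamma> e))) (act g (act (vt e) (pos (tgt \<Gamma> e)))) ` {0..1}"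
    using Psi_epath(2)[OF g, of e] g by (simp add: Psi_Vert act_act)
  also have "\<dots> = straight \<Gamma> pos ` epath \<Gamma> g e ` {0..1}"
    unfolding image_image by (rule image_cong) (use g in \<open>auto simp: straight_epath act_geo'\<close>)
  finally show ?thesis .
qed

text \<open>The edges of \<open>\<Psi>\<close> may be parametrised differently from the straight
  map. The equivalence of carriers looks only at images, so this equality is all that is
  required.\<close>

lemma Psi_image: "\<Psi> ` cover_points G = straight \<Gamma> pos ` cover_points G"
  unfolding cover_points_eq[of \<Gamma>] image_UN using Psi_epath_image by simp

lemma Psi_dpath_on_segment:
  assumes d: "d \<in> darts \<Gamma> v" and t: "t \<in> {0..1}"
  shows "\<Psi> (dpath \<Gamma> \<one> d t) \<in> geo (pos v) (dend \<Gamma> pos d) ` {0..1}"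
proof -
  have im: "dpath \<Gamma> \<one> (e, c) ` {0..1} = epath \<Gamma> (if c then \<one> else inv (vt e)) e ` {0..1}" for e c
  proof (cases c)
    case False
    have "dpath \<Gamma> \<one> (e, False) ` {0..1} = epath \<Gamma> (inv (vt e)) e ` ((\<lambda>t. 1 - t) ` {0..1})"
      by (simp add: image_image del: image_diff_atLeastAtMost)
    then show ?thesis using False by simp
  qed simp
  obtain e c where ec: "d = (e, c)" by (cases d)
  have "\<Psi> (dpath \<Gamma> \<one> d t) \<in> \<Psi> ` dpath \<Gamma> \<one> d ` {0..1}" using t by blast
  also have "\<dots> = straight \<Gamma> pos ` dpath \<Gamma> \<one> d ` {0..1}"
    unfolding ec im by (rule Psi_epath_image) simp
  also have "\<dots> = geo (pos v) (dend \<Gamma> pos d) ` {0..1}"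
    unfolding image_image by (rule image_cong) (use d in \<open>auto simp: straight_dpath\<close>)
  finally show ?thesis .
qed

lemma dend_ne:
  assumes d: "d \<in> darts \<Gamma> v" shows "dend \<Gamma> pos d \<noteq> pos v"
proof -
  obtain e c where ec: "d = (e, c)" by (cases d)
  have ne: "pos (src \<Gamma> e) \<noteq> act (vt e) (pos (tgt \<Gamma> e))"
    using Psi_epath(1)[of \<one> e] by (simp add: Psi_Vert)
  have "act (inv (vt e)) (pos (src \<Gamma> e)) \<noteq> pos (tgt \<Gamma> e)"
  proof
    assume "act (inv (vt e)) (pos (src \<Gamma> e)) = pos (tgt \<Gamma> e)"
    from arg_cong[OF this, of "act (vt e)"] show False using ne by simp
  qed
  then show ?thesis using ne d ec by (cases c) (auto simp: darts_iff)
qed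

text \<open>If two darts left in the same direction, continuity would take both through the same
  point near the vertex, against local injectivity of \<open>\<Psi>\<close>.\<close>

lemma pos_nondeg: "nondeg \<Gamma> pos"
  unfolding nondeg_def
proof (intro conjI allI ballI impI)
  show "range pos \<subseteq> H3" by auto
  fix v d assume d: "d \<in> darts \<Gamma> v"
  show dne: "dend \<Gamma> pos d \<noteq> pos v" by (rule dend_ne[OF d])
  fix d' assume d': "d' \<in> darts \<Gamma> v" and dd': "d \<noteq> d'"
  show "\<not> same_ray (pos v) (dend \<Gamma> pos d) (dend \<Gamma> pos d')"
  proof
    let ?P = "pos v"
    assume ray: "same_ray ?P (dend \<Gamma> pos d) (dend \<Gamma> pos d')"
    note dne' = dend_ne[OF d']
    obtain U where U: "openin (cover \<Gamma>) U" "Vert \<one> v \<in> U" "inj_on \<Psi> U"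
      using Psi_local_inj[of "Vert \<one> v"] by (auto simp: cover_points_def)
    have near: "\<exists>s. 0 < s \<and> s < 1 \<and> (\<forall>t\<in>{0..s}. dpath \<Gamma> \<one> d t \<in> U)" if "d \<in> darts \<Gamma> v" for d
    proof -
      have d0: "dpath \<Gamma> \<one> d 0 \<in> U" using U(2) that by (simp add: dpath_0)
      obtain e where e: "e > 0" "\<And>t. \<lbrakk>t \<in> {0..1}; \<bar>t - 0\<bar> < e\<rbrakk> \<Longrightarrow> dpath \<Gamma> \<one> d t \<in> U"
        by (rule dpath_preimage_open[OF one_closed U(1) d0]) auto
      then show ?thesis by (intro exI[of _ "min (e / 2) (1 / 2)"]) auto
    qed
    define r where "r d t = hdist ?P (\<Psi> (dpath \<Gamma> \<one> d t))" for d t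
    have dp: "dpath \<Gamma> \<one> d t \<in> cover_points G" for d t by (rule dpath_in_cover) simp
    have r0: "r d 0 = 0" if "d \<in> darts \<Gamma> v" for d
      using that by (simp add: r_def dpath_0 Psi_Vert)
    have rcont: "continuous_on {0..1} (r d)" for d
      unfolding r_def[abs_def]
      by (rule continuous_on_hdist[OF pos_H3 Psi_dpath_continuous[OF one_closed]]) (intro image_subsetI Psi_H3 dp)
    have dinj: "dpath \<Gamma> \<one> d t \<noteq> Vert \<one> v" if "0 < t" "t < 1" for d t
      using that by (cases d; cases "snd d") (auto simp: epath_inner)
    obtain s where s: "0 < s" "s < 1" "\<And>t. t \<in> {0..s} \<Longrightarrow> dpath \<Gamma> \<one> d t \<in> U" using near[OF d] by blast
    obtain s' where s': "0 < s'" "s' < 1" "\<And>t. t \<in> {0..s'} \<Longrightarrow> dpath \<Gamma> \<one> d' t \<in> U" using near[OF d'] by blast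
    have rpos: "0 < r d s" if "0 < s" "s < 1" "dpath \<Gamma> \<one> d s \<in> U" for d s
    proof -
      have "\<Psi> (dpath \<Gamma> \<one> d s) \<noteq> \<Psi> (Vert \<one> v)"
        using U(2,3) that dinj[of s d] by (meson inj_onD)
      then have "?P \<noteq> \<Psi> (dpath \<Gamma> \<one> d s)" by (simp add: Psi_Vert)
      then show ?thesis unfolding r_def by (intro hdist_pos Psi_H3 dp pos_H3)
    qed
    \<comment> \<open>A distance that both darts attain, by the intermediate value theorem, while
      still inside \<open>U\<close>.\<close>
    define m where "m = min (r d s) (r d' s')"
    have m: "0 < m" using rpos[of s d] rpos[of s' d'] s s' by (auto simp: m_def)
    obtain t where t: "0 \<le> t" "t \<le> s" "r d t = m"
      using IVT'[of "r d" 0 m s] r0[OF d] m s continuous_on_subset[OF rcont] by (auto simp: m_def)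
    obtain t' where t': "0 \<le> t'" "t' \<le> s'" "r d' t' = m"
      using IVT'[of "r d'" 0 m s'] r0[OF d'] m s' continuous_on_subset[OF rcont] by (auto simp: m_def)
    have t0: "0 < t" "0 < t'" using t t' m r0[OF d] r0[OF d'] by (auto simp: order_le_less)
    let ?x = "\<Psi> (dpath \<Gamma> \<one> d t)" and ?x' = "\<Psi> (dpath \<Gamma> \<one> d' t')"
    have H: "?x \<in> H3" "?x' \<in> H3" by (rule Psi_H3[OF dp])+
    have onray: "same_ray ?P (\<Psi> (dpath \<Gamma> \<one> d t)) (dend \<Gamma> pos d)" if dd: "d \<in> darts \<Gamma> v" "t \<in> {0..1}" for d t
    proof -
      obtain k where "k \<in> {0..1}" "\<Psi> (dpath \<Gamma> \<one> d t) = geo ?P (dend \<Gamma> pos d) k"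
        using Psi_dpath_on_segment[OF dd] by auto
      then show ?thesis using same_ray_geo[of ?P "dend \<Gamma> pos d" k 1] by simp
    qed
    have "same_ray ?P ?x (dend \<Gamma> pos d')"
      using same_ray_trans[OF _ H(1) _ _ dne onray[OF d] ray] t s by simp
    moreover have "same_ray ?P (dend \<Gamma> pos d') ?x'"
      using onray[OF d', of t'] t' s' by (simp add: same_ray_commute)
    ultimately have "same_ray ?P ?x ?x'"
      using same_ray_trans[OF _ H(1) _ H(2) dne'] by simp
    then have "?x = ?x'" using same_ray_unique[OF H] t t' by (simp add: r_def)
    then have "dpath \<Gamma> \<one> d t = dpath \<Gamma> \<one> d' t'"
      using inj_onD[OF U(3)] s(3)[of t] s'(3)[of t'] t t' by simp
    moreover have "t < 1" "t' < 1" using t t' s s' by linarith+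
    ultimately show False using dpath_inner_inject[OF d d' _ t0(1) _ t0(2)] dd' by blast
  qed
qed

text \<open>No path is shorter than the distance of its ends, so each edge is at least as long as
  the distance between the images of its vertices.\<close>

lemma total_len_le_carrier_length: "ennreal (total_len \<Gamma> pos) \<le> carrier_length G a b (Marked \<Gamma> \<Psi> h)"
proof -
  have "ennreal (total_len \<Gamma> pos) = (\<Sum>e\<in>{E1, E2, E3}. ennreal (elen \<Gamma> pos e))"
    unfolding total_len_def by (intro sum_ennreal[symmetric]) (auto simp: elen_def hdist_nonneg)
  also have "\<dots> \<le> carrier_length G a b (Marked \<Gamma> \<Psi> h)"
    unfolding carrier_length_def
  proof (rule sum_mono)
    fix e
    let ?d = "\<lambda>x y. intrinsic_dist (\<Psi> ` cover_points G) (\<Psi> x) (\<Psi> y)"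
    have "ennreal (elen \<Gamma> pos e) \<le> ?d (epath \<Gamma> \<one> e 0) (epath \<Gamma> \<one> e 1)"
      using intrinsic_dist_ge by (simp add: elen_def Psi_Vert)
    also have "\<dots> \<le> curve_length ?d (epath \<Gamma> \<one> e)" by (rule curve_length_ge)
    finally show "ennreal (elen \<Gamma> pos e) \<le> curve_length
        (\<lambda>x y. intrinsic_dist (map_of (Marked \<Gamma> \<Psi> h) ` cover_points G) (map_of (Marked \<Gamma> \<Psi> h) x) (map_of (Marked \<Gamma> \<Psi> h) y))
        (epath (graph_of (Marked \<Gamma> \<Psi> h)) \<one> e)" by simp
  qed
  finally show ?thesis .
qed

end

end

section \<open>Uniqueness of minimisers\<close>

lemma hdist_quadrilateral:
  assumes [simp]: "x \<in> H3" "x' \<in> H3" "y \<in> H3" "y' \<in> H3"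
  shows "\<bar>hdist x' y' - hdist x y\<bar> \<le> hdist x x' + hdist y y'"
proof -
  have "hdist x' y' \<le> hdist x' x + hdist x y'" "hdist x y' \<le> hdist x y + hdist y y'"
    "hdist x y \<le> hdist x x' + hdist x' y" "hdist x' y \<le> hdist x' y' + hdist y' y"
    by (rule hdist_triangle; simp)+
  then show ?thesis by (simp add: hdist_commute[of x' x] hdist_commute[of y' y] abs_le_iff)
qed

lemma tendsto_hdist:
  assumes "x \<in> H3" "y \<in> H3" "\<And>k. X k \<in> H3" "\<And>k. Y k \<in> H3"
    and "(\<lambda>k. hdist x (X k)) \<longlonglongrightarrow> 0" "(\<lambda>k. hdist y (Y k)) \<longlonglongrightarrow> 0"
  shows "(\<lambda>k. hdist (X k) (Y k)) \<longlonglongrightarrow> hdist x y"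
proof -
  have "(\<lambda>k. hdist (X k) (Y k) - hdist x y) \<longlonglongrightarrow> 0"
  proof (rule Lim_null_comparison)
    show "\<forall>\<^sub>F k in sequentially. norm (hdist (X k) (Y k) - hdist x y) \<le> hdist x (X k) + hdist y (Y k)"
      using hdist_quadrilateral assms(1-4) by simp
    show "(\<lambda>k. hdist x (X k) + hdist y (Y k)) \<longlonglongrightarrow> 0" using tendsto_add[OF assms(5,6)] by simp
  qed
  then show ?thesis by (simp add: LIM_zero_iff)
qed

definition mid :: "(vertex \<Rightarrow> point3) \<Rightarrow> (vertex \<Rightarrow> point3) \<Rightarrow> vertex \<Rightarrow> point3" where
  "mid pos pos' v = geo (pos v) (pos' v) (1 / 2)"

context carrier_ctx
begin

lemma elen_dart:
  assumes "\<And>v. pos v \<in> H3" "d \<in> darts \<Gamma> v"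
  shows "hdist (pos v) (dend \<Gamma> pos d) = elen \<Gamma> pos (fst d)"
proof -
  obtain e c where d: "d = (e, c)" by (cases d)
  show ?thesis
  proof (cases c)
    case False
    have "hdist (pos (tgt \<Gamma> e)) (act (inv (vt e)) (pos (src \<Gamma> e))) =
        hdist (act (vt e) (pos (tgt \<Gamma> e))) (act (vt e) (act (inv (vt e)) (pos (src \<Gamma> e))))"
      using assms(1) by (subst hdist_act') auto
    also have "\<dots> = elen \<Gamma> pos e" using assms(1) by (simp add: elen_def hdist_commute)
    finally show ?thesis using False d assms(2) by (simp add: darts_iff)
  qed (use d assms(2) in \<open>simp add: elen_def darts_iff\<close>)
qed

lemma dend_mid:
  assumes "\<And>v. pos v \<in> H3" "\<And>v. pos' v \<in> H3"
  shows "dend \<Gamma> (mid pos pos') d = geo (dend \<Gamma> pos d) (dend \<Gamma> pos' d) (1 / 2)"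
  using assms by (cases d; cases "snd d") (auto simp: mid_def act_geo')

lemma mid_H3: "\<lbrakk>\<And>v. pos v \<in> H3; \<And>v. pos' v \<in> H3\<rbrakk> \<Longrightarrow> mid pos pos' v \<in> H3"
  by (simp add: mid_def)

context
  fixes \<Gamma> :: two_graph and pos pos' :: "vertex \<Rightarrow> point3"
  assumes pp: "\<And>v. pos v \<in> H3" "\<And>v. pos' v \<in> H3"
begin

lemma elen_mid_dart:
  assumes "d \<in> darts \<Gamma> v"
  shows "2 * elen \<Gamma> (mid pos pos') (fst d) \<le> elen \<Gamma> pos (fst d) + elen \<Gamma> pos' (fst d)"
    and "2 * elen \<Gamma> (mid pos pos') (fst d) = elen \<Gamma> pos (fst d) + elen \<Gamma> pos' (fst d) \<Longrightarrow> coll (pos v) (pos' v) (dend \<Gamma> pos d)"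
proof -
  note D = dend_H3[of pos \<Gamma> d, OF pp(1)] dend_H3[of pos' \<Gamma> d, OF pp(2)]
  have e: "elen \<Gamma> (mid pos pos') (fst d) = hdist (geo (pos v) (pos' v) (1 / 2)) (geo (dend \<Gamma> pos d) (dend \<Gamma> pos' d) (1 / 2))"
    using elen_dart[of "mid pos pos'", OF mid_H3[of pos pos', OF pp] assms]
    unfolding dend_mid[of pos pos', OF pp] mid_def by simp
  note mc = midpoint_convex[OF pp(1)[of v] pp(2)[of v] D]
  show "2 * elen \<Gamma> (mid pos pos') (fst d) \<le> elen \<Gamma> pos (fst d) + elen \<Gamma> pos' (fst d)"
    unfolding e elen_dart[of pos, OF pp(1) assms, symmetric] elen_dart[of pos', OF pp(2) assms, symmetric] by (rule mc(1))
  show "coll (pos v) (pos' v) (dend \<Gamma> pos d)"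
    if "2 * elen \<Gamma> (mid pos pos') (fst d) = elen \<Gamma> pos (fst d) + elen \<Gamma> pos' (fst d)"
    using that unfolding e elen_dart[of pos, OF pp(1) assms, symmetric] elen_dart[of pos', OF pp(2) assms, symmetric] by (rule mc(2))
qed

lemma elen_mid: "2 * elen \<Gamma> (mid pos pos') e \<le> elen \<Gamma> pos e + elen \<Gamma> pos' e"
  using elen_mid_dart(1)[of "(e, True)" "src \<Gamma> e"] by (simp add: darts_iff)

lemma total_len_mid: "2 * total_len \<Gamma> (mid pos pos') \<le> total_len \<Gamma> pos + total_len \<Gamma> pos'"
  unfolding total_len_def sum_distrib_left sum.distrib[symmetric] by (intro sum_mono elen_mid)

text \<open>The convexity inequality holds edge by edge, so equality of the sums gives equality on
  each edge. Counting darts instead of edges lets a loop contribute two of the three directions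
  needed for \<open>coll_three\<close>.\<close>

lemma total_len_mid_strict:
  assumes nd: "nondeg \<Gamma> pos" and v: "pos v \<noteq> pos' v"
  shows "2 * total_len \<Gamma> (mid pos pos') < total_len \<Gamma> pos + total_len \<Gamma> pos'"
proof (rule ccontr)
  assume "\<not> ?thesis"
  then have "2 * elen \<Gamma> (mid pos pos') E1 + 2 * elen \<Gamma> (mid pos pos') E2 + 2 * elen \<Gamma> (mid pos pos') E3
      \<ge> elen \<Gamma> pos E1 + elen \<Gamma> pos' E1 + (elen \<Gamma> pos E2 + elen \<Gamma> pos' E2) + (elen \<Gamma> pos E3 + elen \<Gamma> pos' E3)"
    by (simp add: total_len_def)
  then have "2 * elen \<Gamma> (mid pos pos') E1 = elen \<Gamma> pos E1 + elen \<Gamma> pos' E1"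
    "2 * elen \<Gamma> (mid pos pos') E2 = elen \<Gamma> pos E2 + elen \<Gamma> pos' E2"
    "2 * elen \<Gamma> (mid pos pos') E3 = elen \<Gamma> pos E3 + elen \<Gamma> pos' E3"
    using elen_mid[of E1] elen_mid[of E2] elen_mid[of E3] by linarith+
  then have "2 * elen \<Gamma> (mid pos pos') e = elen \<Gamma> pos e + elen \<Gamma> pos' e" for e
    by (cases e) simp_all
  then have c: "coll (pos v) (pos' v) (dend \<Gamma> pos d)" if "d \<in> darts \<Gamma> v" for d
    using elen_mid_dart(2)[OF that] by simp
  obtain d1 d2 d3 where d: "{d1, d2, d3} \<subseteq> darts \<Gamma> v" "d1 \<noteq> d2" "d1 \<noteq> d3" "d2 \<noteq> d3"
    using three_darts by blast
  define D where "D i = (if i = 1 then d1 else if i = 2 then d2 else d3)" for i :: nat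
  have D: "D i \<in> darts \<Gamma> v" for i using d by (simp add: D_def)
  have "\<exists>i\<in>{1, 2, 3}. \<exists>j\<in>{1, 2, 3}. i \<noteq> j \<and> same_ray (pos v) (dend \<Gamma> pos (D i)) (dend \<Gamma> pos (D j))"
    by (rule coll_three[OF pp(1)[of v] pp(2)[of v]])
      (use v c D nd dend_H3[OF pp(1)] in \<open>auto simp: nondeg_def\<close>)
  then obtain i j where ij: "i \<in> {1, 2, 3}" "j \<in> {1, 2, 3}" "i \<noteq> j" "same_ray (pos v) (dend \<Gamma> pos (D i)) (dend \<Gamma> pos (D j))"
    by blast
  then have "D i \<noteq> D j" using d by (auto simp: D_def)
  then show False using nd ij(4) D unfolding nondeg_def by blast
qed

end

text \<open>Nondegeneracy consists of finitely many strict conditions on distances, each continuous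
  in the placement.\<close>

lemma nondeg_limit:
  assumes nd: "nondeg \<Gamma> pos" and P: "\<And>k v. P k v \<in> H3" and lim: "\<And>v. (\<lambda>k. hdist (pos v) (P k v)) \<longlonglongrightarrow> 0"
  shows "\<forall>\<^sub>F k in sequentially. nondeg \<Gamma> (P k)"
proof -
  have pos [simp]: "pos v \<in> H3" for v using nd by (auto simp: nondeg_def)
  have fv: "finite (UNIV :: vertex set)"
  proof (rule finite_subset)
    show "UNIV \<subseteq> {V0, V1}" using vertex.exhaust by auto
  qed simp
  have DH: "dend \<Gamma> pos d \<in> H3" "dend \<Gamma> (P k) d \<in> H3" for d k by (rule dend_H3; simp add: P)+
  have dl: "(\<lambda>k. hdist (dend \<Gamma> pos d) (dend \<Gamma> (P k) d)) \<longlonglongrightarrow> 0" for d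
    using lim by (cases d; cases "snd d") (simp_all add: P)
  have 1: "(\<lambda>k. hdist (P k v) (dend \<Gamma> (P k) d)) \<longlonglongrightarrow> hdist (pos v) (dend \<Gamma> pos d)" for v d
    by (rule tendsto_hdist[OF pos DH(1) P DH(2) lim dl])
  have 2: "(\<lambda>k. hdist (dend \<Gamma> (P k) d) (dend \<Gamma> (P k) d')) \<longlonglongrightarrow> hdist (dend \<Gamma> pos d) (dend \<Gamma> pos d')" for d d'
    by (rule tendsto_hdist[OF DH(1) DH(1) DH(2) DH(2) dl dl])
  have e1: "\<forall>\<^sub>F k in sequentially. dend \<Gamma> (P k) d \<noteq> P k v" if "d \<in> darts \<Gamma> v" for d v
  proof -
    have "pos v \<noteq> dend \<Gamma> pos d" using nd that unfolding nondeg_def by metis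
    then have "0 < hdist (pos v) (dend \<Gamma> pos d)" by (intro hdist_pos pos DH)
    from order_tendstoD(1)[OF 1 this] show ?thesis by (rule eventually_mono) auto
  qed
  have e2: "\<forall>\<^sub>F k in sequentially. \<not> same_ray (P k v) (dend \<Gamma> (P k) d) (dend \<Gamma> (P k) d')"
    if "d \<in> darts \<Gamma> v" "d' \<in> darts \<Gamma> v" "d \<noteq> d'" for d d' v
  proof -
    let ?f = "\<lambda>pos. hdist (dend \<Gamma> pos d) (dend \<Gamma> pos d') - \<bar>hdist (pos v) (dend \<Gamma> pos d) - hdist (pos v) (dend \<Gamma> pos d')\<bar>"
    have "(\<lambda>k. ?f (P k)) \<longlonglongrightarrow> ?f pos" by (intro tendsto_intros 1 2)
    moreover have "?f pos \<noteq> 0" using nd that by (auto simp: nondeg_def same_ray_def)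
    ultimately have "\<forall>\<^sub>F k in sequentially. ?f (P k) \<noteq> 0" by (rule tendsto_imp_eventually_ne)
    then show ?thesis by (rule eventually_mono) (simp add: same_ray_def)
  qed
  have "\<forall>\<^sub>F k in sequentially. \<forall>v\<in>UNIV. \<forall>d\<in>darts \<Gamma> v. dend \<Gamma> (P k) d \<noteq> P k v \<and>
     (\<forall>d'\<in>darts \<Gamma> v. d \<noteq> d' \<longrightarrow> \<not> same_ray (P k v) (dend \<Gamma> (P k) d) (dend \<Gamma> (P k) d'))"
  proof (intro eventually_ball_finite fv finite_edge_bool ballI eventually_conj e1)
    fix v d d' assume "d \<in> darts \<Gamma> v" "d' \<in> darts \<Gamma> v"
    then show "\<forall>\<^sub>F k in sequentially. d \<noteq> d' \<longrightarrow> \<not> same_ray (P k v) (dend \<Gamma> (P k) d) (dend \<Gamma> (P k) d')"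
      using e2 by (cases "d = d'") auto
  qed
  then show ?thesis by (rule eventually_mono) (auto simp: nondeg_def P)
qed

text \<open>The midpoint of the two placements is strictly shorter but may be degenerate. The
  iterated midpoints \<open>P k\<close> converge to \<open>pos\<close>, remain strictly shorter by
  convexity, and are eventually nondegenerate by \<open>nondeg_limit\<close>, which contradicts
  \<open>min\<close>.\<close>

theorem minimizer_unique:
  assumes nd: "nondeg \<Gamma> pos" and pos': "\<And>v. pos' v \<in> H3" and eq: "total_len \<Gamma> pos' = total_len \<Gamma> pos"
    and min: "\<And>q. nondeg \<Gamma> q \<Longrightarrow> total_len \<Gamma> pos \<le> total_len \<Gamma> q"
  shows "pos = pos'"
proof (rule ccontr)
  assume "pos \<noteq> pos'"
  then obtain v where v: "pos v \<noteq> pos' v" by auto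
  have pos: "pos v \<in> H3" for v using nd by (auto simp: nondeg_def)
  define P where "P = rec_nat (mid pos pos') (\<lambda>_. mid pos)"
  have P_simps: "P 0 = mid pos pos'" "P (Suc k) = mid pos (P k)" for k by (simp_all add: P_def)
  have P: "P k v \<in> H3" for k v by (induction k arbitrary: v) (auto simp: P_simps intro!: mid_H3 pos pos')
  have lt: "total_len \<Gamma> (P k) < total_len \<Gamma> pos" for k
  proof (induction k)
    case 0
    then show ?case using total_len_mid_strict[of pos pos' \<Gamma> v, OF pos pos' nd v] eq by (simp add: P_simps)
  next
    case (Suc k)
    then show ?case using total_len_mid[of pos "P k" \<Gamma>, OF pos P] by (simp add: P_simps)
  qed
  have eqn: "hdist (pos v) (P k v) = hdist (pos v) (pos' v) * (1 / 2) ^ Suc k" for k v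
    by (induction k arbitrary: v) (simp_all add: P_simps mid_def hdist_geo pos pos' P mult.commute)
  have "(\<lambda>k. hdist (pos v) (P k v)) \<longlonglongrightarrow> 0" for v
    unfolding eqn by (intro tendsto_mult_right_zero LIMSEQ_Suc LIMSEQ_power_zero) simp
  from nondeg_limit[OF nd P this] obtain k where "nondeg \<Gamma> (P k)"
    by (auto simp: eventually_sequentially)
  then show False using min lt[of k] by fastforce
qed

text \<open>A loop at \<open>V0\<close> representing a letter crosses each edge at most twice; the
  factor 2 is attained by the bridge of the dumbbell, which the loop for \<open>b\<close> traverses
  in both directions.\<close>

lemma displacement:
  assumes [simp]: "\<And>v. pos v \<in> H3"
  shows "hdist (pos V0) (act (letter_val G a b l) (pos V0)) \<le> 2 * total_len \<Gamma> pos"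
proof -
  define p q where "p = pos V0" and "q = pos V1"
  have pq [simp]: "p \<in> H3" "q \<in> H3" by (simp_all add: p_def q_def)
  have nn: "0 \<le> elen \<Gamma> pos e" for e by (simp add: elen_def hdist_nonneg)
  have tl: "total_len \<Gamma> pos = elen \<Gamma> pos E1 + elen \<Gamma> pos E2 + elen \<Gamma> pos E3" by (simp add: total_len_def)
  have e3: "elen \<Gamma> pos E3 = hdist p q" by (simp add: elen_def src_E3 tgt_E3 p_def q_def)
  have tri: "hdist p (act g p) \<le> hdist p (act g q) + hdist p q" "hdist p (act g q) \<le> hdist p q + hdist q (act g q)"
    if "g \<in> carrier G" for g
    using hdist_triangle[of "act g q" p "act g p"] hdist_triangle[of q p "act g q"] that
    by (simp_all add: hdist_commute[of q p])
  have ab: "hdist p (act g p) \<le> 2 * total_len \<Gamma> pos" if "g = a \<or> g = b" for g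
  proof (cases \<Gamma>)
    case Buckle
    have "elen \<Gamma> pos E1 = hdist p (act a q)" "elen \<Gamma> pos E2 = hdist p (act b q)"
      by (simp_all add: elen_def Buckle p_def q_def)
    then show ?thesis using that tri[of g] tl e3 nn[of E1] nn[of E2] nn[of E3] by auto
  next
    case Dumbbell
    have "elen \<Gamma> pos E1 = hdist p (act a p)" "elen \<Gamma> pos E2 = hdist q (act b q)"
      by (simp_all add: elen_def Dumbbell p_def q_def)
    then show ?thesis using that tri[of g] tl e3 nn[of E1] nn[of E2] nn[of E3] by auto
  qed
  have "hdist p (act (inv g) p) = hdist p (act g p)" if "g \<in> carrier G" for g
    using hdist_act'[of g p "act (inv g) p"] that by (simp add: hdist_commute)
  then show ?thesis using ab unfolding p_def[symmetric] by (cases l; cases "fst l") auto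
qed

lemma trace_letters_bound:
  assumes pos: "\<And>v. pos v \<in> H3" and k: "k1 = letter_val G a b l1" "k2 = letter_val G a b l2"
  shows "(cmod (trace (\<rho> (h (k1 \<otimes> k2)))))\<^sup>2 \<le> 4 * cosh (4 * total_len \<Gamma> pos)"
proof -
  let ?p = "pos V0"
  have [simp]: "k1 \<in> carrier G" "k2 \<in> carrier G" by (auto simp: k)
  have "hdist ?p (act (k1 \<otimes> k2) ?p) \<le> hdist ?p (act k1 ?p) + hdist (act k1 ?p) (act k1 (act k2 ?p))"
    using hdist_triangle[of "act k1 ?p" ?p "act (k1 \<otimes> k2) ?p"] pos by (simp add: act_act)
  also have "\<dots> \<le> 4 * total_len \<Gamma> pos"
    using displacement[of pos l1 \<Gamma>] displacement[of pos l2 \<Gamma>] pos by (simp add: k)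
  finally have d: "hdist ?p (act (k1 \<otimes> k2) ?p) \<le> 4 * total_len \<Gamma> pos" .
  have "(cmod (trace (\<rho> (h (k1 \<otimes> k2)))))\<^sup>2 \<le> 4 * cosh (hdist ?p (act (k1 \<otimes> k2) ?p))"
    unfolding act_def using pos by (intro trace_bound) auto
  also have "\<dots> \<le> 4 * cosh (4 * total_len \<Gamma> pos)"
  proof -
    have "0 \<le> hdist ?p (act (k1 \<otimes> k2) ?p)" using pos by (intro hdist_nonneg) auto
    then show ?thesis using d by (simp add: cosh_real_nonneg_le_iff)
  qed
  finally show ?thesis .
qed

text \<open>Undoing the signed permutation writes \<open>A\<close> and \<open>B\<close> as common
  conjugates of images of two letters. So the trace at the vertex is the trace of the image of a
  two-letter product, which moves the base point by at most four times the length.\<close>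

lemma trace_node_bound:
  assumes pos: "\<And>v. pos v \<in> H3" and A: "A \<in> carrier G" "B \<in> carrier G"
    and sc: "signed_conj A B l l' s (h a) (h b)"
  shows "(cmod (trace (\<rho> (A \<otimes> B))))\<^sup>2 \<le> 4 * cosh (4 * total_len \<Gamma> pos)"
proof -
  have s [simp]: "s \<in> carrier G" and ll: "fst l \<noteq> fst l'"
    and U: "h a = inv s \<otimes> letter_val G A B l \<otimes> s" "h b = inv s \<otimes> letter_val G A B l' \<otimes> s"
    using sc by (auto simp: signed_conj_def)
  have hl: "h (letter_val G a b k) = letter_val G (h a) (h b) k" for k
    by (cases k; cases "fst k") (auto simp: auto_inv[OF h])
  obtain x p y q where m: "l = (x, p)" "l' = (y, q)" by (cases l; cases l') auto
  have "\<exists>k1 k2. letter_val G (h a) (h b) k1 = inv s \<otimes> A \<otimes> s \<and> letter_val G (h a) (h b) k2 = inv s \<otimes> B \<otimes> s"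
  proof (cases x)
    case GX
    then have "y = GY" using ll m by (cases y) auto
    then show ?thesis
      using U GX A by (intro exI[of _ "(GX, p)"] exI[of _ "(GY, q)"]) (cases p; cases q; simp add: m inv_mult_group m_assoc)
  next
    case GY
    then have "y = GX" using ll m by (cases y) auto
    then show ?thesis
      using U GY A by (intro exI[of _ "(GY, q)"] exI[of _ "(GX, p)"]) (cases p; cases q; simp add: m inv_mult_group m_assoc)
  qed
  then obtain k1 k2 where k: "letter_val G (h a) (h b) k1 = inv s \<otimes> A \<otimes> s" "letter_val G (h a) (h b) k2 = inv s \<otimes> B \<otimes> s"
    by blast
  have "h (letter_val G a b k1 \<otimes> letter_val G a b k2) = inv s \<otimes> (A \<otimes> B) \<otimes> s"
    using A by (simp add: auto_mult[OF h] hl k m_assoc)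
  moreover have "trace (\<rho> (inv s \<otimes> (A \<otimes> B) \<otimes> s)) = trace (\<rho> (A \<otimes> B))"
  proof -
    have "trace (\<rho> (inv s \<otimes> (A \<otimes> B) \<otimes> s)) = trace (\<rho> s ** (\<rho> (inv s) ** \<rho> (A \<otimes> B)))"
      using A by (simp only: rho_mult inv_closed m_closed s) (rule trace_mul_sym)
    then show ?thesis using A by (simp add: matrix_mul_assoc rho_inv_mult)
  qed
  ultimately show ?thesis using trace_letters_bound[OF pos refl refl, of k1 k2 \<Gamma>] by simp
qed

end

section \<open>Counting the minimal classes\<close>

context BQ_rep
begin

lemma rho_act: "\<lbrakk>g \<in> carrier G; k \<in> carrier G; x \<in> H3\<rbrakk> \<Longrightarrow> SL2C_act (\<rho> (g \<otimes> k)) x = SL2C_act (\<rho> g) (SL2C_act (\<rho> k) x)"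
  by (simp add: rho_mult act_mult)

lemma rho_act_inv:
  assumes "g \<in> carrier G" "x \<in> H3"
  shows "SL2C_act (\<rho> (inv g)) (SL2C_act (\<rho> g) x) = x" "SL2C_act (\<rho> g) (SL2C_act (\<rho> (inv g)) x) = x"
  using rho_act[of "inv g" g x] rho_act[of g "inv g" x] assms by simp_all

lemma rho_act_H3: "\<lbrakk>g \<in> carrier G; x \<in> H3\<rbrakk> \<Longrightarrow> SL2C_act (\<rho> g) x \<in> H3"
  by (simp add: act_H3)

lemma marked_H3: "M \<in> marked_carriers G a b \<rho> \<Longrightarrow> map_of M ` cover_points G \<subseteq> H3"
  by (simp add: marked_carriers_def)

lemma marked_aut: "M \<in> marked_carriers G a b \<rho> \<Longrightarrow> aut_of M \<in> auto G"
  by (simp add: marked_carriers_def equivariant_via_def)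

lemma equiv_carrier: "equiv (marked_carriers G a b \<rho>) (carrier_equiv G a b \<rho>)"
proof (rule equivI)
  interpret A: group "AutoGroup G" by (rule AutoGroup)
  have A_carrier: "M \<in> marked_carriers G a b \<rho> \<Longrightarrow> aut_of M \<in> carrier (AutoGroup G)" for M
    using marked_aut by simp
  show "carrier_equiv G a b \<rho> \<subseteq> marked_carriers G a b \<rho> \<times> marked_carriers G a b \<rho>"
    by (auto simp: carrier_equiv_def)
  show "refl_on (marked_carriers G a b \<rho>) (carrier_equiv G a b \<rho>)"
  proof (rule refl_onI)
    fix M assume M: "M \<in> marked_carriers G a b \<rho>"
    have "\<exists>W\<in>carrier G. map_of M ` cover_points G = SL2C_act (\<rho> W) ` map_of M ` cover_points G"
      by (rule bexI[of _ \<one>]) (simp_all add: image_image)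
    moreover have "\<exists>h'\<in>Inn_e G. aut_of M = h' \<otimes>\<^bsub>AutoGroup G\<^esub> aut_of M"
      using subgroup.one_closed[OF subgroup_Inn_e] A.l_one[OF A_carrier[OF M]] by metis
    ultimately show "(M, M) \<in> carrier_equiv G a b \<rho>" using M by (simp add: carrier_equiv_def)
  qed
  show "sym (carrier_equiv G a b \<rho>)"
  proof (rule symI)
    fix M N assume MN: "(M, N) \<in> carrier_equiv G a b \<rho>"
    then have mc: "M \<in> marked_carriers G a b \<rho>" "N \<in> marked_carriers G a b \<rho>" "graph_of M = graph_of N"
      by (auto simp: carrier_equiv_def)
    obtain W where W: "W \<in> carrier G" "map_of M ` cover_points G = SL2C_act (\<rho> W) ` map_of N ` cover_points G"
      using MN by (auto simp: carrier_equiv_def)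
    obtain k where k: "k \<in> Inn_e G" "aut_of N = k \<otimes>\<^bsub>AutoGroup G\<^esub> aut_of M"
      using MN by (auto simp: carrier_equiv_def)
    let ?S = "map_of N ` cover_points G"
    have "(\<lambda>y. SL2C_act (\<rho> (inv W)) (SL2C_act (\<rho> W) y)) ` ?S = (\<lambda>y. y) ` ?S"
      using marked_H3[OF mc(2)] W(1) rho_act_inv(1) by (intro image_cong) auto
    then have "SL2C_act (\<rho> (inv W)) ` map_of M ` cover_points G = ?S"
      unfolding W(2) image_image[of "SL2C_act (\<rho> (inv W))" "SL2C_act (\<rho> W)"] by simp
    moreover have "aut_of M = inv\<^bsub>AutoGroup G\<^esub> k \<otimes>\<^bsub>AutoGroup G\<^esub> aut_of N"
    proof -
      have kc: "k \<in> carrier (AutoGroup G)" using subgroup.subset[OF subgroup_Inn_e] k(1) by auto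
      show ?thesis unfolding k(2) using A.inv_mult_cancel(1)[OF kc A_carrier[OF mc(1)]] by simp
    qed
    ultimately show "(N, M) \<in> carrier_equiv G a b \<rho>"
      using mc inv_closed[OF W(1)] subgroup.m_inv_closed[OF subgroup_Inn_e k(1)]
      unfolding carrier_equiv_def by (auto intro!: bexI[of _ "inv W"] bexI[of _ "inv\<^bsub>AutoGroup G\<^esub> k"])
  qed
  show "trans (carrier_equiv G a b \<rho>)"
  proof (rule transI)
    fix M N L assume MN: "(M, N) \<in> carrier_equiv G a b \<rho>" and NL: "(N, L) \<in> carrier_equiv G a b \<rho>"
    then have mc: "M \<in> marked_carriers G a b \<rho>" "N \<in> marked_carriers G a b \<rho>" "L \<in> marked_carriers G a b \<rho>"
        "graph_of M = graph_of L"
      by (auto simp: carrier_equiv_def)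
    obtain W where W: "W \<in> carrier G" "map_of M ` cover_points G = SL2C_act (\<rho> W) ` map_of N ` cover_points G"
      using MN by (auto simp: carrier_equiv_def)
    obtain W' where W': "W' \<in> carrier G" "map_of N ` cover_points G = SL2C_act (\<rho> W') ` map_of L ` cover_points G"
      using NL by (auto simp: carrier_equiv_def)
    obtain k where k: "k \<in> Inn_e G" "aut_of N = k \<otimes>\<^bsub>AutoGroup G\<^esub> aut_of M"
      using MN by (auto simp: carrier_equiv_def)
    obtain k' where k': "k' \<in> Inn_e G" "aut_of L = k' \<otimes>\<^bsub>AutoGroup G\<^esub> aut_of N"
      using NL by (auto simp: carrier_equiv_def)
    have "map_of M ` cover_points G = SL2C_act (\<rho> (W \<otimes> W')) ` map_of L ` cover_points G"
      unfolding W(2) W'(2) image_image[of "SL2C_act (\<rho> W)" "SL2C_act (\<rho> W')"]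
      by (rule image_cong[OF refl], rule rho_act[OF W(1) W'(1), symmetric]) (use marked_H3[OF mc(3)] in blast)
    moreover have "aut_of L = (k' \<otimes>\<^bsub>AutoGroup G\<^esub> k) \<otimes>\<^bsub>AutoGroup G\<^esub> aut_of M"
    proof -
      have "k \<in> carrier (AutoGroup G)" "k' \<in> carrier (AutoGroup G)"
        using subgroup.subset[OF subgroup_Inn_e] k(1) k'(1) by auto
      then show ?thesis unfolding k'(2) k(2) using A.m_assoc A_carrier[OF mc(1)] by simp
    qed
    ultimately show "(M, L) \<in> carrier_equiv G a b \<rho>"
      using mc m_closed[OF W(1) W'(1)] subgroup.m_closed[OF subgroup_Inn_e k'(1) k(1)]
      unfolding carrier_equiv_def by auto
  qed
qed

lemma auto_gens:
  assumes h: "h \<in> auto G" and "free_basis G (h a) (h b)"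
  shows "gens (h a) (h b)" "h a \<otimes> h b \<noteq> h b \<otimes> h a"
proof -
  have c [simp]: "h a \<in> carrier G" "h b \<in> carrier G" using auto_closed[OF h] by auto
  have bij: "bij_betw (word_val G (h a) (h b)) {w. reduced w} (carrier G)" using assms by (simp add: free_basis_def)
  show "gens (h a) (h b)"
    unfolding gens_def
  proof (intro conjI allI impI c)
    fix H assume H: "subgroup H G" "h a \<in> H" "h b \<in> H"
    have l: "letter_val G (h a) (h b) l \<in> H" for l
      using H subgroup.m_inv_closed[OF H(1)] by (cases l; cases "fst l") auto
    have "word_val G (h a) (h b) w \<in> H" for w
      by (induction w) (simp_all add: subgroup.one_closed[OF H(1)] subgroup.m_closed[OF H(1)] l)
    moreover have "\<exists>w. g = word_val G (h a) (h b) w" if "g \<in> carrier G" for g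
      using bij that unfolding bij_betw_def by (metis imageE)
    ultimately have "carrier G \<subseteq> H" by blast
    then show "H = carrier G" using subgroup.subset[OF H(1)] by blast
  qed
  show "h a \<otimes> h b \<noteq> h b \<otimes> h a"
  proof
    assume "h a \<otimes> h b = h b \<otimes> h a"
    then have "word_val G (h a) (h b) [(GX, True), (GY, True)] = word_val G (h a) (h b) [(GY, True), (GX, True)]" by simp
    from inj_onD[OF bij_betw_imp_inj_on[OF bij] this] show False by simp
  qed
qed

definition min_marked :: "'a marked_graph \<Rightarrow> bool" where
  "min_marked M \<longleftrightarrow> M \<in> marked_carriers G a b \<rho> \<and> is_geodesic G a b M \<and>
     (\<forall>N\<in>marked_carriers G a b \<rho>. carrier_length G a b M \<le> carrier_length G a b N)"

definition base_pos :: "'a marked_graph \<Rightarrow> vertex \<Rightarrow> point3" where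
  "base_pos M v = map_of M (Vert \<one> v)"

definition marked_len :: "'a marked_graph \<Rightarrow> real" where
  "marked_len M = carrier_ctx.total_len G a b \<rho> (aut_of M) (graph_of M) (base_pos M)"

lemma carrier_ctx_marked: "M \<in> marked_carriers G a b \<rho> \<Longrightarrow> carrier_ctx G a b \<rho> (aut_of M)"
  using marked_aut by unfold_locales

text \<open>Straightening keeps the image and the automorphism, so \<open>marked_len\<close>
  competes on equal terms with every nondegenerate placement. The last two facts stand in for the
  equality of the minimal length with \<open>marked_len\<close>.\<close>

lemma min_marked_facts:
  assumes "min_marked M"
  shows "\<And>v. base_pos M v \<in> H3"
    and "carrier_ctx.nondeg G a b \<rho> (aut_of M) (graph_of M) (base_pos M)"
    and "map_of M ` cover_points G = carrier_ctx.straight G a b \<rho> (aut_of M) (graph_of M) (base_pos M) ` cover_points G"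
    and "\<And>q. carrier_ctx.nondeg G a b \<rho> (aut_of M) (graph_of M) q \<Longrightarrow>
      marked_len M \<le> carrier_ctx.total_len G a b \<rho> (aut_of M) (graph_of M) q"
    and "\<And>N. N \<in> marked_carriers G a b \<rho> \<Longrightarrow> ennreal (marked_len M) \<le> carrier_length G a b N"
    and "\<exists>N\<in>marked_carriers G a b \<rho>. carrier_length G a b N \<le> ennreal (marked_len M)"
proof -
  have M: "M \<in> marked_carriers G a b \<rho>" "is_geodesic G a b M" using assms by (auto simp: min_marked_def)
  interpret c: carrier_ctx G a b \<rho> "aut_of M" by (rule carrier_ctx_marked[OF M(1)])
  have M': "Marked (graph_of M) (map_of M) (aut_of M) = M" by simp
  have fb: "free_basis G (aut_of M a) (aut_of M b)"
    using M(1) by (auto simp: marked_carriers_def equivariant_via_def)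
  have base: "base_pos M = (\<lambda>v. map_of M (Vert \<one> v))" by (simp add: base_pos_def fun_eq_iff)
  note facts = c.pos_H3 c.pos_nondeg c.Psi_image c.total_len_le_carrier_length
  note facts' = facts[of "graph_of M" "map_of M", unfolded M', OF M, folded base]
  show H: "base_pos M v \<in> H3" for v unfolding base by (rule c.pos_H3[of "graph_of M" "map_of M", unfolded M', OF M])
  show nd: "c.nondeg (graph_of M) (base_pos M)" by (rule facts'(2))
  show "map_of M ` cover_points G = c.straight (graph_of M) (base_pos M) ` cover_points G" by (rule facts'(3))
  have le: "ennreal (marked_len M) \<le> carrier_length G a b M" unfolding marked_len_def by (rule facts'(4))
  then show lower: "ennreal (marked_len M) \<le> carrier_length G a b N" if "N \<in> marked_carriers G a b \<rho>" for N
    using assms that by (auto simp: min_marked_def intro: order_trans)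
  have upper: "Marked (graph_of M) (c.straight (graph_of M) q) (aut_of M) \<in> marked_carriers G a b \<rho>"
    "carrier_length G a b (Marked (graph_of M) (c.straight (graph_of M) q) (aut_of M)) \<le> ennreal (c.total_len (graph_of M) q)"
    if "c.nondeg (graph_of M) q" for q
  proof -
    have q: "q v \<in> H3" for v using that by (auto simp: c.nondeg_def)
    show "Marked (graph_of M) (c.straight (graph_of M) q) (aut_of M) \<in> marked_carriers G a b \<rho>"
      by (rule c.straight_marked[OF q that fb])
    show "carrier_length G a b (Marked (graph_of M) (c.straight (graph_of M) q) (aut_of M)) \<le> ennreal (c.total_len (graph_of M) q)"
      by (rule c.carrier_length_straight[OF q])
  qed
  show "marked_len M \<le> c.total_len (graph_of M) q" if nq: "c.nondeg (graph_of M) q" for q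
  proof -
    have "q v \<in> H3" for v using nq by (auto simp: c.nondeg_def)
    then have "0 \<le> c.total_len (graph_of M) q"
      by (auto simp: c.total_len_def c.elen_def intro!: add_nonneg_nonneg hdist_nonneg)
    moreover have "ennreal (marked_len M) \<le> ennreal (c.total_len (graph_of M) q)"
      using lower[OF upper(1)[OF nq]] upper(2)[OF nq] by (rule order_trans)
    ultimately show ?thesis by simp
  qed
  show "\<exists>N\<in>marked_carriers G a b \<rho>. carrier_length G a b N \<le> ennreal (marked_len M)"
    using upper[OF nd] unfolding marked_len_def by blast
qed

lemma marked_len_nonneg: "min_marked M \<Longrightarrow> 0 \<le> marked_len M"
proof -
  assume M: "min_marked M"
  then interpret c: carrier_ctx G a b \<rho> "aut_of M" by (intro carrier_ctx_marked) (simp add: min_marked_def)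
  show ?thesis using min_marked_facts(1)[OF M]
    by (auto simp: marked_len_def c.total_len_def c.elen_def intro!: add_nonneg_nonneg hdist_nonneg)
qed

lemma marked_len_unique:
  assumes "min_marked M" "min_marked N" shows "marked_len M = marked_len N"
proof -
  have "marked_len M \<le> marked_len N" if MN: "min_marked M" "min_marked N" for M N
  proof -
    obtain L where "L \<in> marked_carriers G a b \<rho>" "carrier_length G a b L \<le> ennreal (marked_len N)"
      using min_marked_facts(6)[OF MN(2)] by blast
    then have "ennreal (marked_len M) \<le> ennreal (marked_len N)"
      using min_marked_facts(5)[OF MN(1)] order_trans by blast
    then show ?thesis using marked_len_nonneg[OF MN(2)] by simp
  qed
  then show ?thesis using assms by (meson order_antisym)
qed

text \<open>The code forgets the conjugator, so it records the automorphism up to inner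
  automorphisms.\<close>

definition has_code :: "'a marked_graph \<Rightarrow> bool \<times> bool list \<times> letter \<times> letter \<Rightarrow> bool" where
  "has_code M = (\<lambda>(e, w, l, l'). \<exists>s. signed_conj (fst (gnode (seed e) w)) (snd (gnode (seed e) w)) l l' s (aut_of M a) (aut_of M b))"

lemma has_code_exists:
  assumes "min_marked M" shows "\<exists>c. has_code M c"
proof -
  have M: "M \<in> marked_carriers G a b \<rho>" using assms by (simp add: min_marked_def)
  have fb: "free_basis G (aut_of M a) (aut_of M b)"
    using M by (auto simp: marked_carriers_def equivariant_via_def)
  show ?thesis
    using reached_if_gens[OF auto_gens[OF marked_aut[OF M] fb]] unfolding reached_def has_code_def by auto
qed

lemma finite_codes: "finite {c. \<exists>M. min_marked M \<and> has_code M c}"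
proof (cases "\<exists>M0. min_marked M0")
  case True
  then obtain M0 where M0: "min_marked M0" by blast
  \<comment> \<open>All minimal carriers have the same length, so the bound of
    \<open>trace_node_bound\<close> is the same for all of them.\<close>
  define K where "K = sqrt (4 * cosh (4 * marked_len M0))"
  let ?W = "\<lambda>e. {w. cmod (trace (\<rho> (fst (gnode (seed e) w) \<otimes> snd (gnode (seed e) w)))) \<le> K}"
  have L: "finite (UNIV :: letter set)"
  proof (rule finite_subset)
    show "(UNIV :: letter set) \<subseteq> {GX, GY} \<times> UNIV" using gen.exhaust by auto
  qed simp
  have "{c. \<exists>M. min_marked M \<and> has_code M c} \<subseteq> (\<Union>e. {e} \<times> ?W e \<times> UNIV \<times> UNIV)"
  proof
    fix c assume "c \<in> {c. \<exists>M. min_marked M \<and> has_code M c}"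
    then obtain M where M: "min_marked M" "has_code M c" by blast
    then interpret C: carrier_ctx G a b \<rho> "aut_of M" by (intro carrier_ctx_marked) (simp add: min_marked_def)
    obtain e w l l' where c: "c = (e, w, l, l')" by (cases c)
    obtain s where s: "signed_conj (fst (gnode (seed e) w)) (snd (gnode (seed e) w)) l l' s (aut_of M a) (aut_of M b)"
      using M(2) by (auto simp: c has_code_def)
    have "(cmod (trace (\<rho> (fst (gnode (seed e) w) \<otimes> snd (gnode (seed e) w)))))\<^sup>2 \<le> 4 * cosh (4 * C.total_len (graph_of M) (base_pos M))"
      by (rule C.trace_node_bound[OF min_marked_facts(1)[OF M(1)] _ _ s]) (use gnode_closed[of "seed e" w] in auto)
    also have "C.total_len (graph_of M) (base_pos M) = marked_len M0"
      using marked_len_unique[OF M(1) M0] by (simp add: marked_len_def)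
    finally have "cmod (trace (\<rho> (fst (gnode (seed e) w) \<otimes> snd (gnode (seed e) w)))) \<le> K"
      unfolding K_def by (rule real_le_rsqrt)
    then show "c \<in> (\<Union>e. {e} \<times> ?W e \<times> UNIV \<times> UNIV)" by (auto simp: c)
  qed
  moreover have "finite (\<Union>e. {e} \<times> ?W e \<times> (UNIV :: letter set) \<times> (UNIV :: letter set))"
    by (intro finite_UN_I finite_cartesian_product finite_small_traces L) auto
  ultimately show ?thesis by (rule finite_subset)
qed simp

text \<open>With equal codes the automorphisms differ by an inner one. The corresponding isometry
  carries the placement of \<open>N\<close> to one for the automorphism of \<open>M\<close> with the
  same total length, and \<open>minimizer_unique\<close> identifies the two.\<close>

lemma equiv_if_same_code:
  assumes M: "min_marked M" "min_marked N" and code: "has_code M c" "has_code N c" and \<Gamma>: "graph_of M = graph_of N"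
  shows "(M, N) \<in> carrier_equiv G a b \<rho>"
proof -
  have mc: "M \<in> marked_carriers G a b \<rho>" "N \<in> marked_carriers G a b \<rho>" using M by (auto simp: min_marked_def)
  interpret c1: carrier_ctx G a b \<rho> "aut_of M" by (rule carrier_ctx_marked[OF mc(1)])
  interpret c2: carrier_ctx G a b \<rho> "aut_of N" by (rule carrier_ctx_marked[OF mc(2)])
  note h1 = marked_aut[OF mc(1)] and h2 = marked_aut[OF mc(2)]
  obtain e w l l' where c: "c = (e, w, l, l')" by (cases c)
  obtain s1 where s1: "signed_conj (fst (gnode (seed e) w)) (snd (gnode (seed e) w)) l l' s1 (aut_of M a) (aut_of M b)"
    using code(1) by (auto simp: c has_code_def)
  obtain s2 where s2: "signed_conj (fst (gnode (seed e) w)) (snd (gnode (seed e) w)) l l' s2 (aut_of N a) (aut_of N b)"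
    using code(2) by (auto simp: c has_code_def)
  \<comment> \<open>The quotient of the two conjugators over the common vertex of the tree.\<close>
  define x where "x = inv s2 \<otimes> s1"
  have s [simp]: "s1 \<in> carrier G" "s2 \<in> carrier G" using s1 s2 by (auto simp: signed_conj_def)
  then have x [simp]: "x \<in> carrier G" by (simp add: x_def)
  let ?i = "\<lambda>g\<in>carrier G. x \<otimes> g \<otimes> inv x"
  have lc: "letter_val G (fst (gnode (seed e) w)) (snd (gnode (seed e) w)) l \<in> carrier G" for l
    using gnode_closed[of "seed e" w] by auto
  have conj_gens: "aut_of N a = x \<otimes> aut_of M a \<otimes> inv x" "aut_of N b = x \<otimes> aut_of M b \<otimes> inv x"
    using s1 s2 lc by (simp_all add: signed_conj_def x_def inv_mult_group m_assoc)
  have i: "?i \<in> Inn_e G" by (rule inner_in_Inn_e[OF x])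
  interpret A: group "AutoGroup G" by (rule AutoGroup)
  have comp: "?i \<otimes>\<^bsub>AutoGroup G\<^esub> aut_of M \<in> auto G"
    using A.m_closed[of ?i "aut_of M"] Inn_e_auto[OF i] h1 by simp
  have conj: "aut_of N g = x \<otimes> aut_of M g \<otimes> inv x" if "g \<in> carrier G" for g
  proof -
    have hw: "k (word_val G a b (nf g)) = word_val G (k a) (k b) (nf g)" if "k \<in> auto G" for k
      by (rule word_val_hom[OF is_group is_group auto_hom[OF that]]) auto
    let ?k = "?i \<otimes>\<^bsub>AutoGroup G\<^esub> aut_of M"
    have k: "?k y = x \<otimes> aut_of M y \<otimes> inv x" if "y \<in> carrier G" for y
      using AutoGroup_apply[OF Inn_e_auto[OF i] h1 that] auto_closed[OF h1 that] by simp
    have "aut_of N g = ?k g"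
      using hw[OF h2] hw[OF comp] nf(2)[OF that] by (simp add: k conj_gens)
    then show ?thesis using k[OF that] by simp
  qed
  have aut: "aut_of N = ?i \<otimes>\<^bsub>AutoGroup G\<^esub> aut_of M"
    using h2 comp by (rule auto_eqI)
      (simp add: AutoGroup_apply[OF Inn_e_auto[OF i] h1] auto_closed[OF h1] conj)
  let ?X = "SL2C_act (\<rho> (inv x))"
  \<comment> \<open>Conjugating the automorphism by \<open>x\<close> conjugates the twisted action
    by \<open>\<rho> x\<close>, so \<open>?X\<close> maps equivariant data for \<open>N\<close> to
    equivariant data for \<open>M\<close>.\<close>
  have act: "?X (c2.act g y) = c1.act g (?X y)" if "g \<in> carrier G" "y \<in> H3" for g y
    using that auto_closed[OF h1 that(1)]
    by (simp add: c1.act_def c2.act_def conj rho_act[symmetric] m_assoc)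
  define \<Gamma>' where "\<Gamma>' = graph_of M"
  define q where "q v = ?X (base_pos N v)" for v
  have bH: "base_pos N v \<in> H3" "base_pos M v \<in> H3" for v using min_marked_facts(1) M by auto
  have q: "q v \<in> H3" for v unfolding q_def by (rule rho_act_H3) (simp_all add: bH)
  have iso: "hdist (?X y) (?X z) = hdist y z" if "y \<in> H3" "z \<in> H3" for y z
    using that by (simp add: hdist_act)
  have "c1.elen \<Gamma>' q e = c2.elen \<Gamma>' (base_pos N) e" for e
    unfolding c1.elen_def c2.elen_def q_def by (simp add: act[symmetric] bH iso c2.act_closed)
  then have "c1.total_len \<Gamma>' q = marked_len N"
    by (simp add: c1.total_len_def c2.total_len_def marked_len_def \<Gamma>'_def \<Gamma>)
  also have "\<dots> = c1.total_len \<Gamma>' (base_pos M)"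
    using marked_len_unique[OF M] by (simp add: marked_len_def \<Gamma>'_def)
  finally have "base_pos M = q"
    using c1.minimizer_unique[of \<Gamma>' "base_pos M" q] min_marked_facts(2,4)[OF M(1)] q
    by (simp add: \<Gamma>'_def marked_len_def)
  have st: "c1.straight \<Gamma>' q y = ?X (c2.straight \<Gamma>' (base_pos N) y)" if "y \<in> cover_points G" for y
  proof -
    consider g v where "y = Vert g v" "g \<in> carrier G" | g e t where "y = Inner g e t" "g \<in> carrier G" "0 < t" "t < 1"
      using \<open>y \<in> cover_points G\<close> by (auto simp: cover_points_def)
    then show ?thesis
    proof cases
      case 1
      then show ?thesis by (simp add: q_def act bH)
    next
      case 2
      then show ?thesis
        by (simp add: q_def act[symmetric] bH c2.act_closed act_geo[symmetric] rho_act_H3)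
    qed
  qed
  have im: "map_of M ` cover_points G = ?X ` map_of N ` cover_points G"
    unfolding min_marked_facts(3)[OF M(1)] min_marked_facts(3)[OF M(2)] image_image[of ?X] \<open>base_pos M = q\<close>
    using st by (auto simp: \<Gamma>'_def \<Gamma> intro!: image_cong)
  have "\<exists>W\<in>carrier G. map_of M ` cover_points G = SL2C_act (\<rho> W) ` map_of N ` cover_points G"
    using im inv_closed[OF x] by (rule bexI)
  moreover have "\<exists>h'\<in>Inn_e G. aut_of N = h' \<otimes>\<^bsub>AutoGroup G\<^esub> aut_of M"
    using aut i by (rule bexI)
  ultimately show ?thesis using mc \<Gamma> by (simp add: carrier_equiv_def)
qed

text \<open>A class is determined by the graph and a code of one minimal representative, and both
  range over finite sets.\<close>

theorem finite_minimal_carriers: "finite (minimal_carriers G a b \<rho>)"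
proof -
  have "\<exists>M. M \<in> C \<and> min_marked M" if C: "C \<in> minimal_carriers G a b \<rho>" for C
  proof -
    have CQ: "C \<in> marked_carriers G a b \<rho> // carrier_equiv G a b \<rho>"
      using C by (simp add: minimal_carriers_def geodesic_carriers_def carrier_graphs_def)
    obtain M where M: "M \<in> C" "is_geodesic G a b M"
      "\<And>C' N. \<lbrakk>C' \<in> carrier_graphs G a b \<rho>; N \<in> C'\<rbrakk> \<Longrightarrow> carrier_length G a b M \<le> carrier_length G a b N"
      using C by (auto simp: minimal_carriers_def)
    have "carrier_length G a b M \<le> carrier_length G a b N" if N: "N \<in> marked_carriers G a b \<rho>" for N
    proof (rule M(3))
      show "carrier_equiv G a b \<rho> `` {N} \<in> carrier_graphs G a b \<rho>"
        unfolding carrier_graphs_def using N by (rule quotientI)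
      show "N \<in> carrier_equiv G a b \<rho> `` {N}" using equiv_class_self[OF equiv_carrier N] .
    qed
    then show ?thesis using M in_quotient_imp_subset[OF equiv_carrier CQ] by (auto simp: min_marked_def)
  qed
  then obtain R where R: "\<And>C. C \<in> minimal_carriers G a b \<rho> \<Longrightarrow> R C \<in> C \<and> min_marked (R C)" by metis
  obtain f where f: "\<And>M. min_marked M \<Longrightarrow> has_code M (f M)" using has_code_exists by metis
  define F where "F C = (graph_of (R C), f (R C))" for C
  have "inj_on F (minimal_carriers G a b \<rho>)"
  proof (rule inj_onI)
    fix C D assume CD: "C \<in> minimal_carriers G a b \<rho>" "D \<in> minimal_carriers G a b \<rho>" "F C = F D"
    then have "(R C, R D) \<in> carrier_equiv G a b \<rho>"
      using R f by (intro equiv_if_same_code[of _ _ "f (R C)"]) (auto simp: F_def, metis)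
    then show "C = D"
      using CD(1,2) R[OF CD(1)] R[OF CD(2)] quotient_eqI[OF equiv_carrier, of C D "R C" "R D"]
      by (simp add: minimal_carriers_def geodesic_carriers_def carrier_graphs_def)
  qed
  moreover have "F ` minimal_carriers G a b \<rho> \<subseteq> {Buckle, Dumbbell} \<times> {c. \<exists>M. min_marked M \<and> has_code M c}"
  proof (rule image_subsetI)
    fix C assume C: "C \<in> minimal_carriers G a b \<rho>"
    have "graph_of (R C) \<in> {Buckle, Dumbbell}" by (cases "graph_of (R C)") auto
    then show "F C \<in> {Buckle, Dumbbell} \<times> {c. \<exists>M. min_marked M \<and> has_code M c}"
      using R[OF C] f[of "R C"] unfolding F_def by blast
  qed
  then have "finite (F ` minimal_carriers G a b \<rho>)"
    by (rule finite_subset) (intro finite_cartesian_product finite_codes, simp)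
  ultimately show ?thesis by (rule finite_imageD[rotated])
qed

end

theorem corollary1p2:
  fixes G :: "('g, 'm) monoid_scheme" and X0 Y0 :: 'g and \<rho> :: "'g \<Rightarrow> complex^2^2"
  assumes "group G" and "free_basis G X0 Y0"
    and "\<rho> \<in> hom G SL2C"
    and "irreducible_rep G \<rho>"
    and "BQ_conditions G \<rho>"
  shows "finite (minimal_carriers G X0 Y0 \<rho>)"
proof -
  interpret group G by fact
  interpret BQ_rep G X0 Y0 \<rho> by unfold_locales (use assms in auto)
  show ?thesis by (rule finite_minimal_carriers)
qed

end
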